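(* Let $\mathcal{L}=\mathcal{S}\dot{+}\mathcal{I}$ be an indecomposable semisimple Leibniz algebra, where $\mathcal{I}=\mathrm{span}\{[x,x]:x\in\mathcal{L}\}\neq 0$ and $\mathcal{S}$ is a semisimple Lie subalgebra. Then $$\mathrm{Aut}(\mathcal{L})=\mathrm{Aut}(\mathcal{L})_{\mathcal{S}}\ltimes\mathrm{Aut}(\mathcal{L})_0,$$ i.e. $\mathrm{Aut}(\mathcal{L})$ is the internal semidirect product of its subgroup $\mathrm{Aut}(\mathcal{L})_{\mathcal{S}}$ and its normal subgroup $\mathrm{Aut}(\mathcal{L})_0$.
   Context: All vector spaces and algebras are finite-dimensional over $\mathbb{C}$. A (right) Leibniz algebra is a vector space $\mathcal{L}$ with a bilinear bracket satisfying $[x,[y,z]]=[[x,y],z]-[[x,z],y]$ for all $x,y,z$. The subspace $\mathcal{I}=\mathrm{span}\{[x,x]:x\in\mathcal{L}\}$ is an ideal with $[\mathcal{L},\mathcal{I}]=0$, and $\mathcal{L}/\mathcal{I}$ is a Lie algebra. $\mathcal{L}$ is semisimple if $\mathcal{L}/\mathcal{I}$ is a semisimple Lie algebra. In that case $\mathcal{L}=\mathcal{S}\dot{+}\mathcal{I}$ (direct sum of subspaces) with $\mathcal{S}$ a semisimple Lie subalgebra. A semisimple Leibniz algebra is decomposable if it is a direct sum of two ideals, each a nonzero semisimple Leibniz algebra (possibly a Lie algebra); otherwise it is indecomposable. $\mathrm{Aut}(\mathcal{L})$ is the group of automorphisms of $\mathcal{L}$, and $$\mathrm{Aut}(\mathcal{L})_{\mathcal{S}}=\{\varphi\in\mathrm{Aut}(\mathcal{L}):\varphi(\mathcal{S})=\mathcal{S}\},\qquad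 \mathrm{Aut}(\mathcal{L})_0=\{\varphi\in\mathrm{Aut}(\mathcal{L}):\varphi|_{\mathcal{I}}=\mathrm{id}_{\mathcal{I}}\}.$$ *)

theory Defs
  imports Complex_Main "HOL-Algebra.Bij" "HOL-Algebra.QuotRing" "Jordan_Normal_Form.VS_Connect"
begin

abbreviation CC :: "complex ring" where
  "CC \<equiv> class_ring"

text \<open>As for every \<^typ>\<open>('a, 'b) module\<close> record, the fields \<open>mult\<close> and \<open>one\<close> inherited from
  rings play no role.\<close>

record 'v leibniz = "(complex, 'v) module" +
  bracket :: "'v \<Rightarrow> 'v \<Rightarrow> 'v" (\<open>\<lbrace>_,/ _\<rbrace>\<index>\<close>)

locale leibniz_algebra = vectorspace CC L for L :: "'v leibniz" (structure) +
  assumes finite_dimensional: "fin_dim"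
    and bracket_closed: "\<lbrakk>x \<in> carrier L; y \<in> carrier L\<rbrakk> \<Longrightarrow> \<lbrace>x, y\<rbrace> \<in> carrier L"
    and bracket_add_left: "\<lbrakk>x \<in> carrier L; y \<in> carrier L; z \<in> carrier L\<rbrakk>
      \<Longrightarrow> \<lbrace>x \<oplus> y, z\<rbrace> = \<lbrace>x, z\<rbrace> \<oplus> \<lbrace>y, z\<rbrace>"
    and bracket_add_right: "\<lbrakk>x \<in> carrier L; y \<in> carrier L; z \<in> carrier L\<rbrakk>
      \<Longrightarrow> \<lbrace>x, y \<oplus> z\<rbrace> = \<lbrace>x, y\<rbrace> \<oplus> \<lbrace>x, z\<rbrace>"
    and bracket_smult_left: "\<lbrakk>x \<in> carrier L; y \<in> carrier L\<rbrakk>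
      \<Longrightarrow> \<lbrace>c \<odot>\<^bsub>L\<^esub> x, y\<rbrace> = c \<odot>\<^bsub>L\<^esub> \<lbrace>x, y\<rbrace>"
    and bracket_smult_right: "\<lbrakk>x \<in> carrier L; y \<in> carrier L\<rbrakk>
      \<Longrightarrow> \<lbrace>x, c \<odot>\<^bsub>L\<^esub> y\<rbrace> = c \<odot>\<^bsub>L\<^esub> \<lbrace>x, y\<rbrace>"
    and leibniz_identity: "\<lbrakk>x \<in> carrier L; y \<in> carrier L; z \<in> carrier L\<rbrakk>
      \<Longrightarrow> \<lbrace>x, \<lbrace>y, z\<rbrace>\<rbrace> = \<lbrace>\<lbrace>x, y\<rbrace>, z\<rbrace> \<ominus> \<lbrace>\<lbrace>x, z\<rbrace>, y\<rbrace>"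

text \<open>For an alternating bracket the Leibniz identity is the Jacobi identity.\<close>

locale lie_algebra = leibniz_algebra +
  assumes bracket_self: "x \<in> carrier L \<Longrightarrow> \<lbrace>x, x\<rbrace> = \<zero>"

definition leibniz_subalgebra :: "'v leibniz \<Rightarrow> 'v set \<Rightarrow> bool" where
  "leibniz_subalgebra L A \<longleftrightarrow>
     VectorSpace.subspace CC A L \<and> (\<forall>x\<in>A. \<forall>y\<in>A. \<lbrace>x, y\<rbrace>\<^bsub>L\<^esub> \<in> A)"

definition leibniz_ideal :: "'v leibniz \<Rightarrow> 'v set \<Rightarrow> bool" where
  "leibniz_ideal L J \<longleftrightarrow>
     VectorSpace.subspace CC J L \<and>
     (\<forall>x\<in>carrier L. \<forall>j\<in>J. \<lbrace>x, j\<rbrace>\<^bsub>L\<^esub> \<in> J \<and> \<lbrace>j, x\<rbrace>\<^bsub>L\<^esub> \<in> J)"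

definition leibniz_kernel :: "'v leibniz \<Rightarrow> 'v set" where
  "leibniz_kernel L = LinearCombinations.module.span CC L {\<lbrace>x, x\<rbrace>\<^bsub>L\<^esub> | x. x \<in> carrier L}"

text \<open>The quotient by an ideal, on additive cosets, in the style of \<^const>\<open>FactRing\<close>.\<close>

definition leibniz_quotient :: "'v leibniz \<Rightarrow> 'v set \<Rightarrow> 'v set leibniz" where
  "leibniz_quotient L J =
    \<lparr>carrier = a_rcosets\<^bsub>L\<^esub> J, mult = (\<lambda>_ _. J), one = J, zero = J, add = set_add L,
     smult = (\<lambda>c A. \<Union>a\<in>A. J +>\<^bsub>L\<^esub> (c \<odot>\<^bsub>L\<^esub> a)),
     bracket = (\<lambda>A B. \<Union>a\<in>A. \<Union>b\<in>B. J +>\<^bsub>L\<^esub> \<lbrace>a, b\<rbrace>\<^bsub>L\<^esub>)\<rparr>"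

primrec derived_series :: "'v leibniz \<Rightarrow> nat \<Rightarrow> 'v set" where
  "derived_series L 0 = carrier L"
| "derived_series L (Suc n) = LinearCombinations.module.span CC L
     {\<lbrace>x, y\<rbrace>\<^bsub>L\<^esub> | x y. x \<in> derived_series L n \<and> y \<in> derived_series L n}"

definition solvable_algebra :: "'v leibniz \<Rightarrow> bool" where
  "solvable_algebra L \<longleftrightarrow> (\<exists>n. derived_series L n = {\<zero>\<^bsub>L\<^esub>})"

text \<open>The radical, i.e. the largest solvable ideal, is zero. The zero algebra is semisimple
  in this sense.\<close>

definition semisimple_lie :: "'v leibniz \<Rightarrow> bool" where
  "semisimple_lie G \<longleftrightarrow> lie_algebra G \<and>
     (\<forall>J. leibniz_ideal G J \<and> solvable_algebra (G\<lparr>carrier := J\<rparr>) \<longrightarrow> J = {\<zero>\<^bsub>G\<^esub>})"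

definition semisimple_leibniz :: "'v leibniz \<Rightarrow> bool" where
  "semisimple_leibniz L \<longleftrightarrow>
     leibniz_algebra L \<and> semisimple_lie (leibniz_quotient L (leibniz_kernel L))"

definition internal_direct_sum :: "'v leibniz \<Rightarrow> 'v set \<Rightarrow> 'v set \<Rightarrow> bool" where
  "internal_direct_sum L A B \<longleftrightarrow>
     VectorSpace.subspace CC A L \<and> VectorSpace.subspace CC B L \<and>
     A \<inter> B = {\<zero>\<^bsub>L\<^esub>} \<and> A <+>\<^bsub>L\<^esub> B = carrier L"

definition decomposable :: "'v leibniz \<Rightarrow> bool" where
  "decomposable L \<longleftrightarrow> (\<exists>A B.
     leibniz_ideal L A \<and> leibniz_ideal L B \<and> internal_direct_sum L A B \<and>
     A \<noteq> {\<zero>\<^bsub>L\<^esub>} \<and> B \<noteq> {\<zero>\<^bsub>L\<^esub>} \<and>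
     semisimple_leibniz (L\<lparr>carrier := A\<rparr>) \<and> semisimple_leibniz (L\<lparr>carrier := B\<rparr>))"

definition leibniz_auto :: "'v leibniz \<Rightarrow> ('v \<Rightarrow> 'v) set" where
  "leibniz_auto L = {\<phi> \<in> Bij (carrier L). \<phi> \<in> LinearCombinations.module_hom CC L L \<and>
     (\<forall>x\<in>carrier L. \<forall>y\<in>carrier L. \<phi> \<lbrace>x, y\<rbrace>\<^bsub>L\<^esub> = \<lbrace>\<phi> x, \<phi> y\<rbrace>\<^bsub>L\<^esub>)}"

definition leibniz_Aut :: "'v leibniz \<Rightarrow> ('v \<Rightarrow> 'v) monoid" where
  "leibniz_Aut L = BijGroup (carrier L) \<lparr>carrier := leibniz_auto L\<rparr>"

definition Aut_stab :: "'v leibniz \<Rightarrow> 'v set \<Rightarrow> ('v \<Rightarrow> 'v) set" where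
  "Aut_stab L S = {\<phi> \<in> leibniz_auto L. \<phi> ` S = S}"

definition Aut_zero :: "'v leibniz \<Rightarrow> ('v \<Rightarrow> 'v) set" where
  "Aut_zero L = {\<phi> \<in> leibniz_auto L. \<forall>x\<in>leibniz_kernel L. \<phi> x = x}"

definition internal_semidirect_product :: "('g, 'm) monoid_scheme \<Rightarrow> 'g set \<Rightarrow> 'g set \<Rightarrow> bool" where
  "internal_semidirect_product G H N \<longleftrightarrow>
     group G \<and> subgroup H G \<and> N \<lhd> G \<and> H \<inter> N = {\<one>\<^bsub>G\<^esub>} \<and> H <#>\<^bsub>G\<^esub> N = carrier G"

end

theory Submission
  imports Defs "Jordan_Normal_Form.Jordan_Normal_Form_Existence"
begin

text \<open>Let \<open>I\<close> be the kernel and \<open>p\<close> the projection onto \<open>S\<close> along \<open>I\<close>. Since \<open>[L, I] = 0\<close>, replacing an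
  automorphism \<open>f\<close> by \<open>s + i \<mapsto> p (f s) + f i\<close> again gives an automorphism; it stabilizes \<open>S\<close> and agrees with \<open>f\<close>
  on \<open>I\<close>, so it differs from \<open>f\<close> by an automorphism that fixes \<open>I\<close>. If \<open>f\<close> stabilizes \<open>S\<close> and fixes \<open>I\<close>, then
  \<open>f s - s\<close> acts trivially on \<open>I\<close>, and it remains to see that the annihilator of \<open>I\<close> in \<open>S\<close> is zero. Otherwise
  it contains a minimal ideal \<open>M\<close> of \<open>S\<close>, the orthogonal \<open>B\<close> of \<open>M\<close> for the trace form of \<open>M\<close> is a
  complementary ideal, and \<open>L\<close> is decomposed by \<open>M\<close> and \<open>B + I\<close>. That the trace form does not vanish on \<open>M\<close>
  is Cartan's criterion.\<close>

section \<open>Coordinates and traces\<close>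

text \<open>\<open>M\<close> is chosen minimal so that Cartan's criterion meets an algebra that
  equals its derived algebra and has center zero: [M, M] and the center of \<open>M\<close> are
  ideals of \<open>S\<close>, and a nonzero abelian ideal is excluded by semisimplicity. If the
  trace form vanished on \<open>M\<close>, every right multiplication of \<open>M\<close> would be
  nilpotent, and Engel's theorem would produce a nonzero central element. The form is evaluated on
  all of \<open>S\<close>, which acts on the ideal \<open>M\<close>; hence its orthogonal
  \<open>B\<close> is an ideal of \<open>S\<close>, and nondegeneracy on \<open>M\<close> gives both
  M \<inter> B = 0 and M + B = S.

  The asymmetry of a right Leibniz algebra carries the construction of the stabilizing automorphism:
  a component in \<open>I\<close> is invisible as the right argument of a bracket, so [f i, f s] =
  [f i, p (f s)]. To contradict indecomposability, both summands must be semisimple in the sense of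
  the definition, that is through the quotient by their own kernel. This is why isomorphisms between
  an algebra on vectors and one on cosets appear.\<close>

lemma CC_simps [simp]: "carrier CC = UNIV" "add CC = (+)" "monoid.mult CC = (*)" "\<zero>\<^bsub>CC\<^esub> = 0" "\<one>\<^bsub>CC\<^esub> = 1"
  by (simp_all add: class_ring_simps)

section \<open>Subspaces and spans of complex vector spaces\<close>

context
  fixes V :: "(complex, 'v, 'm) module_scheme" (structure)
  assumes V: "vectorspace CC V"
begin

interpretation vectorspace CC V by (rule V)

lemma subspace_CC_iff:
  "VectorSpace.subspace CC W V \<longleftrightarrow> W \<subseteq> carrier V \<and> \<zero> \<in> W \<and>
    (\<forall>v\<in>W. \<forall>w\<in>W. v \<oplus> w \<in> W) \<and> (\<forall>c. \<forall>v\<in>W. c \<odot>\<^bsub>V\<^esub> v \<in> W)"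
  unfolding VectorSpace.subspace_def LinearCombinations.submodule_def
  using V module_axioms by auto

lemma subspace_CC_uminus:
  assumes "VectorSpace.subspace CC W V" "v \<in> W"
  shows "\<ominus> v \<in> W"
proof -
  have "v \<in> carrier V" using assms by (auto simp: subspace_CC_iff)
  then have "\<ominus> v = (\<ominus>\<^bsub>CC\<^esub> \<one>\<^bsub>CC\<^esub>) \<odot>\<^bsub>V\<^esub> v"
    using smult_minus_1 by metis
  then show ?thesis using assms by (simp add: subspace_CC_iff)
qed

lemma subspace_CC_minus:
  assumes "VectorSpace.subspace CC W V" "v \<in> W" "w \<in> W"
  shows "v \<ominus> w \<in> W"
  using assms subspace_CC_uminus[OF assms(1,3)] by (auto simp: a_minus_def subspace_CC_iff)

lemma subspace_CC_span:
  assumes "X \<subseteq> carrier V"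
  shows "VectorSpace.subspace CC (span X) V"
  using assms by (simp add: span_is_subspace)

lemma subspace_CC_restrict:
  assumes "VectorSpace.subspace CC W V" "X \<subseteq> W"
  shows "VectorSpace.subspace CC X (V\<lparr>carrier := W\<rparr>) \<longleftrightarrow> VectorSpace.subspace CC X V"
proof -
  have "vectorspace CC (V\<lparr>carrier := W\<rparr>)"
    using assms(1) by (rule subspace_is_vs)
  then show ?thesis
    using assms V module_axioms
    by (auto simp: subspace_CC_iff VectorSpace.subspace_def LinearCombinations.submodule_def vectorspace_def)
qed

lemma span_CC_restrict:
  assumes "VectorSpace.subspace CC W V" "X \<subseteq> W"
  shows "LinearCombinations.module.span CC (V\<lparr>carrier := W\<rparr>) X = span X"
  using assms by (simp add: span_li_not_depend)

lemma span_CC_least: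
  assumes "VectorSpace.subspace CC W V" "X \<subseteq> W"
  shows "span X \<subseteq> W"
  using assms by (simp add: span_is_subset)

end

section \<open>Coordinate vectors, matrices and traces of endomorphisms\<close>

lemma linear_vec_expand:
  fixes g :: "complex vec \<Rightarrow> complex vec"
  assumes closed: "\<And>v. v \<in> carrier_vec n \<Longrightarrow> g v \<in> carrier_vec m"
    and add: "\<And>v w. v \<in> carrier_vec n \<Longrightarrow> w \<in> carrier_vec n \<Longrightarrow> g (v + w) = g v + g w"
    and smult: "\<And>a v. v \<in> carrier_vec n \<Longrightarrow> g (a \<cdot>\<^sub>v v) = a \<cdot>\<^sub>v g v"
    and v: "v \<in> carrier_vec n" and i: "i < m"
  shows "g v $ i = (\<Sum>j<n. v $ j * g (unit_vec n j) $ i)"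
proof -
  have g0: "g (0\<^sub>v n) $ i = 0"
    using smult[of "0\<^sub>v n" 0] closed[of "0\<^sub>v n"] i
    by (auto simp: smult_vec_def zero_vec_def)
  \<comment> \<open>Truncating \<open>v\<close> after its first \<open>k\<close> entries turns
    linearity into an induction. Since \<open>g\<close> is only controlled on vectors of dimension
    \<open>n\<close>, the truncations keep that dimension and are padded with zeros.\<close>
  have "k \<le> n \<Longrightarrow> g (vec n (\<lambda>j. if j < k then v $ j else 0)) $ i = (\<Sum>j<k. v $ j * g (unit_vec n j) $ i)" for k
  proof (induction k)
    case 0
    have "vec n (\<lambda>j. if j < 0 then v $ j else 0) = 0\<^sub>v n" by auto
    then show ?case using g0 by simp
  next
    case (Suc k)
    let ?w = "vec n (\<lambda>j. if j < k then v $ j else 0)"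
    have eq: "vec n (\<lambda>j. if j < Suc k then v $ j else 0) = ?w + v $ k \<cdot>\<^sub>v unit_vec n k"
      using Suc.prems by (intro eq_vecI) (auto simp: less_Suc_eq)
    have "g (vec n (\<lambda>j. if j < Suc k then v $ j else 0)) = g ?w + v $ k \<cdot>\<^sub>v g (unit_vec n k)"
      unfolding eq by (simp add: add smult)
    then show ?case
      using Suc i closed[of ?w] closed[of "unit_vec n k"] by auto
  qed
  from this[of n] have "g (vec n (\<lambda>j. if j < n then v $ j else 0)) $ i = (\<Sum>j<n. v $ j * g (unit_vec n j) $ i)"
    by simp
  moreover have "vec n (\<lambda>j. if j < n then v $ j else 0) = v"
    using v by auto
  ultimately show ?thesis by simp
qed

lemma sum_diag_mult_commute:
  fixes A B :: "complex mat"
  assumes "A \<in> carrier_mat n n" "B \<in> carrier_mat n n"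
  shows "(\<Sum>i<n. (A * B) $$ (i, i)) = (\<Sum>i<n. (B * A) $$ (i, i))"
proof -
  have *: "(\<Sum>i<n. (A * B) $$ (i, i)) = (\<Sum>i<n. \<Sum>k<n. A $$ (i, k) * B $$ (k, i))"
    if "A \<in> carrier_mat n n" "B \<in> carrier_mat n n" for A B :: "complex mat"
    using that by (simp add: scalar_prod_def lessThan_atLeast0)
  show ?thesis
    unfolding *[OF assms] *[OF assms(2,1)] by (subst sum.swap) (simp add: mult.commute)
qed

text \<open>Mutually inverse maps between \<open>V\<close> and coordinate vectors make the matrix
  library, and with it the Jordan normal form, available on an abstract carrier. Linearity is
  required of \<open>c\<close> alone; that of \<open>e\<close> follows because \<open>c\<close> is
  injective.\<close>

locale coordinates = vectorspace CC V for V :: "(complex, 'v, 'm) module_scheme" (structure) +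
  fixes n :: nat and e :: "complex vec \<Rightarrow> 'v" and c :: "'v \<Rightarrow> complex vec"
  assumes e_closed [simp]: "v \<in> carrier_vec n \<Longrightarrow> e v \<in> carrier V"
    and c_closed [simp]: "x \<in> carrier V \<Longrightarrow> c x \<in> carrier_vec n"
    and c_e [simp]: "v \<in> carrier_vec n \<Longrightarrow> c (e v) = v"
    and e_c [simp]: "x \<in> carrier V \<Longrightarrow> e (c x) = x"
    and c_add [simp]: "x \<in> carrier V \<Longrightarrow> y \<in> carrier V \<Longrightarrow> c (x \<oplus> y) = c x + c y"
    and c_smult [simp]: "x \<in> carrier V \<Longrightarrow> c (a \<odot>\<^bsub>V\<^esub> x) = a \<cdot>\<^sub>v c x"
begin

lemma c_eqD: "c x = c y \<Longrightarrow> x \<in> carrier V \<Longrightarrow> y \<in> carrier V \<Longrightarrow> x = y"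
  by (metis e_c)

lemma c_dim [simp]: "x \<in> carrier V \<Longrightarrow> dim_vec (c x) = n"
  using c_closed by (auto simp del: c_closed)

lemma smult_closed' [simp]: "x \<in> carrier V \<Longrightarrow> a \<odot>\<^bsub>V\<^esub> x \<in> carrier V"
  by simp

lemma e_add: "v \<in> carrier_vec n \<Longrightarrow> w \<in> carrier_vec n \<Longrightarrow> e (v + w) = e v \<oplus> e w"
  by (rule c_eqD) auto

lemma e_smult: "v \<in> carrier_vec n \<Longrightarrow> e (a \<cdot>\<^sub>v v) = a \<odot>\<^bsub>V\<^esub> e v"
  by (rule c_eqD) auto

lemma c_zero [simp]: "c \<zero> = 0\<^sub>v n"
proof -
  have "c \<zero> = 0 \<cdot>\<^sub>v c \<zero>"
    using lmult_0[of \<zero>] c_smult[of \<zero> 0] by simp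
  then show ?thesis by (intro eq_vecI) (auto simp: smult_vec_def)
qed

definition op_mat :: "('v \<Rightarrow> 'v) \<Rightarrow> complex mat" where
  "op_mat f = mat n n (\<lambda>(i, j). c (f (e (unit_vec n j))) $ i)"

text \<open>Reading off diagonal entries makes sense for every function, so additivity asks only for
  closure and congruence only for agreement on the carrier. Linearity enters through
  \<open>op_mat\<close>, in \<open>op_trace_commute\<close>.\<close>

definition op_trace :: "('v \<Rightarrow> 'v) \<Rightarrow> complex" where
  "op_trace f = (\<Sum>i<n. c (f (e (unit_vec n i))) $ i)"

lemma op_mat_carrier [simp]: "op_mat f \<in> carrier_mat n n"
  by (simp add: op_mat_def)

lemma op_mat_mult_vec:
  assumes f: "f \<in> LinearCombinations.module_hom CC V V" and x: "x \<in> carrier V"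
  shows "op_mat f *\<^sub>v c x = c (f x)"
proof -
  have fc: "y \<in> carrier V \<Longrightarrow> f y \<in> carrier V" for y
    using f by (auto simp: LinearCombinations.module_hom_def)
  have fa: "f (y \<oplus> z) = f y \<oplus> f z" if "y \<in> carrier V" "z \<in> carrier V" for y z
    using f that by (auto simp: LinearCombinations.module_hom_def)
  have fs: "f (a \<odot>\<^bsub>V\<^esub> y) = a \<odot>\<^bsub>V\<^esub> f y" if "y \<in> carrier V" for a y
    using f that by (auto simp: LinearCombinations.module_hom_def)
  show ?thesis
  proof (rule eq_vecI)
    fix i assume "i < dim_vec (c (f x))"
    then have i: "i < n" using x fc by simp
    have "c (f (e (c x))) $ i = (\<Sum>j<n. c x $ j * c (f (e (unit_vec n j))) $ i)"
      by (rule linear_vec_expand[where m = n])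
        (use i x fc in \<open>auto simp: fa fs e_add e_smult\<close>)
    then show "(op_mat f *\<^sub>v c x) $ i = c (f x) $ i"
      using i x by (simp add: op_mat_def scalar_prod_def mult.commute lessThan_atLeast0)
  qed (use x fc in \<open>simp_all add: op_mat_def\<close>)
qed

lemma op_trace_mt: "op_trace f = (\<Sum>i<n. op_mat f $$ (i, i))"
  by (simp add: op_trace_def op_mat_def)

lemma op_mat_comp:
  assumes f: "f \<in> LinearCombinations.module_hom CC V V" and g: "g \<in> LinearCombinations.module_hom CC V V"
  shows "op_mat (\<lambda>x. f (g x)) = op_mat f * op_mat g"
proof (rule eq_matI)
  fix i j assume "i < dim_row (op_mat f * op_mat g)" "j < dim_col (op_mat f * op_mat g)"
  then have ij: "i < n" "j < n" by (auto simp: op_mat_def)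
  have ge: "g (e (unit_vec n j)) \<in> carrier V"
    using g by (auto simp: LinearCombinations.module_hom_def)
  have "col (op_mat g) j = c (g (e (unit_vec n j)))"
    using ij ge by (auto simp: op_mat_def)
  then show "op_mat (\<lambda>x. f (g x)) $$ (i, j) = (op_mat f * op_mat g) $$ (i, j)"
    using ij op_mat_mult_vec[OF f ge, symmetric] by (simp add: op_mat_def)
qed (auto simp: op_mat_def)

lemma op_trace_commute:
  assumes f: "f \<in> LinearCombinations.module_hom CC V V" and g: "g \<in> LinearCombinations.module_hom CC V V"
  shows "op_trace (\<lambda>x. f (g x)) = op_trace (\<lambda>x. g (f x))"
  unfolding op_trace_mt op_mat_comp[OF f g] op_mat_comp[OF g f] by (rule sum_diag_mult_commute) simp_all

lemma op_trace_add:
  assumes "\<And>x. x \<in> carrier V \<Longrightarrow> f x \<in> carrier V" "\<And>x. x \<in> carrier V \<Longrightarrow> g x \<in> carrier V"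
  shows "op_trace (\<lambda>x. f x \<oplus> g x) = op_trace f + op_trace g"
  using assms by (simp add: op_trace_def sum.distrib)

lemma op_trace_smult:
  assumes "\<And>x. x \<in> carrier V \<Longrightarrow> f x \<in> carrier V"
  shows "op_trace (\<lambda>x. a \<odot>\<^bsub>V\<^esub> f x) = a * op_trace f"
  using assms by (simp add: op_trace_def sum_distrib_left)

lemma op_trace_minus:
  assumes "\<And>x. x \<in> carrier V \<Longrightarrow> f x \<in> carrier V" "\<And>x. x \<in> carrier V \<Longrightarrow> g x \<in> carrier V"
  shows "op_trace (\<lambda>x. f x \<ominus> g x) = op_trace f - op_trace g"
proof -
  have "\<ominus> y = (- 1) \<odot>\<^bsub>V\<^esub> y" if "y \<in> carrier V" for y
    using smult_minus_1[OF that] by (simp add: class_ring_simps)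
  then have "c (x \<ominus> y) = c x - c y" if "x \<in> carrier V" "y \<in> carrier V" for x y
    using that by (auto simp: a_minus_def)
  then show ?thesis using assms by (simp add: op_trace_def sum_subtractf)
qed

lemma op_trace_cong: "(\<And>x. x \<in> carrier V \<Longrightarrow> f x = g x) \<Longrightarrow> op_trace f = op_trace g"
  by (simp add: op_trace_def)

end

section \<open>Bases, dimension and extremal subspaces\<close>

context
  fixes V :: "(complex, 'v, 'm) module_scheme" (structure)
  assumes V: "vectorspace CC V"
begin

interpretation vectorspace CC V by (rule V)

lemma coordinates_exist:
  assumes "fin_dim"
  obtains n e c where "coordinates V n e c"
proof -
  obtain B where B: "finite B" "lin_indpt B" "span B = carrier V" "B \<subseteq> carrier V"
    using finite_basis_exists[OF assms] by (auto simp: basis_def)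
  define n where "n = card B"
  obtain p where p: "bij_betw p {0..<n} B"
    using ex_bij_betw_nat_finite[OF B(1)] by (auto simp: n_def)
  define q where "q = inv_into {0..<n} p"
  have q: "q x < n" "p (q x) = x" if "x \<in> B" for x
    using that p bij_betw_inv_into[OF p] by (auto simp: q_def bij_betw_def inv_into_into f_inv_into_f)
  have qp: "q (p i) = i" "p i \<in> B" if "i < n" for i
    using that p by (auto simp: q_def bij_betw_def)
  define e where "e v = lincomb (\<lambda>x. v $ q x) B" for v
  have e_add: "e (v + w) = e v \<oplus> e w" if "v \<in> carrier_vec n" "w \<in> carrier_vec n" for v w
  proof -
    have "e (v + w) = lincomb (\<lambda>x. v $ q x \<oplus>\<^bsub>CC\<^esub> w $ q x) B"
      unfolding e_def using that B q by (intro lincomb_cong) auto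
    then show ?thesis
      using lincomb_sum[OF B(1,4), of "\<lambda>x. v $ q x" "\<lambda>x. w $ q x"] by (simp add: e_def)
  qed
  have e_smult: "e (a \<cdot>\<^sub>v v) = a \<odot>\<^bsub>V\<^esub> e v" if "v \<in> carrier_vec n" for a v
  proof -
    have "e (a \<cdot>\<^sub>v v) = lincomb (\<lambda>x. a \<otimes>\<^bsub>CC\<^esub> v $ q x) B"
      unfolding e_def using that B q by (intro lincomb_cong) auto
    then show ?thesis
      using lincomb_smult[OF B(4), of "\<lambda>x. v $ q x" a] by (simp add: e_def)
  qed
  have e_closed: "e v \<in> carrier V" for v
    unfolding e_def using B by (intro lincomb_closed) auto
  have inj: "inj_on e (carrier_vec n)"
  proof (rule inj_onI, rule ccontr)
    fix v w assume vw: "v \<in> carrier_vec n" "w \<in> carrier_vec n" "e v = e w" "v \<noteq> w"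
    then obtain i where i: "i < n" "v $ i \<noteq> w $ i" by (metis eq_vecI carrier_vecD)
    have "lincomb (\<lambda>x. v $ q x \<ominus>\<^bsub>CC\<^esub> w $ q x) B = e v \<ominus> e w"
      using lincomb_diff[OF B(1,4), of "\<lambda>x. v $ q x" "\<lambda>x. w $ q x"] by (simp add: e_def)
    also have "\<dots> = \<zero>"
      using vw(3) e_closed by (simp add: r_neg a_minus_def)
    \<comment> \<open>Two distinct vectors with the same image give a vanishing combination of
      \<open>B\<close> whose coefficient at \<open>p i\<close> is nonzero.\<close>
    finally have "lin_dep B"
      using i qp[of i] B
      by (intro lin_dep_crit[of B B "\<lambda>x. v $ q x \<ominus>\<^bsub>CC\<^esub> w $ q x" "p i"]) (auto simp: class_ring_simps)
    then show False using B(2) by simp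
  qed
  have surj: "e ` carrier_vec n = carrier V"
  proof (intro equalityI subsetI)
    fix x assume "x \<in> carrier V"
    then obtain a where a: "lincomb a B = x"
      using B finite_in_span[of B x] by auto
    have "e (vec n (\<lambda>i. a (p i))) = lincomb a B"
      unfolding e_def using B q by (intro lincomb_cong) auto
    then show "x \<in> e ` carrier_vec n" using a by (metis imageI vec_carrier)
  qed (use e_closed in auto)
  define c where "c = inv_into (carrier_vec n) e"
  have c: "c x \<in> carrier_vec n" "e (c x) = x" if "x \<in> carrier V" for x
    using that surj by (auto simp: c_def inv_into_into f_inv_into_f)
  have ce: "c (e v) = v" if "v \<in> carrier_vec n" for v
    using that inj by (simp add: c_def)
  have "coordinates V n e c"
  proof unfold_locales
    fix x y a assume xy: "x \<in> carrier V" "y \<in> carrier V"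
    have "c (e (c x + c y)) = c (x \<oplus> y)"
      using xy by (simp add: e_add c)
    then show "c (x \<oplus> y) = c x + c y" using xy c by (simp add: ce)
  next
    fix x y a assume xy: "x \<in> carrier V"
    have "c (e (a \<cdot>\<^sub>v c x)) = c (a \<odot>\<^bsub>V\<^esub> x)"
      using xy by (simp add: e_smult c)
    then show "c (a \<odot>\<^bsub>V\<^esub> x) = a \<cdot>\<^sub>v c x" using xy c by (simp add: ce)
  qed (auto simp: e_closed c ce)
  then show thesis using that by blast
qed

text \<open>Independence in \<open>W\<close> and in \<open>V\<close> agree, so \<open>dim\<close>
  bounds the size of independent subsets of \<open>W\<close>; a maximal one generates
  \<open>W\<close>.\<close>

lemma subspace_fin_dim:
  assumes fd: fin_dim and W: "VectorSpace.subspace CC W V"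
  shows "vectorspace.fin_dim CC (V\<lparr>carrier := W\<rparr>)"
proof -
  interpret W: vectorspace CC "V\<lparr>carrier := W\<rparr>"
    by (rule subspace_is_vs[OF W])
  have sub: "W \<subseteq> carrier V" using W V by (simp add: subspace_CC_iff)
  have li: "W.lin_dep X = lin_dep X" if "X \<subseteq> W" for X
    using that W by (simp add: span_li_not_depend)
  have "lin_indpt {}" by (simp add: lin_dep_def)
  then obtain X where X: "finite X" "maximal X (\<lambda>X. X \<subseteq> W \<and> lin_indpt X)"
    using maximal_exists[of "\<lambda>X. X \<subseteq> W \<and> lin_indpt X" dim "{}"] li_le_dim[OF fd] sub by blast
  have "maximal X (\<lambda>X. X \<subseteq> carrier (V\<lparr>carrier := W\<rparr>) \<and> W.lin_indpt X)"
    using X(2) li by (auto simp: maximal_def)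
  then have "W.gen_set X" by (rule W.max_li_is_gen)
  moreover have "X \<subseteq> W" using X(2) by (simp add: maximal_def)
  ultimately show ?thesis using X(1) by (auto simp: W.fin_dim_def)
qed

text \<open>The rank of \<open>W\<close> is the largest size of an independent subset of
  \<open>W\<close>, in effect its dimension. Only boundedness and strict monotonicity are passed on:
  they suffice to choose maximal and minimal subspaces with a given property.\<close>

lemma strict_rank_exists:
  assumes fd: fin_dim
  shows "\<exists>(r :: 'v set \<Rightarrow> nat) N. (\<forall>W. VectorSpace.subspace CC W V \<longrightarrow> r W \<le> N) \<and>
    (\<forall>W W'. VectorSpace.subspace CC W V \<longrightarrow> VectorSpace.subspace CC W' V \<longrightarrow> W \<subset> W' \<longrightarrow> r W < r W')"
proof -
  define A where "A W = {card X |X. X \<subseteq> W \<and> lin_indpt X}" for W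
  have bound: "m \<le> dim" if "VectorSpace.subspace CC W V" "m \<in> A W" for W m
    using that li_le_dim[OF fd] V by (auto simp: A_def subspace_CC_iff)
  have fin: "finite (A W)" if "VectorSpace.subspace CC W V" for W
    using bound[OF that] finite_nat_set_iff_bounded_le by blast
  have "lin_indpt {}" by (simp add: lin_dep_def)
  then have ne: "A W \<noteq> {}" for W
    by (auto simp: A_def)
  show ?thesis
  proof (intro exI[of _ "\<lambda>W. Max (A W)"] exI[of _ dim] conjI allI impI)
    show "Max (A W) \<le> dim" if "VectorSpace.subspace CC W V" for W
      using bound[OF that] fin[OF that] ne by simp
    show "Max (A W) < Max (A W')"
      if W: "VectorSpace.subspace CC W V" and W': "VectorSpace.subspace CC W' V" and lt: "W \<subset> W'" for W W'
    proof -
      obtain X where X: "X \<subseteq> W" "lin_indpt X" "Max (A W) = card X"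
        using Max_in[OF fin[OF W] ne] by (auto simp: A_def)
      obtain v where v: "v \<in> W'" "v \<notin> W" using lt by blast
      have sub: "W \<subseteq> carrier V" "W' \<subseteq> carrier V" using W W' V by (auto simp: subspace_CC_iff)
      \<comment> \<open>The span of \<open>X\<close> stays inside \<open>W\<close>, so
        \<open>v\<close> enlarges \<open>X\<close> to an independent subset of
        \<open>W'\<close>.\<close>
      have "v \<notin> span X" using v span_CC_least[OF V W X(1)] by blast
      then have "lin_indpt (X \<union> {v})"
        using lin_dep_iff_in_span[of X v] X v sub by auto
      moreover have "X \<union> {v} \<subseteq> W'" using X v lt by blast
      ultimately have "card (X \<union> {v}) \<in> A W'" by (auto simp: A_def)
      moreover have "card (X \<union> {v}) = Suc (card X)"
        using v X li_le_dim(1)[OF fd _ X(2)] sub by (auto simp: card_insert_if)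
      ultimately show ?thesis using fin[OF W'] X(3) by (metis Max_ge Suc_le_eq)
    qed
  qed
qed

lemma maximal_subspace_exists:
  assumes fd: fin_dim and P: "P W0" "\<And>W. P W \<Longrightarrow> VectorSpace.subspace CC W V"
  obtains W where "P W" "\<And>W'. P W' \<Longrightarrow> W \<subseteq> W' \<Longrightarrow> W' = W"
proof -
  obtain r N where r: "\<forall>W. VectorSpace.subspace CC W V \<longrightarrow> r W \<le> (N :: nat)"
    "\<forall>W W'. VectorSpace.subspace CC W V \<longrightarrow> VectorSpace.subspace CC W' V \<longrightarrow> W \<subset> W' \<longrightarrow> r W < r W'"
    using strict_rank_exists[OF fd] by blast
  have "\<forall>W. P W \<longrightarrow> r W < Suc N"
    using P(2) r(1) by (simp add: less_Suc_eq_le)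
  then obtain W where "P W" "\<And>W'. P W' \<Longrightarrow> r W' \<le> r W"
    using ex_has_greatest_nat[of P W0 r "Suc N"] P(1) by blast
  then show thesis using r(2) P(2) by (intro that[of W]) (blast dest: leD)+
qed

lemma minimal_subspace_exists:
  assumes fd: fin_dim and P: "P W0" "\<And>W. P W \<Longrightarrow> VectorSpace.subspace CC W V"
  obtains W where "P W" "\<And>W'. P W' \<Longrightarrow> W' \<subseteq> W \<Longrightarrow> W' = W"
proof -
  obtain r N where r: "\<forall>W. VectorSpace.subspace CC W V \<longrightarrow> r W \<le> (N :: nat)"
    "\<forall>W W'. VectorSpace.subspace CC W V \<longrightarrow> VectorSpace.subspace CC W' V \<longrightarrow> W \<subset> W' \<longrightarrow> r W < r W'"
    using strict_rank_exists[OF fd] by blast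
  obtain W where "P W" "\<And>W'. P W' \<Longrightarrow> r W \<le> r W'"
    using ex_has_least_nat[of P W0 r] P(1) by blast
  then show thesis using r(2) P(2) by (intro that[of W]) (blast dest: leD)+
qed

end

text \<open>The two features of a Jordan matrix on which the trace argument rests: it is upper
  triangular, and a nonzero entry links only indices with the same eigenvalue, so generalized
  eigenspaces are preserved. The induction peels off the first Jordan block.\<close>

lemma jordan_matrix_nonzero:
  assumes "i < sum_list (map fst nas)" "j < sum_list (map fst nas)" "jordan_matrix nas $$ (i, j) \<noteq> 0"
  shows "i \<le> j \<and> jordan_matrix nas $$ (i, i) = jordan_matrix nas $$ (j, j)"
  using assms
proof (induction nas arbitrary: i j)
  case (Cons na nas)
  obtain m a where na: "na = (m, a)" by force
  let ?s = "sum_list (map fst nas)"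
  have J: "jordan_matrix (na # nas) =
      four_block_mat (jordan_block m a) (0\<^sub>m m ?s) (0\<^sub>m ?s m) (jordan_matrix nas)"
    using jordan_matrix_dim[of nas] by (simp add: jordan_matrix_def na Let_def)
  have ind: "jordan_matrix (na # nas) $$ (k, l) =
      (if k < m then if l < m then (if k = l then a else if Suc k = l then 1 else 0) else 0
       else if l < m then 0 else jordan_matrix nas $$ (k - m, l - m))"
    if "k < m + ?s" "l < m + ?s" for k l
    unfolding J using that by (subst index_mat_four_block) auto
  have ij: "i < m + ?s" "j < m + ?s" using Cons.prems by (auto simp: na)
  show ?case
  proof (cases "i < m \<or> j < m")
    case True
    then show ?thesis using Cons.prems(3) ij by (auto simp: ind split: if_splits)
  next
    case False
    then have "jordan_matrix nas $$ (i - m, j - m) \<noteq> 0" using Cons.prems(3) ij by (simp add: ind)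
    then have "i - m \<le> j - m \<and> jordan_matrix nas $$ (i - m, i - m) = jordan_matrix nas $$ (j - m, j - m)"
      using ij False by (intro Cons.IH) auto
    then show ?thesis using False ij by (auto simp: ind)
  qed
qed simp

context coordinates
begin

text \<open>The coordinates of \<open>x\<close> become \<open>Q\<close> applied to
  \<open>c x\<close>, hence matrices are conjugated; the trace survives because \<open>Q\<close> can
  be moved cyclically past the other factors.\<close>

lemma change_coordinates:
  assumes P: "P \<in> carrier_mat n n" and Q: "Q \<in> carrier_mat n n" and PQ: "P * Q = 1\<^sub>m n" and QP: "Q * P = 1\<^sub>m n"
  shows "coordinates V n (\<lambda>v. e (P *\<^sub>v v)) (\<lambda>x. Q *\<^sub>v c x)" (is "coordinates _ _ ?e ?c")
    and "f \<in> LinearCombinations.module_hom CC V V \<Longrightarrow>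
      coordinates.op_mat n (\<lambda>v. e (P *\<^sub>v v)) (\<lambda>x. Q *\<^sub>v c x) f = Q * op_mat f * P"
    and "f \<in> LinearCombinations.module_hom CC V V \<Longrightarrow>
      coordinates.op_trace n (\<lambda>v. e (P *\<^sub>v v)) (\<lambda>x. Q *\<^sub>v c x) f = op_trace f"
proof -
  note car = P Q mult_mat_vec_carrier[OF P] mult_mat_vec_carrier[OF Q]
  have PQv: "P *\<^sub>v (Q *\<^sub>v v) = v" "Q *\<^sub>v (P *\<^sub>v v) = v" if "v \<in> carrier_vec n" for v
    using assoc_mult_mat_vec[OF P Q that] assoc_mult_mat_vec[OF Q P that] that by (simp_all add: PQ QP)
  show new: "coordinates V n ?e ?c"
    by unfold_locales
      (use car in \<open>auto simp: PQv mult_add_distrib_mat_vec[OF Q] mult_mat_vec[OF Q]\<close>)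
  interpret new: coordinates V n ?e ?c by (rule new)
  show op_mat: "new.op_mat f = Q * op_mat f * P" if f: "f \<in> LinearCombinations.module_hom CC V V" for f
  proof (rule eq_matI)
    fix i j assume "i < dim_row (Q * op_mat f * P)" "j < dim_col (Q * op_mat f * P)"
    then have ij: "i < n" "j < n" using P Q by auto
    have u: "unit_vec n j \<in> carrier_vec n" by simp
    have "c (f (e (P *\<^sub>v unit_vec n j))) = op_mat f *\<^sub>v (P *\<^sub>v unit_vec n j)"
      using op_mat_mult_vec[OF f, of "e (P *\<^sub>v unit_vec n j)"] car u by simp
    then have "Q *\<^sub>v c (f (e (P *\<^sub>v unit_vec n j))) = (Q * op_mat f * P) *\<^sub>v unit_vec n j"
      using assoc_mult_mat_vec[OF _ P u, of "Q * op_mat f" n] assoc_mult_mat_vec[OF Q op_mat_carrier, of "P *\<^sub>v unit_vec n j"] car u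
      by auto
    moreover have "((Q * op_mat f * P) *\<^sub>v unit_vec n j) $ i = (Q * op_mat f * P) $$ (i, j)"
      using ij car by (simp add: index_mult_mat_vec)
    ultimately show "new.op_mat f $$ (i, j) = (Q * op_mat f * P) $$ (i, j)"
      using ij by (simp add: new.op_mat_def del: index_mult_mat index_mult_mat_vec)
  qed (use car in \<open>auto simp: new.op_mat_def\<close>)
  show "new.op_trace f = op_trace f" if f: "f \<in> LinearCombinations.module_hom CC V V"
  proof -
    have "new.op_trace f = (\<Sum>i<n. (Q * (op_mat f * P)) $$ (i, i))"
      using assoc_mult_mat[OF Q op_mat_carrier P] by (simp only: new.op_trace_mt op_mat[OF f])
    also have "\<dots> = (\<Sum>i<n. (op_mat f * P * Q) $$ (i, i))"
      by (rule sum_diag_mult_commute) (use P Q in \<open>simp_all add: mult_carrier_mat[OF op_mat_carrier]\<close>)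
    also have "op_mat f * P * Q = op_mat f"
      using assoc_mult_mat[OF op_mat_carrier P Q] right_mult_one_mat[OF op_mat_carrier] by (simp add: PQ)
    finally show ?thesis by (simp add: op_trace_mt)
  qed
qed

text \<open>The characteristic polynomial splits over the complex numbers, so a Jordan form exists,
  and its similarity witness serves as the change of coordinates. Trace invariance is exported
  because the trace form is given in the old coordinates.\<close>

lemma triangular_coordinates_exist:
  assumes f: "f \<in> LinearCombinations.module_hom CC V V"
  obtains e' c' where "coordinates V n e' c'"
    "\<And>g. g \<in> LinearCombinations.module_hom CC V V \<Longrightarrow> coordinates.op_trace n e' c' g = op_trace g"
    "\<And>i j. i < n \<Longrightarrow> j < n \<Longrightarrow> coordinates.op_mat n e' c' f $$ (i, j) \<noteq> 0 \<Longrightarrow>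
      i \<le> j \<and> coordinates.op_mat n e' c' f $$ (i, i) = coordinates.op_mat n e' c' f $$ (j, j)"
proof -
  obtain as where "char_poly (op_mat f) = (\<Prod>a\<leftarrow>as. [:- a, 1:])"
    using char_poly_factorized[OF op_mat_carrier] by blast
  then obtain nas where "jordan_nf (op_mat f) nas"
    using jordan_nf_exists[OF op_mat_carrier] by blast
  then obtain P Q where PQ: "similar_mat_wit (op_mat f) (jordan_matrix nas) P Q"
    unfolding jordan_nf_def similar_mat_def by blast
  note PQ = similar_mat_witD2[OF op_mat_carrier PQ]
  note new = change_coordinates[OF PQ(6,7,1,2)]
  have dim: "sum_list (map fst nas) = n" using PQ(5) by auto
  have "Q * op_mat f * P = Q * (P * jordan_matrix nas * Q) * P" using PQ(3) by simp
  also have "\<dots> = (Q * P) * jordan_matrix nas * (Q * P)"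
    using PQ(5-7) by (simp add: assoc_mult_mat[of _ n n _ n _ n])
  also have "\<dots> = jordan_matrix nas"
    unfolding PQ(2) left_mult_one_mat[OF PQ(5)] right_mult_one_mat[OF PQ(5)] ..
  finally have "Q * op_mat f * P = jordan_matrix nas" .
  then have "coordinates.op_mat n (\<lambda>v. e (P *\<^sub>v v)) (\<lambda>x. Q *\<^sub>v c x) f = jordan_matrix nas"
    using new(2)[OF f] by simp
  then show thesis
    using jordan_matrix_nonzero[of _ nas] dim by (intro that[OF new(1) new(3)]) simp_all
qed

end

section \<open>Vanishing trace forms and Engel's theorem\<close>

lemma (in coordinates) hom_coord:
  assumes f: "f \<in> LinearCombinations.module_hom CC V V" and x: "x \<in> carrier V" and i: "i < n"
  shows "c (f x) $ i = (\<Sum>j<n. c x $ j * c (f (e (unit_vec n j))) $ i)"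
  using op_mat_mult_vec[OF f x, symmetric] i x
  by (simp add: op_mat_def scalar_prod_def lessThan_atLeast0 mult.commute)

section \<open>Bracket identities and multiplications as linear maps\<close>

context leibniz_algebra
begin

lemmas subspace_iff = subspace_CC_iff[OF vectorspace_axioms]

lemma bracket_zero_left [simp]: "x \<in> carrier L \<Longrightarrow> \<lbrace>\<zero>, x\<rbrace> = \<zero>"
  using bracket_smult_left[of \<zero> x 0] bracket_closed[of \<zero> x] lmult_0[of \<zero>] lmult_0[of "\<lbrace>\<zero>, x\<rbrace>"] by simp

lemma bracket_zero_right [simp]: "x \<in> carrier L \<Longrightarrow> \<lbrace>x, \<zero>\<rbrace> = \<zero>"
  using bracket_smult_right[of x \<zero> 0] bracket_closed[of x \<zero>] lmult_0[of \<zero>] lmult_0[of "\<lbrace>x, \<zero>\<rbrace>"] by simp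

lemma smult_closed_CC [simp]: "x \<in> carrier L \<Longrightarrow> a \<odot>\<^bsub>L\<^esub> x \<in> carrier L"
  by simp

lemma smult_zero_CC [simp]: "x \<in> carrier L \<Longrightarrow> 0 \<odot>\<^bsub>L\<^esub> x = \<zero>"
  using lmult_0[of x] by simp

lemma smult_one_CC [simp]: "x \<in> carrier L \<Longrightarrow> 1 \<odot>\<^bsub>L\<^esub> x = x"
  using smult_one[of x] by simp

lemma uminus_eq_smult: "x \<in> carrier L \<Longrightarrow> \<ominus> x = (- 1) \<odot>\<^bsub>L\<^esub> x"
  using smult_minus_1[of x] by (simp add: class_ring_simps)

lemma add_minus_cancel_left:
  assumes "x \<in> carrier L" "y \<in> carrier L"
  shows "(x \<oplus> y) \<ominus> x = y"
proof -
  have "(x \<oplus> y) \<ominus> x = (y \<oplus> x) \<oplus> \<ominus> x" using assms by (simp add: a_minus_def a_comm)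
  also have "\<dots> = y \<oplus> (x \<oplus> \<ominus> x)" using assms by (intro a_assoc) auto
  finally show ?thesis using assms by (simp add: r_neg)
qed

lemma bracket_minus_left:
  "x \<in> carrier L \<Longrightarrow> y \<in> carrier L \<Longrightarrow> z \<in> carrier L \<Longrightarrow> \<lbrace>x \<ominus> y, z\<rbrace> = \<lbrace>x, z\<rbrace> \<ominus> \<lbrace>y, z\<rbrace>"
  by (simp add: a_minus_def uminus_eq_smult bracket_add_left bracket_smult_left bracket_closed)

lemma bracket_minus_right:
  "x \<in> carrier L \<Longrightarrow> y \<in> carrier L \<Longrightarrow> z \<in> carrier L \<Longrightarrow> \<lbrace>z, x \<ominus> y\<rbrace> = \<lbrace>z, x\<rbrace> \<ominus> \<lbrace>z, y\<rbrace>"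
  by (simp add: a_minus_def uminus_eq_smult bracket_add_right bracket_smult_right bracket_closed)

lemma bracket_right_hom: "y \<in> carrier L \<Longrightarrow> (\<lambda>x. \<lbrace>x, y\<rbrace>) \<in> LinearCombinations.module_hom CC L L"
  by (simp add: LinearCombinations.module_hom_def bracket_closed bracket_add_left bracket_smult_left)

lemma bracket_left_hom: "y \<in> carrier L \<Longrightarrow> (\<lambda>x. \<lbrace>y, x\<rbrace>) \<in> LinearCombinations.module_hom CC L L"
  by (simp add: LinearCombinations.module_hom_def bracket_closed bracket_add_right bracket_smult_right)

text \<open>The Leibniz identity rearranged into a product rule: right multiplications are
  derivations. This is the form used for eigenspaces, Engel's theorem and ideals.\<close>

lemma bracket_derivation:
  assumes "x \<in> carrier L" "y \<in> carrier L" "z \<in> carrier L"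
  shows "\<lbrace>\<lbrace>x, y\<rbrace>, z\<rbrace> = \<lbrace>\<lbrace>x, z\<rbrace>, y\<rbrace> \<oplus> \<lbrace>x, \<lbrace>y, z\<rbrace>\<rbrace>"
  using assms by (simp add: leibniz_identity bracket_closed a_minus_def a_lcomm[of "\<lbrace>\<lbrace>x, z\<rbrace>, y\<rbrace>"] r_neg)

end

lemma module_hom_comp:
  assumes "f \<in> LinearCombinations.module_hom R V V" "g \<in> LinearCombinations.module_hom R V V"
  shows "(\<lambda>x. f (g x)) \<in> LinearCombinations.module_hom R V V"
  using assms by (auto simp: LinearCombinations.module_hom_def Pi_iff)

lemma (in lie_algebra) bracket_skew:
  assumes "x \<in> carrier L" "y \<in> carrier L"
  shows "\<lbrace>x, y\<rbrace> = \<ominus> \<lbrace>y, x\<rbrace>"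
proof -
  have "\<zero> = \<lbrace>x \<oplus> y, x \<oplus> y\<rbrace>" using assms by (simp add: bracket_self)
  also have "\<dots> = \<lbrace>x, y\<rbrace> \<oplus> \<lbrace>y, x\<rbrace>"
    using assms bracket_closed[OF assms] bracket_closed[OF assms(2,1)]
    by (simp add: bracket_add_left bracket_add_right bracket_self[of x] bracket_self[of y] a_comm)
  finally show ?thesis
    using assms bracket_closed by (intro minus_equality[symmetric]) auto
qed

text \<open>If the trace form vanishes, then for the derivation \<open>D\<close> that acts as \<open>cnj a\<close> on the generalized
  eigenspace of the right multiplication by \<open>x\<close> for \<open>a\<close>, the trace of \<open>\<lambda>z. \<lbrace>D z, x\<rbrace>\<close> is zero; but it
  is the sum of the squared moduli of the eigenvalues.\<close>

lemma (in lie_algebra) trace_form_zero_imp_nilpotent: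
  assumes coords: "coordinates L n e0 c0"
    and perfect: "span {\<lbrace>u, v\<rbrace> | u v. u \<in> carrier L \<and> v \<in> carrier L} = carrier L"
    and tr0: "\<And>u v. u \<in> carrier L \<Longrightarrow> v \<in> carrier L \<Longrightarrow> coordinates.op_trace n e0 c0 (\<lambda>z. \<lbrace>\<lbrace>z, u\<rbrace>, v\<rbrace>) = 0"
    and x: "x \<in> carrier L"
  shows "\<exists>k. \<forall>z\<in>carrier L. ((\<lambda>z. \<lbrace>z, x\<rbrace>) ^^ k) z = \<zero>"
proof -
  interpret c0: coordinates L n e0 c0 by (rule coords)
  obtain e c where ec: "coordinates L n e c"
    and op_trace_eq: "\<And>g. g \<in> LinearCombinations.module_hom CC L L \<Longrightarrow> coordinates.op_trace n e c g = c0.op_trace g"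
    and op_mat: "\<And>i j. i < n \<Longrightarrow> j < n \<Longrightarrow> coordinates.op_mat n e c (\<lambda>z. \<lbrace>z, x\<rbrace>) $$ (i, j) \<noteq> 0 \<Longrightarrow>
      i \<le> j \<and> coordinates.op_mat n e c (\<lambda>z. \<lbrace>z, x\<rbrace>) $$ (i, i) = coordinates.op_mat n e c (\<lambda>z. \<lbrace>z, x\<rbrace>) $$ (j, j)"
    using c0.triangular_coordinates_exist[OF bracket_right_hom[OF x]] by blast
  interpret c: coordinates L n e c by (rule ec)
  define p where "p i = e (unit_vec n i)" for i
  have p [simp]: "p i \<in> carrier L" for i by (simp add: p_def)
  have cp: "c (p i) = unit_vec n i" for i by (simp add: p_def)
  define J where "J i j = c \<lbrace>p j, x\<rbrace> $ i" for i j
  define a where "a i = J i i" for i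
  have J: "i \<le> j" "a i = a j" if "i < n" "j < n" "J i j \<noteq> 0" for i j
    using op_mat[of i j] that by (simp_all add: c.op_mat_def J_def a_def p_def)
  note [simp] = bracket_closed
  have Jx: "c \<lbrace>z, x\<rbrace> $ i = (\<Sum>j<n. c z $ j * J i j)" if "z \<in> carrier L" "i < n" for z i
    using c.hom_coord[OF bracket_right_hom[OF x] that] by (simp add: J_def p_def)
  \<comment> \<open>If right multiplication by \<open>x\<close> minus \<open>b\<close> sends
    \<open>z\<close> into the generalized eigenspace of \<open>b\<close>, then \<open>z\<close>
    already lies in it. At the largest offending index \<open>m\<close>, the pattern
    \<open>J\<close> leaves only the diagonal term in row \<open>m\<close>, so the coordinate of the
    image is \<open>(a m - b) * c z $ m\<close>, which is nonzero.\<close>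
  have step: "a k = b"
    if z: "z \<in> carrier L" and R: "\<And>k. k < n \<Longrightarrow> c \<lbrace>z, x\<rbrace> $ k - b * c z $ k \<noteq> 0 \<Longrightarrow> a k = b"
      and k: "k < n" "c z $ k \<noteq> 0" for z b k
  proof (rule ccontr)
    assume "a k \<noteq> b"
    define S where "S = {k. k < n \<and> c z $ k \<noteq> 0 \<and> a k \<noteq> b}"
    have S: "finite S" "S \<noteq> {}" using k \<open>a k \<noteq> b\<close> by (auto simp: S_def)
    define m where "m = Max S"
    have m: "m < n" "c z $ m \<noteq> 0" "a m \<noteq> b"
      using Max_in[OF S] by (auto simp: S_def m_def)
    have "c z $ j * J m j = 0" if "j < n" "j \<noteq> m" for j
    proof (rule ccontr)
      assume "c z $ j * J m j \<noteq> 0"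
      then have "j \<in> S" "m \<le> j" using J[of m j] that m by (auto simp: S_def)
      then show False using Max_ge[OF S(1), of j] \<open>j \<noteq> m\<close> by (simp add: m_def)
    qed
    then have "(\<Sum>j<n. c z $ j * J m j) = (\<Sum>j<n. if j = m then c z $ m * a m else 0)"
      by (intro sum.cong) (auto simp: a_def)
    then have "c \<lbrace>z, x\<rbrace> $ m = c z $ m * a m" using Jx[OF z m(1)] m(1) by simp
    then have "c \<lbrace>z, x\<rbrace> $ m - b * c z $ m = (a m - b) * c z $ m" by (simp add: algebra_simps)
    then show False using R[OF m(1)] m by simp
  qed
  \<comment> \<open>\<open>w i\<close> is the off-diagonal part of [p i, x]. It involves only
    \<open>p m\<close> with \<open>m < i\<close> and \<open>a m = a i\<close>, which drives the
    induction in \<open>eig\<close>.\<close>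
  define w where "w i = \<lbrace>p i, x\<rbrace> \<oplus> (- a i) \<odot>\<^bsub>L\<^esub> p i" for i
  have w [simp]: "w i \<in> carrier L" for i using x by (simp add: w_def)
  have px: "\<lbrace>p i, x\<rbrace> = a i \<odot>\<^bsub>L\<^esub> p i \<oplus> w i" for i
  proof -
    have "a i \<odot>\<^bsub>L\<^esub> p i \<oplus> (- a i) \<odot>\<^bsub>L\<^esub> p i = \<zero>"
      using smult_l_distr[of "a i" "- a i" "p i"] by (simp del: smult_l_distr)
    then show ?thesis
      using x by (simp add: w_def a_lcomm[of "a i \<odot>\<^bsub>L\<^esub> p i"])
  qed
  have cw: "c (w i) $ k = (if k = i then 0 else J k i)" if "i < n" "k < n" for i k
    using that x by (simp add: w_def cp J_def a_def)
  \<comment> \<open>Brackets add eigenvalues. By the product rule, right multiplication by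
    \<open>x\<close> minus \<open>a i + a j\<close> maps [p i, p j] to [w i, p j] + [p i, w j],
    whose terms have smaller index sums; \<open>step\<close> then lifts the conclusion back to
    [p i, p j].\<close>
  have eig: "a l = a i + a j" if "i < n" "j < n" "l < n" "c \<lbrace>p i, p j\<rbrace> $ l \<noteq> 0" for i j l
    using that
  proof (induction "i + j" arbitrary: i j l rule: less_induct)
    case less
    show ?case
    proof (rule step[of "\<lbrace>p i, p j\<rbrace>"])
      fix k assume k: "k < n" and nz: "c \<lbrace>\<lbrace>p i, p j\<rbrace>, x\<rbrace> $ k - (a i + a j) * c \<lbrace>p i, p j\<rbrace> $ k \<noteq> 0"
      have "\<lbrace>\<lbrace>p i, p j\<rbrace>, x\<rbrace> = (a i \<odot>\<^bsub>L\<^esub> \<lbrace>p i, p j\<rbrace> \<oplus> \<lbrace>w i, p j\<rbrace>) \<oplus> (a j \<odot>\<^bsub>L\<^esub> \<lbrace>p i, p j\<rbrace> \<oplus> \<lbrace>p i, w j\<rbrace>)"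
        using x by (simp add: bracket_derivation[of "p i" "p j" x] px bracket_add_left bracket_add_right
            bracket_smult_left bracket_smult_right del: M.a_assoc)
      then have "c \<lbrace>\<lbrace>p i, p j\<rbrace>, x\<rbrace> $ k - (a i + a j) * c \<lbrace>p i, p j\<rbrace> $ k = c \<lbrace>w i, p j\<rbrace> $ k + c \<lbrace>p i, w j\<rbrace> $ k"
        using k by (simp add: algebra_simps)
      also have "c \<lbrace>w i, p j\<rbrace> $ k = (\<Sum>m<n. c (w i) $ m * c \<lbrace>p m, p j\<rbrace> $ k)"
        using c.hom_coord[OF bracket_right_hom w k, of "p j" i] by (simp add: p_def)
      also have "c \<lbrace>p i, w j\<rbrace> $ k = (\<Sum>m<n. c (w j) $ m * c \<lbrace>p i, p m\<rbrace> $ k)"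
        using c.hom_coord[OF bracket_left_hom w k, of "p i" j] by (simp add: p_def)
      finally have eq: "c \<lbrace>\<lbrace>p i, p j\<rbrace>, x\<rbrace> $ k - (a i + a j) * c \<lbrace>p i, p j\<rbrace> $ k =
          (\<Sum>m<n. c (w i) $ m * c \<lbrace>p m, p j\<rbrace> $ k) + (\<Sum>m<n. c (w j) $ m * c \<lbrace>p i, p m\<rbrace> $ k)" .
      have "(\<Sum>m<n. c (w i) $ m * c \<lbrace>p m, p j\<rbrace> $ k) \<noteq> 0 \<or> (\<Sum>m<n. c (w j) $ m * c \<lbrace>p i, p m\<rbrace> $ k) \<noteq> 0"
        using nz unfolding eq by (rule contrapos_np) simp
      then show "a k = a i + a j"
      proof
        assume "(\<Sum>m<n. c (w i) $ m * c \<lbrace>p m, p j\<rbrace> $ k) \<noteq> 0"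
        then obtain m where m: "m < n" "c (w i) $ m \<noteq> 0" "c \<lbrace>p m, p j\<rbrace> $ k \<noteq> 0"
          by (rule sum.not_neutral_contains_not_neutral) auto
        then have "m \<noteq> i" "J m i \<noteq> 0" using cw[OF less.prems(1) m(1)] by (auto split: if_splits)
        then have "m < i" "a m = a i" using J[of m i] m(1) less.prems by auto
        then show ?thesis using less.hyps[of m j k] m k less.prems by simp
      next
        assume "(\<Sum>m<n. c (w j) $ m * c \<lbrace>p i, p m\<rbrace> $ k) \<noteq> 0"
        then obtain m where m: "m < n" "c (w j) $ m \<noteq> 0" "c \<lbrace>p i, p m\<rbrace> $ k \<noteq> 0"
          by (rule sum.not_neutral_contains_not_neutral) auto
        then have "m \<noteq> j" "J m j \<noteq> 0" using cw[OF less.prems(2) m(1)] by (auto split: if_splits)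
        then have "m < j" "a m = a j" using J[of m j] m(1) less.prems by auto
        then show ?thesis using less.hyps[of i m k] m k less.prems by simp
      qed
    qed (use less.prems in auto)
  qed
  have bracket_coord: "c \<lbrace>u, v\<rbrace> $ l = (\<Sum>i<n. \<Sum>j<n. c u $ i * c v $ j * c \<lbrace>p i, p j\<rbrace> $ l)"
    if "u \<in> carrier L" "v \<in> carrier L" "l < n" for u v l
  proof -
    have "c \<lbrace>u, v\<rbrace> $ l = (\<Sum>i<n. c u $ i * c \<lbrace>p i, v\<rbrace> $ l)"
      using c.hom_coord[OF bracket_right_hom that(1,3), of v] that by (simp add: p_def)
    moreover have "c \<lbrace>p i, v\<rbrace> $ l = (\<Sum>j<n. c v $ j * c \<lbrace>p i, p j\<rbrace> $ l)" for i
      using c.hom_coord[OF bracket_left_hom that(2,3), of "p i"] by (simp add: p_def)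
    ultimately show ?thesis by (simp add: sum_distrib_left mult.assoc)
  qed
  \<comment> \<open>Conjugation is additive, so the additivity of eigenvalues in \<open>eig\<close>
    makes this diagonal map a derivation.\<close>
  define D where "D z = e (vec n (\<lambda>i. cnj (a i) * c z $ i))" for z
  have D [simp]: "D z \<in> carrier L" for z by (simp add: D_def)
  have cD: "c (D z) $ i = cnj (a i) * c z $ i" if "i < n" for z i
    using that by (simp add: D_def)
  have eqI: "u = v" if "u \<in> carrier L" "v \<in> carrier L" "\<And>i. i < n \<Longrightarrow> c u $ i = c v $ i" for u v
    using that by (intro c.c_eqD[of u v] eq_vecI) auto
  have D_hom: "D \<in> LinearCombinations.module_hom CC L L"
    unfolding LinearCombinations.module_hom_def
    by (auto intro!: eqI simp: cD algebra_simps)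
  have D_der: "D \<lbrace>u, v\<rbrace> = \<lbrace>D u, v\<rbrace> \<oplus> \<lbrace>u, D v\<rbrace>" if uv: "u \<in> carrier L" "v \<in> carrier L" for u v
  proof (rule eqI)
    fix l assume l: "l < n"
    have t: "cnj (a l) * (c u $ i * c v $ j * c \<lbrace>p i, p j\<rbrace> $ l) =
        c (D u) $ i * c v $ j * c \<lbrace>p i, p j\<rbrace> $ l + c u $ i * c (D v) $ j * c \<lbrace>p i, p j\<rbrace> $ l"
      if "i < n" "j < n" for i j
    proof (cases "c \<lbrace>p i, p j\<rbrace> $ l = 0")
      case False
      show ?thesis using that unfolding eig[OF that l False] by (simp add: cD ring_distribs mult_ac)
    qed simp
    have "c (D \<lbrace>u, v\<rbrace>) $ l = (\<Sum>i<n. \<Sum>j<n. cnj (a l) * (c u $ i * c v $ j * c \<lbrace>p i, p j\<rbrace> $ l))"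
      using l uv by (simp add: cD bracket_coord[OF uv l] sum_distrib_left)
    also have "\<dots> = (\<Sum>i<n. \<Sum>j<n. c (D u) $ i * c v $ j * c \<lbrace>p i, p j\<rbrace> $ l + c u $ i * c (D v) $ j * c \<lbrace>p i, p j\<rbrace> $ l)"
      by (intro sum.cong refl t) auto
    also have "\<dots> = c (\<lbrace>D u, v\<rbrace> \<oplus> \<lbrace>u, D v\<rbrace>) $ l"
      using l uv by (simp add: bracket_coord[OF D uv(2) l] bracket_coord[OF uv(1) D l] sum.distrib)
    finally show "c (D \<lbrace>u, v\<rbrace>) $ l = c (\<lbrace>D u, v\<rbrace> \<oplus> \<lbrace>u, D v\<rbrace>) $ l" .
  qed (use uv in auto)
  have op_trace: "c.op_trace (\<lambda>z. \<lbrace>\<lbrace>z, u\<rbrace>, v\<rbrace>) = 0" if "u \<in> carrier L" "v \<in> carrier L" for u v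
    using tr0[OF that] op_trace_eq[OF module_hom_comp[OF bracket_right_hom[OF that(2)] bracket_right_hom[OF that(1)]]] by simp
  \<comment> \<open>\<open>Z\<close> is a subspace containing all brackets, and these span the
    algebra, so the trace condition reaches \<open>x\<close> itself.\<close>
  define Z where "Z = {y \<in> carrier L. c.op_trace (\<lambda>z. \<lbrace>D z, y\<rbrace>) = 0}"
  have "{\<lbrace>u, v\<rbrace> | u v. u \<in> carrier L \<and> v \<in> carrier L} \<subseteq> Z"
  proof clarify
    fix u v assume uv: "u \<in> carrier L" "v \<in> carrier L"
    have "c.op_trace (\<lambda>z. \<lbrace>D z, \<lbrace>u, v\<rbrace>\<rbrace>) = c.op_trace (\<lambda>z. \<lbrace>\<lbrace>D z, u\<rbrace>, v\<rbrace> \<ominus> \<lbrace>\<lbrace>D z, v\<rbrace>, u\<rbrace>)"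
      using uv by (intro c.op_trace_cong) (simp add: leibniz_identity)
    also have "\<dots> = c.op_trace (\<lambda>z. \<lbrace>\<lbrace>D z, u\<rbrace>, v\<rbrace>) - c.op_trace (\<lambda>z. \<lbrace>\<lbrace>D z, v\<rbrace>, u\<rbrace>)"
      using uv by (intro c.op_trace_minus) auto
    \<comment> \<open>The cyclic property moves right multiplication by \<open>v\<close> inside
      \<open>D\<close>. The derivation rule then leaves only [[z, D v], u], whose trace is the trace
      form at \<open>D v\<close> and \<open>u\<close>.\<close>
    also have "c.op_trace (\<lambda>z. \<lbrace>\<lbrace>D z, u\<rbrace>, v\<rbrace>) = c.op_trace (\<lambda>z. \<lbrace>D \<lbrace>z, v\<rbrace>, u\<rbrace>)"
      using c.op_trace_commute[OF bracket_right_hom[OF uv(2)] module_hom_comp[OF bracket_right_hom[OF uv(1)] D_hom]] .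
    also have "\<dots> - c.op_trace (\<lambda>z. \<lbrace>\<lbrace>D z, v\<rbrace>, u\<rbrace>) = c.op_trace (\<lambda>z. \<lbrace>D \<lbrace>z, v\<rbrace>, u\<rbrace> \<ominus> \<lbrace>\<lbrace>D z, v\<rbrace>, u\<rbrace>)"
      using uv by (intro c.op_trace_minus[symmetric]) auto
    also have "\<dots> = c.op_trace (\<lambda>z. \<lbrace>\<lbrace>z, D v\<rbrace>, u\<rbrace>)"
    proof (rule c.op_trace_cong)
      fix z assume z: "z \<in> carrier L"
      show "\<lbrace>D \<lbrace>z, v\<rbrace>, u\<rbrace> \<ominus> \<lbrace>\<lbrace>D z, v\<rbrace>, u\<rbrace> = \<lbrace>\<lbrace>z, D v\<rbrace>, u\<rbrace>"
        using z uv by (simp add: D_der bracket_add_left add_minus_cancel_left)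
    qed
    also have "\<dots> = 0" using uv by (simp add: op_trace)
    finally show "\<lbrace>u, v\<rbrace> \<in> Z" using uv by (simp add: Z_def)
  qed
  moreover have "VectorSpace.subspace CC Z L"
  proof -
    have "c.op_trace (\<lambda>z. \<zero>) = 0" by (simp add: c.op_trace_def)
    moreover have "c.op_trace (\<lambda>z. \<lbrace>D z, u \<oplus> v\<rbrace>) = c.op_trace (\<lambda>z. \<lbrace>D z, u\<rbrace>) + c.op_trace (\<lambda>z. \<lbrace>D z, v\<rbrace>)"
      if "u \<in> carrier L" "v \<in> carrier L" for u v
      using that by (simp add: bracket_add_right c.op_trace_add)
    moreover have "c.op_trace (\<lambda>z. \<lbrace>D z, b \<odot>\<^bsub>L\<^esub> u\<rbrace>) = b * c.op_trace (\<lambda>z. \<lbrace>D z, u\<rbrace>)"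
      if "u \<in> carrier L" for u b
      using that by (simp add: bracket_smult_right c.op_trace_smult)
    ultimately show ?thesis
      by (auto simp: subspace_iff Z_def)
  qed
  ultimately have "span {\<lbrace>u, v\<rbrace> | u v. u \<in> carrier L \<and> v \<in> carrier L} \<subseteq> Z"
    by (rule span_CC_least[OF vectorspace_axioms, rotated])
  then have "c.op_trace (\<lambda>z. \<lbrace>D z, x\<rbrace>) = 0" using perfect x by (auto simp: Z_def)
  moreover have "c \<lbrace>D (p i), x\<rbrace> $ i = cnj (a i) * a i" if i: "i < n" for i
  proof -
    have "D (p i) = cnj (a i) \<odot>\<^bsub>L\<^esub> p i"
      using i by (intro eqI) (auto simp: cD cp)
    then show ?thesis using i x by (simp add: bracket_smult_left a_def J_def)
  qed
  ultimately have "(\<Sum>i<n. cnj (a i) * a i) = 0"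
    by (simp add: c.op_trace_def p_def)
  then have "complex_of_real (\<Sum>i<n. (cmod (a i))\<^sup>2) = 0"
    unfolding of_real_sum complex_norm_square by (simp only: mult.commute)
  then have "(\<Sum>i<n. (cmod (a i))\<^sup>2) = 0" by (simp only: of_real_eq_0_iff)
  then have a0: "a i = 0" if "i < n" for i
    using that by (simp add: sum_nonneg_eq_0_iff)
  \<comment> \<open>With all eigenvalues zero the matrix is strictly upper triangular, so each
    application clears one more trailing coordinate. The bound \<open>n \<le> i + k\<close> avoids
    truncated subtraction; \<open>k = n\<close> clears everything.\<close>
  have R: "((\<lambda>z. \<lbrace>z, x\<rbrace>) ^^ k) z \<in> carrier L \<and>
      (\<forall>i<n. n \<le> i + k \<longrightarrow> c (((\<lambda>z. \<lbrace>z, x\<rbrace>) ^^ k) z) $ i = 0)" if z: "z \<in> carrier L" for k z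
  proof (induction k)
    case 0
    then show ?case using z by simp
  next
    case (Suc k)
    let ?y = "((\<lambda>z. \<lbrace>z, x\<rbrace>) ^^ k) z"
    have y: "?y \<in> carrier L" using Suc by simp
    have "c \<lbrace>?y, x\<rbrace> $ i = 0" if i: "i < n" "n \<le> i + Suc k" for i
    proof -
      have "c ?y $ j * J i j = 0" if "j < n" for j
      proof (cases "J i j = 0")
        case False
        then have "i < j" using J[of i j] a0[OF i(1)] i that by (cases "i = j") (auto simp: a_def)
        then show ?thesis using Suc i that by simp
      qed simp
      then show ?thesis unfolding Jx[OF y i(1)] by (intro sum.neutral) auto
    qed
    then show ?case using y x by simp
  qed
  have "((\<lambda>z. \<lbrace>z, x\<rbrace>) ^^ n) z = \<zero>" if z: "z \<in> carrier L" for z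
    using R[OF z, of n] by (intro eqI) auto
  then show ?thesis by blast
qed

text \<open>The property of a subalgebra that is carried from \<open>T\<close> to a larger subalgebra is that
  it has a common null vector in every quotient \<open>W / U\<close> of nested stable subspaces.\<close>

lemma (in lie_algebra) engel:
  assumes nil: "\<And>x. x \<in> carrier L \<Longrightarrow> \<exists>k. \<forall>z\<in>carrier L. ((\<lambda>z. \<lbrace>z, x\<rbrace>) ^^ k) z = \<zero>"
    and nz: "carrier L \<noteq> {\<zero>}"
  obtains z where "z \<in> carrier L" "z \<noteq> \<zero>" "\<And>y. y \<in> carrier L \<Longrightarrow> \<lbrace>z, y\<rbrace> = \<zero>"
proof -
  define stable where "stable T W \<longleftrightarrow> VectorSpace.subspace CC W L \<and> (\<forall>w\<in>W. \<forall>t\<in>T. \<lbrace>w, t\<rbrace> \<in> W)" for T W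
  define P where "P T \<longleftrightarrow> leibniz_subalgebra L T \<and>
    (\<forall>U W. stable T U \<longrightarrow> stable T W \<longrightarrow> U \<subset> W \<longrightarrow> (\<exists>w\<in>W - U. \<forall>t\<in>T. \<lbrace>w, t\<rbrace> \<in> U))" for T
  note [simp] = bracket_closed
  have "P {\<zero>}"
    unfolding P_def
  proof (intro conjI allI impI)
    show "leibniz_subalgebra L {\<zero>}"
      by (simp add: leibniz_subalgebra_def subspace_iff)
    fix U W assume UW: "stable {\<zero>} U" "stable {\<zero>} W" "U \<subset> W"
    then obtain w where "w \<in> W - U" by blast
    then show "\<exists>w\<in>W - U. \<forall>t\<in>{\<zero>}. \<lbrace>w, t\<rbrace> \<in> U"
      using UW by (intro bexI[of _ w]) (auto simp: stable_def subspace_iff)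
  qed
  moreover have "VectorSpace.subspace CC T L" if "P T" for T
    using that by (simp add: P_def leibniz_subalgebra_def)
  ultimately obtain T where T: "P T" and T_max: "\<And>T'. P T' \<Longrightarrow> T \<subseteq> T' \<Longrightarrow> T' = T"
    using maximal_subspace_exists[OF vectorspace_axioms finite_dimensional, of P "{\<zero>}"] by blast
  have T_sub: "VectorSpace.subspace CC T L" and T_alg: "\<And>s t. s \<in> T \<Longrightarrow> t \<in> T \<Longrightarrow> \<lbrace>s, t\<rbrace> \<in> T"
    using T by (auto simp: P_def leibniz_subalgebra_def)
  have T_car: "T \<subseteq> carrier L" using T_sub by (simp add: subspace_iff)
  have whole: "stable T (carrier L)" "stable T {\<zero>}"
    if "T \<subseteq> carrier L" for T
    using that by (auto simp: stable_def subspace_iff)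
  have "T = carrier L"
  proof (rule ccontr)
    assume "T \<noteq> carrier L"
    then have "T \<subset> carrier L" using T_car by blast
    moreover have "stable T T" using T_sub T_alg by (simp add: stable_def)
    ultimately have "\<exists>w\<in>carrier L - T. \<forall>t\<in>T. \<lbrace>w, t\<rbrace> \<in> T"
      using T whole(1)[OF T_car] by (simp add: P_def)
    then obtain y where y: "y \<in> carrier L" "y \<notin> T" and yT: "\<And>t. t \<in> T \<Longrightarrow> \<lbrace>y, t\<rbrace> \<in> T"
      by blast
    have Ty: "\<lbrace>t, y\<rbrace> \<in> T" if "t \<in> T" for t
      using subspace_CC_uminus[OF vectorspace_axioms T_sub yT[OF that]] bracket_skew[of t y] that T_car y by auto
    define T' where "T' = {t \<oplus> b \<odot>\<^bsub>L\<^esub> y | t b. t \<in> T}"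
    have T'_car: "T' \<subseteq> carrier L" using T_car y by (auto simp: T'_def)
    have TT': "T \<subseteq> T'"
    proof
      fix t assume "t \<in> T"
      then have "t = t \<oplus> 0 \<odot>\<^bsub>L\<^esub> y" using T_car y lmult_0[OF y(1)] by auto
      then show "t \<in> T'" using \<open>t \<in> T\<close> by (auto simp: T'_def)
    qed
    have "y = \<zero> \<oplus> 1 \<odot>\<^bsub>L\<^esub> y" using y smult_one[OF y(1)] by simp
    then have yT': "y \<in> T'" using T_sub by (auto simp: T'_def subspace_iff)
    have T'_sub: "VectorSpace.subspace CC T' L"
      unfolding subspace_iff
    proof (intro conjI ballI allI)
      show "\<zero> \<in> T'" using TT' T_sub by (auto simp: subspace_iff)
      fix v assume v: "v \<in> T'"
      then obtain t b where tb: "v = t \<oplus> b \<odot>\<^bsub>L\<^esub> y" "t \<in> T" by (auto simp: T'_def)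
      have "d \<odot>\<^bsub>L\<^esub> v = d \<odot>\<^bsub>L\<^esub> t \<oplus> (d * b) \<odot>\<^bsub>L\<^esub> y" for d
        using tb T_car y smult_r_distr[of d t "b \<odot>\<^bsub>L\<^esub> y"] smult_assoc1[of d b y] by auto
      then show "d \<odot>\<^bsub>L\<^esub> v \<in> T'" for d using tb T_sub by (auto simp: T'_def subspace_iff)
      fix v' assume "v' \<in> T'"
      then obtain t' b' where tb': "v' = t' \<oplus> b' \<odot>\<^bsub>L\<^esub> y" "t' \<in> T" by (auto simp: T'_def)
      have "v \<oplus> v' = (t \<oplus> t') \<oplus> (b + b') \<odot>\<^bsub>L\<^esub> y"
        using tb tb' T_car y smult_l_distr[of b b' y] by (auto simp: a_ac subset_iff)
      then show "v \<oplus> v' \<in> T'" using tb tb' T_sub by (auto simp: T'_def subspace_iff)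
    qed (rule T'_car)
    have "P T'"
      unfolding P_def leibniz_subalgebra_def
    proof (intro conjI ballI allI impI T'_sub)
      fix v v' assume "v \<in> T'" "v' \<in> T'"
      then obtain t b t' b' where tb: "v = t \<oplus> b \<odot>\<^bsub>L\<^esub> y" "t \<in> T" "v' = t' \<oplus> b' \<odot>\<^bsub>L\<^esub> y" "t' \<in> T"
        by (auto simp: T'_def)
      have tc: "t \<in> carrier L" "t' \<in> carrier L" using tb T_car by auto
      have "\<lbrace>v, v'\<rbrace> = (\<lbrace>t, t'\<rbrace> \<oplus> b \<odot>\<^bsub>L\<^esub> \<lbrace>y, t'\<rbrace>) \<oplus> (b' \<odot>\<^bsub>L\<^esub> \<lbrace>t, y\<rbrace> \<oplus> b' \<odot>\<^bsub>L\<^esub> (b \<odot>\<^bsub>L\<^esub> \<lbrace>y, y\<rbrace>))"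
        using tc y by (simp add: tb(1,3) bracket_add_left bracket_add_right bracket_smult_left bracket_smult_right
            smult_r_distr a_ac)
      moreover have "\<lbrace>y, y\<rbrace> = \<zero>" using y by (simp add: bracket_self)
      ultimately show "\<lbrace>v, v'\<rbrace> \<in> T'"
        using TT' T_sub T_alg[OF tb(2,4)] Ty[OF tb(2)] yT[OF tb(4)] by (simp add: subspace_iff subset_iff)
    next
      fix U W assume U: "stable T' U" and W: "stable T' W" and UW: "U \<subset> W"
      \<comment> \<open>\<open>W1\<close> consists of the vectors of \<open>W\<close> that
        \<open>T\<close> kills modulo \<open>U\<close>. Since \<open>y\<close> normalizes
        \<open>T\<close>, right multiplication by \<open>y\<close> preserves \<open>W1\<close>, and
        its nilpotency yields a vector of \<open>W1\<close> outside \<open>U\<close> that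
        \<open>y\<close> also kills modulo \<open>U\<close>.\<close>
      define W1 where "W1 = {w \<in> W. \<forall>t\<in>T. \<lbrace>w, t\<rbrace> \<in> U}"
      have U_sub: "VectorSpace.subspace CC U L" and W_car: "W \<subseteq> carrier L"
        using U W by (auto simp: stable_def subspace_iff)
      have "stable T U" "stable T W" using U W TT' by (auto simp: stable_def)
      then have "\<exists>w\<in>W - U. \<forall>t\<in>T. \<lbrace>w, t\<rbrace> \<in> U" using T UW by (simp add: P_def)
      then obtain w where w: "w \<in> W1" "w \<notin> U" by (auto simp: W1_def)
      have wL: "w \<in> carrier L" using w W_car by (auto simp: W1_def)
      obtain K where "\<forall>z\<in>carrier L. ((\<lambda>z. \<lbrace>z, y\<rbrace>) ^^ K) z = \<zero>"
        using nil[OF y(1)] by blast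
      then have K: "((\<lambda>z. \<lbrace>z, y\<rbrace>) ^^ K) w \<in> U"
        using wL U_sub by (simp add: subspace_iff)
      \<comment> \<open>The vector sought is the last iterate outside \<open>U\<close>:
        \<open>k\<close> is positive because \<open>w\<close> itself is not in \<open>U\<close>, so
        the predecessor \<open>l\<close> exists.\<close>
      define k where "k = (LEAST k. ((\<lambda>z. \<lbrace>z, y\<rbrace>) ^^ k) w \<in> U)"
      have k: "((\<lambda>z. \<lbrace>z, y\<rbrace>) ^^ k) w \<in> U" unfolding k_def using K by (rule LeastI)
      then obtain l where l: "k = Suc l" using w(2) by (cases k) auto
      define w' where "w' = ((\<lambda>z. \<lbrace>z, y\<rbrace>) ^^ l) w"
      have "w' \<notin> U" using not_less_Least[of l "\<lambda>k. ((\<lambda>z. \<lbrace>z, y\<rbrace>) ^^ k) w \<in> U"] l by (auto simp: w'_def k_def)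
      have w'y: "\<lbrace>w', y\<rbrace> \<in> U" using k by (simp add: l w'_def)
      have W1_step: "\<lbrace>v, y\<rbrace> \<in> W1" if v: "v \<in> W1" for v
      proof -
        have "\<lbrace>\<lbrace>v, y\<rbrace>, t\<rbrace> \<in> U" if t: "t \<in> T" for t
        proof -
          have "\<lbrace>\<lbrace>v, y\<rbrace>, t\<rbrace> = \<lbrace>\<lbrace>v, t\<rbrace>, y\<rbrace> \<oplus> \<lbrace>v, \<lbrace>y, t\<rbrace>\<rbrace>"
            using v t T_car W_car y by (intro bracket_derivation) (auto simp: W1_def)
          moreover have "\<lbrace>\<lbrace>v, t\<rbrace>, y\<rbrace> \<in> U" using v t U yT' by (auto simp: W1_def stable_def)
          moreover have "\<lbrace>v, \<lbrace>y, t\<rbrace>\<rbrace> \<in> U" using v yT[OF t] by (auto simp: W1_def)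
          ultimately show ?thesis using U_sub by (simp add: subspace_iff)
        qed
        moreover have "\<lbrace>v, y\<rbrace> \<in> W" using v W yT' by (auto simp: W1_def stable_def)
        ultimately show ?thesis by (simp add: W1_def)
      qed
      have "((\<lambda>z. \<lbrace>z, y\<rbrace>) ^^ m) w \<in> W1" for m
        by (induction m) (use w W1_step in auto)
      then have w': "w' \<in> W1" by (simp add: w'_def)
      have "\<lbrace>w', v\<rbrace> \<in> U" if v: "v \<in> T'" for v
      proof -
        obtain t b where tb: "v = t \<oplus> b \<odot>\<^bsub>L\<^esub> y" "t \<in> T" using v by (auto simp: T'_def)
        have "\<lbrace>w', v\<rbrace> = \<lbrace>w', t\<rbrace> \<oplus> b \<odot>\<^bsub>L\<^esub> \<lbrace>w', y\<rbrace>"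
          using tb w' W_car T_car y by (auto simp: W1_def bracket_add_right bracket_smult_right subset_iff)
        then show ?thesis using w' w'y tb U_sub by (auto simp: W1_def subspace_iff)
      qed
      then show "\<exists>w\<in>W - U. \<forall>t\<in>T'. \<lbrace>w, t\<rbrace> \<in> U"
        using w' \<open>w' \<notin> U\<close> by (auto simp: W1_def)
    qed
    then show False using T_max[OF _ TT'] yT' y by auto
  qed
  moreover have "{\<zero>} \<subset> carrier L" using nz by auto
  \<comment> \<open>The property for the nested pair zero and whole algebra is Engel's
    conclusion.\<close>
  ultimately have "\<exists>z\<in>carrier L - {\<zero>}. \<forall>t\<in>carrier L. \<lbrace>z, t\<rbrace> \<in> {\<zero>}"
    using T[unfolded P_def, THEN conjunct2, rule_format, of "{\<zero>}" "carrier L"] whole[of "carrier L"] by simp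
  then obtain z where "z \<in> carrier L - {\<zero>}" "\<forall>t\<in>carrier L. \<lbrace>z, t\<rbrace> \<in> {\<zero>}"
    by blast
  then show thesis using that by auto
qed

section \<open>Splitting ideals of semisimple Lie algebras\<close>

lemma (in coordinates) functional_coord:
  assumes "\<And>x y. x \<in> carrier V \<Longrightarrow> y \<in> carrier V \<Longrightarrow> g (x \<oplus> y) = g x + g y"
    and "\<And>a x. x \<in> carrier V \<Longrightarrow> g (a \<odot>\<^bsub>V\<^esub> x) = a * g x"
    and x: "x \<in> carrier V"
  shows "g x = (\<Sum>j<n. c x $ j * (g (e (unit_vec n j)) :: complex))"
proof -
  \<comment> \<open>A functional is treated as a linear map into vectors of length one.\<close>
  have "vec 1 (\<lambda>_. g (e (c x))) $ 0 = (\<Sum>j<n. c x $ j * vec 1 (\<lambda>_. g (e (unit_vec n j))) $ 0)"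
    by (rule linear_vec_expand[where m = 1]) (use assms in \<open>auto simp: e_add e_smult\<close>)
  then show ?thesis using x by simp
qed

section \<open>Subalgebras and ideals as restricted records\<close>

context leibniz_algebra
begin

lemma leibniz_subalgebra_restrict:
  assumes A: "leibniz_subalgebra L A"
  shows "leibniz_algebra (L\<lparr>carrier := A\<rparr>)"
proof -
  have sub: "VectorSpace.subspace CC A L" using A by (simp add: leibniz_subalgebra_def)
  have car: "x \<in> A \<Longrightarrow> x \<in> carrier L" for x using sub by (auto simp: subspace_iff)
  interpret A: vectorspace CC "L\<lparr>carrier := A\<rparr>" by (rule subspace_is_vs[OF sub])
  \<comment> \<open>The additive inverse of the restricted record is determined by its own carrier,
    so it has to be identified with that of \<open>L\<close>; both are multiplication by minus
    one.\<close>
  have inv: "\<ominus>\<^bsub>L\<lparr>carrier := A\<rparr>\<^esub> x = \<ominus> x" if "x \<in> A" for x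
    using A.smult_minus_1[of x] smult_minus_1[of x] that car[OF that] by simp
  have br: "x \<in> A \<Longrightarrow> y \<in> A \<Longrightarrow> \<lbrace>x, y\<rbrace> \<in> A" for x y
    using A by (simp add: leibniz_subalgebra_def)
  show ?thesis
  proof (intro leibniz_algebra.intro leibniz_algebra_axioms.intro)
    show "vectorspace CC (L\<lparr>carrier := A\<rparr>)" by (rule A.vectorspace_axioms)
    show "A.fin_dim" by (rule subspace_fin_dim[OF vectorspace_axioms finite_dimensional sub])
    fix x y z a assume "x \<in> carrier (L\<lparr>carrier := A\<rparr>)" "y \<in> carrier (L\<lparr>carrier := A\<rparr>)"
    then have xy: "x \<in> A" "y \<in> A" by simp_all
    note [simp] = xy car[OF xy(1)] car[OF xy(2)]
    show "\<lbrace>x, y\<rbrace>\<^bsub>L\<lparr>carrier := A\<rparr>\<^esub> \<in> carrier (L\<lparr>carrier := A\<rparr>)" by (simp add: br)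
    show "\<lbrace>a \<odot>\<^bsub>L\<lparr>carrier := A\<rparr>\<^esub> x, y\<rbrace>\<^bsub>L\<lparr>carrier := A\<rparr>\<^esub> =
        a \<odot>\<^bsub>L\<lparr>carrier := A\<rparr>\<^esub> \<lbrace>x, y\<rbrace>\<^bsub>L\<lparr>carrier := A\<rparr>\<^esub>"
      by (simp add: bracket_smult_left)
    show "\<lbrace>x, a \<odot>\<^bsub>L\<lparr>carrier := A\<rparr>\<^esub> y\<rbrace>\<^bsub>L\<lparr>carrier := A\<rparr>\<^esub> =
        a \<odot>\<^bsub>L\<lparr>carrier := A\<rparr>\<^esub> \<lbrace>x, y\<rbrace>\<^bsub>L\<lparr>carrier := A\<rparr>\<^esub>"
      by (simp add: bracket_smult_right)
    assume "z \<in> carrier (L\<lparr>carrier := A\<rparr>)"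
    then have z: "z \<in> A" by simp
    note [simp] = z car[OF z]
    show "\<lbrace>x \<oplus>\<^bsub>L\<lparr>carrier := A\<rparr>\<^esub> y, z\<rbrace>\<^bsub>L\<lparr>carrier := A\<rparr>\<^esub> =
        \<lbrace>x, z\<rbrace>\<^bsub>L\<lparr>carrier := A\<rparr>\<^esub> \<oplus>\<^bsub>L\<lparr>carrier := A\<rparr>\<^esub> \<lbrace>y, z\<rbrace>\<^bsub>L\<lparr>carrier := A\<rparr>\<^esub>"
      by (simp add: bracket_add_left)
    show "\<lbrace>x, y \<oplus>\<^bsub>L\<lparr>carrier := A\<rparr>\<^esub> z\<rbrace>\<^bsub>L\<lparr>carrier := A\<rparr>\<^esub> =
        \<lbrace>x, y\<rbrace>\<^bsub>L\<lparr>carrier := A\<rparr>\<^esub> \<oplus>\<^bsub>L\<lparr>carrier := A\<rparr>\<^esub> \<lbrace>x, z\<rbrace>\<^bsub>L\<lparr>carrier := A\<rparr>\<^esub>"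
      by (simp add: bracket_add_right)
    have neg: "\<ominus>\<^bsub>L\<lparr>carrier := A\<rparr>\<^esub> \<lbrace>\<lbrace>x, z\<rbrace>, y\<rbrace> = \<ominus> \<lbrace>\<lbrace>x, z\<rbrace>, y\<rbrace>"
      by (intro inv br xy z)
    show "\<lbrace>x, \<lbrace>y, z\<rbrace>\<^bsub>L\<lparr>carrier := A\<rparr>\<^esub>\<rbrace>\<^bsub>L\<lparr>carrier := A\<rparr>\<^esub> =
        \<lbrace>\<lbrace>x, y\<rbrace>\<^bsub>L\<lparr>carrier := A\<rparr>\<^esub>, z\<rbrace>\<^bsub>L\<lparr>carrier := A\<rparr>\<^esub> \<ominus>\<^bsub>L\<lparr>carrier := A\<rparr>\<^esub>
        \<lbrace>\<lbrace>x, z\<rbrace>\<^bsub>L\<lparr>carrier := A\<rparr>\<^esub>, y\<rbrace>\<^bsub>L\<lparr>carrier := A\<rparr>\<^esub>"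
      using leibniz_identity[of x y z] neg unfolding a_minus_def by simp
  qed
qed

lemma ideal_subspace: "leibniz_ideal L J \<Longrightarrow> VectorSpace.subspace CC J L"
  by (simp add: leibniz_ideal_def)

lemma ideal_carrier: "leibniz_ideal L J \<Longrightarrow> x \<in> J \<Longrightarrow> x \<in> carrier L"
  using ideal_subspace[of J] by (auto simp: subspace_iff)

lemma ideal_subalgebra: "leibniz_ideal L J \<Longrightarrow> leibniz_subalgebra L J"
  using ideal_carrier[of J] by (simp add: leibniz_ideal_def leibniz_subalgebra_def)

lemma ideal_Int:
  assumes "leibniz_ideal L J" "leibniz_ideal L J'"
  shows "leibniz_ideal L (J \<inter> J')"
  unfolding leibniz_ideal_def
proof (intro conjI ballI)
  show "VectorSpace.subspace CC (J \<inter> J') L"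
    using assms[THEN ideal_subspace] unfolding subspace_iff by blast
qed (use assms in \<open>simp_all add: leibniz_ideal_def\<close>)

end

lemma (in lie_algebra) lie_subalgebra_restrict:
  assumes A: "leibniz_subalgebra L A"
  shows "lie_algebra (L\<lparr>carrier := A\<rparr>)"
proof -
  have "A \<subseteq> carrier L" using A by (simp add: leibniz_subalgebra_def subspace_iff)
  then show ?thesis
    using leibniz_subalgebra_restrict[OF A] bracket_self by (auto simp: lie_algebra_def lie_algebra_axioms_def)
qed

section \<open>Ideals inside Lie algebras\<close>

context lie_algebra
begin

lemma lie_idealI:
  assumes sub: "VectorSpace.subspace CC J L"
    and J: "\<And>j x. j \<in> J \<Longrightarrow> x \<in> carrier L \<Longrightarrow> \<lbrace>j, x\<rbrace> \<in> J"
  shows "leibniz_ideal L J"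
  unfolding leibniz_ideal_def
proof (intro conjI ballI sub)
  fix x j assume xj: "x \<in> carrier L" "j \<in> J"
  then have "j \<in> carrier L" using sub by (auto simp: subspace_iff)
  then show "\<lbrace>x, j\<rbrace> \<in> J"
    using bracket_skew[of x j] subspace_CC_uminus[OF vectorspace_axioms sub J[OF xj(2,1)]] xj by simp
qed (rule J)

lemma abelian_ideal_solvable:
  assumes J: "leibniz_ideal L J" and ab: "\<And>x y. x \<in> J \<Longrightarrow> y \<in> J \<Longrightarrow> \<lbrace>x, y\<rbrace> = \<zero>"
  shows "solvable_algebra (L\<lparr>carrier := J\<rparr>)"
proof -
  interpret J: lie_algebra "L\<lparr>carrier := J\<rparr>" by (rule lie_subalgebra_restrict[OF ideal_subalgebra[OF J]])
  have "\<zero> \<in> J" using ideal_subspace[OF J] by (simp add: subspace_iff)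
  then have "{\<lbrace>x, y\<rbrace> | x y. x \<in> J \<and> y \<in> J} = {\<zero>}"
    using ab by (auto intro!: exI[of _ \<zero>])
  moreover have "J.span {\<zero>} \<subseteq> {\<zero>}"
    using J.span_is_subset[of "{\<zero>}" "{\<zero>}"] \<open>\<zero> \<in> J\<close> J.subspace_iff[of "{\<zero>}"] J.smult_r_null
      J.r_zero[of \<zero>] J.is_module[of "{\<zero>}"] by auto
  moreover have "\<zero> \<in> J.span {\<zero>}" using J.in_own_span[of "{\<zero>}"] \<open>\<zero> \<in> J\<close> by simp
  ultimately have "derived_series (L\<lparr>carrier := J\<rparr>) 1 = {\<zero>}" by auto
  then show ?thesis unfolding solvable_algebra_def by (intro exI[of _ 1]) simp
qed

text \<open>A derivation sends a bracket from \<open>M\<close> to a sum of two such brackets. The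
  elements whose right brackets all lie in the span form a subspace \<open>Z\<close>, which extends
  this from the generators to the span.\<close>

lemma derived_ideal:
  assumes M: "leibniz_ideal L M"
  shows "leibniz_ideal L (span {\<lbrace>u, v\<rbrace> | u v. u \<in> M \<and> v \<in> M})" (is "leibniz_ideal L (span ?X)")
    and "span {\<lbrace>u, v\<rbrace> | u v. u \<in> M \<and> v \<in> M} \<subseteq> M"
proof -
  have car: "u \<in> M \<Longrightarrow> u \<in> carrier L" for u by (rule ideal_carrier[OF M])
  have br: "u \<in> M \<Longrightarrow> x \<in> carrier L \<Longrightarrow> \<lbrace>u, x\<rbrace> \<in> M" for u x using M by (simp add: leibniz_ideal_def)
  have X: "?X \<subseteq> carrier L" "?X \<subseteq> M" using car br by (auto simp: bracket_closed)
  then show "span ?X \<subseteq> M" by (intro span_CC_least[OF vectorspace_axioms ideal_subspace[OF M]])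
  have sub: "VectorSpace.subspace CC (span ?X) L" by (rule subspace_CC_span[OF vectorspace_axioms X(1)])
  define Z where "Z = {m \<in> carrier L. \<forall>x\<in>carrier L. \<lbrace>m, x\<rbrace> \<in> span ?X}"
  have Z_sub: "VectorSpace.subspace CC Z L"
    using sub by (auto simp: Z_def subspace_iff bracket_add_left bracket_smult_left)
  have "?X \<subseteq> Z"
  proof clarify
    fix u v assume uv: "u \<in> M" "v \<in> M"
    have "\<lbrace>\<lbrace>u, v\<rbrace>, x\<rbrace> \<in> span ?X" if x: "x \<in> carrier L" for x
    proof -
      have "\<lbrace>\<lbrace>u, v\<rbrace>, x\<rbrace> = \<lbrace>\<lbrace>u, x\<rbrace>, v\<rbrace> \<oplus> \<lbrace>u, \<lbrace>v, x\<rbrace>\<rbrace>"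
        using uv x car by (intro bracket_derivation) auto
      moreover have "\<lbrace>\<lbrace>u, x\<rbrace>, v\<rbrace> \<in> ?X" "\<lbrace>u, \<lbrace>v, x\<rbrace>\<rbrace> \<in> ?X" using uv br x by blast+
      ultimately show ?thesis using in_own_span[OF X(1)] sub by (simp add: subspace_iff subset_iff)
    qed
    then show "\<lbrace>u, v\<rbrace> \<in> Z" using uv car by (simp add: Z_def bracket_closed)
  qed
  then have "span ?X \<subseteq> Z" by (rule span_CC_least[OF vectorspace_axioms Z_sub])
  then show "leibniz_ideal L (span ?X)" by (intro lie_idealI sub) (auto simp: Z_def)
qed

text \<open>The product rule gives [[z, x], m] = [[z, m], x] + [z, [x, m]], and both terms vanish
  because [x, m] stays in \<open>M\<close>.\<close>

lemma center_ideal: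
  assumes M: "leibniz_ideal L M"
  shows "leibniz_ideal L {z \<in> M. \<forall>m\<in>M. \<lbrace>z, m\<rbrace> = \<zero>}"
proof (rule lie_idealI)
  have car: "u \<in> M \<Longrightarrow> u \<in> carrier L" for u by (rule ideal_carrier[OF M])
  show "VectorSpace.subspace CC {z \<in> M. \<forall>m\<in>M. \<lbrace>z, m\<rbrace> = \<zero>} L"
    using ideal_subspace[OF M] car smult_r_null
    by (auto simp: subspace_iff bracket_add_left bracket_smult_left)
  fix z x assume z: "z \<in> {z \<in> M. \<forall>m\<in>M. \<lbrace>z, m\<rbrace> = \<zero>}" and x: "x \<in> carrier L"
  have br: "u \<in> M \<Longrightarrow> \<lbrace>u, x\<rbrace> \<in> M" "u \<in> M \<Longrightarrow> \<lbrace>x, u\<rbrace> \<in> M" for u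
    using M x by (simp_all add: leibniz_ideal_def)
  have "\<lbrace>\<lbrace>z, x\<rbrace>, m\<rbrace> = \<zero>" if m: "m \<in> M" for m
    using bracket_derivation[of z x m] z x m car br by simp
  then show "\<lbrace>z, x\<rbrace> \<in> {z \<in> M. \<forall>m\<in>M. \<lbrace>z, m\<rbrace> = \<zero>}" using z br by simp
qed

end

lemma injective_mat_solvable:
  fixes T :: "complex mat"
  assumes T: "T \<in> carrier_mat n n" and inj: "\<And>v. v \<in> carrier_vec n \<Longrightarrow> T *\<^sub>v v = 0\<^sub>v n \<Longrightarrow> v = 0\<^sub>v n"
    and b: "b \<in> carrier_vec n"
  obtains v where "v \<in> carrier_vec n" "T *\<^sub>v v = b"
proof -
  have "det T \<noteq> 0" using det_0_iff_vec_prod_zero_field[OF T] inj by blast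
  then obtain T' where T': "T' \<in> carrier_mat n n" "T * T' = 1\<^sub>m n"
    using det_non_zero_imp_unit[OF T] by (auto simp: Units_def ring_mat_def)
  then have "T *\<^sub>v (T' *\<^sub>v b) = b" using assoc_mult_mat_vec[OF T T'(1) b] b by simp
  then show thesis using T' b by (intro that[of "T' *\<^sub>v b"]) auto
qed

text \<open>In the application \<open>K\<close> is the annihilator of the kernel. Only
  \<open>M\<close> is confined to \<open>K\<close>; its complement is taken in all of
  \<open>G\<close>. The component of an element in \<open>M\<close> is found by solving a linear
  system with the Gram matrix of the trace form.\<close>

lemma semisimple_lie_split_ideal:
  assumes G: "semisimple_lie G" and K: "leibniz_ideal G K" "K \<noteq> {\<zero>\<^bsub>G\<^esub>}"
  obtains M B where "leibniz_ideal G M" "leibniz_ideal G B" "M \<subseteq> K" "M \<noteq> {\<zero>\<^bsub>G\<^esub>}" "internal_direct_sum G M B"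
proof -
  interpret G: lie_algebra G using G by (simp add: semisimple_lie_def)
  note [simp] = G.bracket_closed
  define P where "P J \<longleftrightarrow> leibniz_ideal G J \<and> J \<subseteq> K \<and> J \<noteq> {\<zero>\<^bsub>G\<^esub>}" for J
  have "P K" using K by (simp add: P_def)
  moreover have "VectorSpace.subspace CC J G" if "P J" for J using that G.ideal_subspace by (simp add: P_def)
  ultimately obtain M where M: "P M" and M_min: "\<And>J. P J \<Longrightarrow> J \<subseteq> M \<Longrightarrow> J = M"
    using minimal_subspace_exists[OF G.vectorspace_axioms G.finite_dimensional, of P K] by blast
  have MI: "leibniz_ideal G M" and MK: "M \<subseteq> K" and M0: "M \<noteq> {\<zero>\<^bsub>G\<^esub>}" using M by (auto simp: P_def)
  have min: "J = {\<zero>\<^bsub>G\<^esub>} \<or> J = M" if "leibniz_ideal G J" "J \<subseteq> M" for J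
    using M_min[of J] that MK by (auto simp: P_def)
  \<comment> \<open>Otherwise \<open>M\<close> would be an abelian, hence solvable, ideal. With
    this, minimality forces [M, M] = M and a zero center.\<close>
  have nonab: "\<exists>x\<in>M. \<exists>y\<in>M. \<lbrace>x, y\<rbrace>\<^bsub>G\<^esub> \<noteq> \<zero>\<^bsub>G\<^esub>"
    using G M0 MI G.abelian_ideal_solvable[OF MI] by (auto simp: semisimple_lie_def)
  have Msub: "VectorSpace.subspace CC M G" by (rule G.ideal_subspace[OF MI])
  have car: "m \<in> M \<Longrightarrow> m \<in> carrier G" for m by (rule G.ideal_carrier[OF MI])
  have br: "m \<in> M \<Longrightarrow> x \<in> carrier G \<Longrightarrow> \<lbrace>m, x\<rbrace>\<^bsub>G\<^esub> \<in> M" for m x using MI by (simp add: leibniz_ideal_def)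
  have perfect: "G.span {\<lbrace>u, v\<rbrace>\<^bsub>G\<^esub> | u v. u \<in> M \<and> v \<in> M} = M" (is "G.span ?X = M")
  proof -
    have "?X \<subseteq> carrier G" using car by auto
    then have "?X \<subseteq> G.span ?X" by (rule G.in_own_span)
    then have "G.span ?X \<noteq> {\<zero>\<^bsub>G\<^esub>}" using nonab by blast
    then show ?thesis using min G.derived_ideal[OF MI] by blast
  qed
  have centerless: "{z \<in> M. \<forall>m\<in>M. \<lbrace>z, m\<rbrace>\<^bsub>G\<^esub> = \<zero>\<^bsub>G\<^esub>} = {\<zero>\<^bsub>G\<^esub>}"
    using min[OF G.center_ideal[OF MI]] nonab by blast
  define V where "V = G\<lparr>carrier := M\<rparr>"
  interpret V: lie_algebra V
    unfolding V_def by (rule G.lie_subalgebra_restrict[OF G.ideal_subalgebra[OF MI]])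
  have V_simps: "carrier V = M" "x \<oplus>\<^bsub>V\<^esub> y = x \<oplus>\<^bsub>G\<^esub> y" "a \<odot>\<^bsub>V\<^esub> x = a \<odot>\<^bsub>G\<^esub> x" "\<zero>\<^bsub>V\<^esub> = \<zero>\<^bsub>G\<^esub>"
    "\<lbrace>x, y\<rbrace>\<^bsub>V\<^esub> = \<lbrace>x, y\<rbrace>\<^bsub>G\<^esub>" for x y a
    by (simp_all add: V_def)
  have V_minus: "x \<ominus>\<^bsub>V\<^esub> y = x \<ominus>\<^bsub>G\<^esub> y" if "x \<in> M" "y \<in> M" for x y
    using V.uminus_eq_smult[of y] G.uminus_eq_smult[of y] that car by (simp add: a_minus_def V_simps)
  obtain n e c where "coordinates V n e c"
    using coordinates_exist[OF V.vectorspace_axioms V.finite_dimensional] by blast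
  then interpret c: coordinates V n e c .
  have R_hom: "(\<lambda>z. \<lbrace>z, s\<rbrace>\<^bsub>G\<^esub>) \<in> LinearCombinations.module_hom CC V V" if "s \<in> carrier G" for s
    using that br car
    by (auto simp: LinearCombinations.module_hom_def V_simps G.bracket_add_left G.bracket_smult_left)
  \<comment> \<open>The trace is taken over \<open>M\<close>, but \<open>u\<close> and
    \<open>v\<close> range over \<open>G\<close>, which acts on the ideal \<open>M\<close> by right
    multiplication. For \<open>u\<close> and \<open>v\<close> in \<open>M\<close> this is the
    Killing form of \<open>M\<close>.\<close>
  define t where "t u v = c.op_trace (\<lambda>z. \<lbrace>\<lbrace>z, u\<rbrace>\<^bsub>G\<^esub>, v\<rbrace>\<^bsub>G\<^esub>)" for u v
  have t_sym: "t u v = t v u" if "u \<in> carrier G" "v \<in> carrier G" for u v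
    using c.op_trace_commute[OF R_hom[OF that(2)] R_hom[OF that(1)]] by (simp add: t_def)
  have t_add: "t (u \<oplus>\<^bsub>G\<^esub> u') v = t u v + t u' v"
    if "u \<in> carrier G" "u' \<in> carrier G" "v \<in> carrier G" for u u' v
  proof -
    have "t (u \<oplus>\<^bsub>G\<^esub> u') v = c.op_trace (\<lambda>z. \<lbrace>\<lbrace>z, u\<rbrace>\<^bsub>G\<^esub>, v\<rbrace>\<^bsub>G\<^esub> \<oplus>\<^bsub>V\<^esub> \<lbrace>\<lbrace>z, u'\<rbrace>\<^bsub>G\<^esub>, v\<rbrace>\<^bsub>G\<^esub>)"
      unfolding t_def by (rule c.op_trace_cong) (use that car in \<open>simp add: V_simps G.bracket_add_left G.bracket_add_right\<close>)
    also have "\<dots> = t u v + t u' v"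
      unfolding t_def using that br by (intro c.op_trace_add) (simp_all add: V_simps)
    finally show ?thesis .
  qed
  have t_smult: "t (a \<odot>\<^bsub>G\<^esub> u) v = a * t u v" if "u \<in> carrier G" "v \<in> carrier G" for a u v
  proof -
    have "t (a \<odot>\<^bsub>G\<^esub> u) v = c.op_trace (\<lambda>z. a \<odot>\<^bsub>V\<^esub> \<lbrace>\<lbrace>z, u\<rbrace>\<^bsub>G\<^esub>, v\<rbrace>\<^bsub>G\<^esub>)"
      unfolding t_def by (rule c.op_trace_cong) (use that car in \<open>simp add: V_simps G.bracket_smult_left G.bracket_smult_right\<close>)
    also have "\<dots> = a * t u v"
      unfolding t_def using that br by (intro c.op_trace_smult) (simp_all add: V_simps)
    finally show ?thesis .
  qed
  \<comment> \<open>Expanding [u, v] and [v, w] by the Leibniz identity gives two differences with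
    one term in common; the remaining terms are cyclic rotations of each other.\<close>
  have t_invariant: "t \<lbrace>u, v\<rbrace>\<^bsub>G\<^esub> w = t u \<lbrace>v, w\<rbrace>\<^bsub>G\<^esub>"
    if uvw: "u \<in> carrier G" "v \<in> carrier G" "w \<in> carrier G" for u v w
  proof -
    note R3 = module_hom_comp[OF R_hom R_hom]
    have "t \<lbrace>u, v\<rbrace>\<^bsub>G\<^esub> w = c.op_trace (\<lambda>z. \<lbrace>\<lbrace>\<lbrace>z, u\<rbrace>\<^bsub>G\<^esub>, v\<rbrace>\<^bsub>G\<^esub>, w\<rbrace>\<^bsub>G\<^esub> \<ominus>\<^bsub>V\<^esub> \<lbrace>\<lbrace>\<lbrace>z, v\<rbrace>\<^bsub>G\<^esub>, u\<rbrace>\<^bsub>G\<^esub>, w\<rbrace>\<^bsub>G\<^esub>)"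
      unfolding t_def by (rule c.op_trace_cong)
        (use uvw car br in \<open>simp add: V_simps V_minus G.leibniz_identity G.bracket_minus_left\<close>)
    also have "\<dots> = c.op_trace (\<lambda>z. \<lbrace>\<lbrace>\<lbrace>z, u\<rbrace>\<^bsub>G\<^esub>, v\<rbrace>\<^bsub>G\<^esub>, w\<rbrace>\<^bsub>G\<^esub>) - c.op_trace (\<lambda>z. \<lbrace>\<lbrace>\<lbrace>z, v\<rbrace>\<^bsub>G\<^esub>, u\<rbrace>\<^bsub>G\<^esub>, w\<rbrace>\<^bsub>G\<^esub>)"
      using uvw br by (intro c.op_trace_minus) (simp_all add: V_simps)
    also have "c.op_trace (\<lambda>z. \<lbrace>\<lbrace>\<lbrace>z, v\<rbrace>\<^bsub>G\<^esub>, u\<rbrace>\<^bsub>G\<^esub>, w\<rbrace>\<^bsub>G\<^esub>) = c.op_trace (\<lambda>z. \<lbrace>\<lbrace>\<lbrace>z, u\<rbrace>\<^bsub>G\<^esub>, w\<rbrace>\<^bsub>G\<^esub>, v\<rbrace>\<^bsub>G\<^esub>)"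
      using c.op_trace_commute[OF R3[OF uvw(3,1)] R_hom[OF uvw(2)]] .
    also have "c.op_trace (\<lambda>z. \<lbrace>\<lbrace>\<lbrace>z, u\<rbrace>\<^bsub>G\<^esub>, v\<rbrace>\<^bsub>G\<^esub>, w\<rbrace>\<^bsub>G\<^esub>) - \<dots> =
        c.op_trace (\<lambda>z. \<lbrace>\<lbrace>\<lbrace>z, u\<rbrace>\<^bsub>G\<^esub>, v\<rbrace>\<^bsub>G\<^esub>, w\<rbrace>\<^bsub>G\<^esub> \<ominus>\<^bsub>V\<^esub> \<lbrace>\<lbrace>\<lbrace>z, u\<rbrace>\<^bsub>G\<^esub>, w\<rbrace>\<^bsub>G\<^esub>, v\<rbrace>\<^bsub>G\<^esub>)"
      using uvw br by (intro c.op_trace_minus[symmetric]) (simp_all add: V_simps)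
    also have "\<dots> = t u \<lbrace>v, w\<rbrace>\<^bsub>G\<^esub>"
      unfolding t_def by (rule c.op_trace_cong)
        (use uvw car br in \<open>simp add: V_simps V_minus G.leibniz_identity\<close>)
    finally show ?thesis .
  qed
  define B where "B = {s \<in> carrier G. \<forall>m\<in>M. t s m = 0}"
  have "t \<zero>\<^bsub>G\<^esub> m = 0" if "m \<in> M" for m
    using t_smult[of "\<zero>\<^bsub>G\<^esub>" m 0] that car by simp
  then have B_sub: "VectorSpace.subspace CC B G"
    using car by (auto simp: G.subspace_iff B_def t_add t_smult)
  have BI: "leibniz_ideal G B"
  proof (rule G.lie_idealI[OF B_sub])
    fix s x assume s: "s \<in> B" and x: "x \<in> carrier G"
    have "t \<lbrace>s, x\<rbrace>\<^bsub>G\<^esub> m = 0" if m: "m \<in> M" for m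
    proof -
      have "\<lbrace>x, m\<rbrace>\<^bsub>G\<^esub> \<in> M" using MI m x by (simp add: leibniz_ideal_def)
      then show ?thesis using t_invariant[of s x m] s x m car by (simp add: B_def)
    qed
    then show "\<lbrace>s, x\<rbrace>\<^bsub>G\<^esub> \<in> B" using s x by (simp add: B_def)
  qed
  have MB: "M \<inter> B = {\<zero>\<^bsub>G\<^esub>}"
  proof (rule ccontr)
    assume "M \<inter> B \<noteq> {\<zero>\<^bsub>G\<^esub>}"
    \<comment> \<open>By minimality the form is either nondegenerate on \<open>M\<close> or zero on
      it. The second case makes all right multiplications of \<open>M\<close> nilpotent and yields a
      central element, against \<open>centerless\<close>.\<close>
    then have "M \<inter> B = M" using min[OF G.ideal_Int[OF MI BI]] by blast
    then have t0: "t u v = 0" if "u \<in> M" "v \<in> M" for u v using that by (auto simp: B_def)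
    have "V.span {\<lbrace>u, v\<rbrace>\<^bsub>G\<^esub> | u v. u \<in> M \<and> v \<in> M} = G.span {\<lbrace>u, v\<rbrace>\<^bsub>G\<^esub> | u v. u \<in> M \<and> v \<in> M}"
      unfolding V_def using br car by (intro span_CC_restrict[OF G.vectorspace_axioms Msub]) auto
    then have "V.span {\<lbrace>u, v\<rbrace>\<^bsub>V\<^esub> | u v. u \<in> carrier V \<and> v \<in> carrier V} = carrier V"
      by (simp add: V_simps perfect)
    then have nil: "\<exists>k. \<forall>z\<in>carrier V. ((\<lambda>z. \<lbrace>z, x\<rbrace>\<^bsub>V\<^esub>) ^^ k) z = \<zero>\<^bsub>V\<^esub>" if "x \<in> carrier V" for x
      using V.trace_form_zero_imp_nilpotent[OF c.coordinates_axioms _ _ that] t0 by (simp add: V_simps t_def)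
    have "carrier V \<noteq> {\<zero>\<^bsub>V\<^esub>}" using M0 by (simp add: V_simps)
    then obtain z where "z \<in> carrier V" "z \<noteq> \<zero>\<^bsub>V\<^esub>" "\<And>y. y \<in> carrier V \<Longrightarrow> \<lbrace>z, y\<rbrace>\<^bsub>V\<^esub> = \<zero>\<^bsub>V\<^esub>"
      using V.engel[OF nil] by blast
    then show False using centerless by (auto simp: V_simps)
  qed
  define p where "p i = e (unit_vec n i)" for i
  have p: "p i \<in> M" for i using c.e_closed[of "unit_vec n i"] by (simp add: p_def V_simps)
  \<comment> \<open>The Gram matrix of the form on \<open>M\<close>. It is injective because a
    kernel vector gives an element of M \<inter> B.\<close>
  define T where "T = mat n n (\<lambda>(i, j). t (p j) (p i))"
  have t_coord: "t s m = (\<Sum>j<n. c m $ j * t s (p j))" if "s \<in> carrier G" "m \<in> M" for s m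
    unfolding p_def
    by (rule c.functional_coord) (use that car in \<open>simp_all add: V_simps t_sym[OF that(1)] t_add t_smult\<close>)
  have t_coord': "t m s = (\<Sum>j<n. c m $ j * t (p j) s)" if "s \<in> carrier G" "m \<in> M" for s m
    using t_coord[OF that] t_sym[OF that(1)] that car p by simp
  have T_mult: "(T *\<^sub>v c m) $ i = t m (p i)" if "m \<in> M" "i < n" for m i
    using t_coord'[of "p i" m] that p car c.c_closed[of m]
    by (simp add: T_def scalar_prod_def lessThan_atLeast0 mult.commute V_simps)
  have "M <+>\<^bsub>G\<^esub> B = carrier G"
  proof (intro equalityI subsetI)
    fix s assume s: "s \<in> carrier G"
    have "v = 0\<^sub>v n" if v: "v \<in> carrier_vec n" "T *\<^sub>v v = 0\<^sub>v n" for v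
    proof -
      have ev: "e v \<in> M" using c.e_closed[OF v(1)] by (simp add: V_simps)
      have "t (e v) (p i) = 0" if "i < n" for i
        using T_mult[OF ev that] v that by simp
      then have "e v \<in> B" using ev car t_coord[of "e v"] by (simp add: B_def)
      then have "e v = \<zero>\<^bsub>V\<^esub>" using MB ev by (auto simp: V_simps)
      then show ?thesis using c.c_e[OF v(1)] c.c_zero by simp
    qed
    \<comment> \<open>The right-hand side makes the resulting \<open>m\<close> pair with every basis
      vector of \<open>M\<close> as \<open>s\<close> does, so s - m is orthogonal to
      \<open>M\<close>.\<close>
    then obtain v where v: "v \<in> carrier_vec n" "T *\<^sub>v v = vec n (\<lambda>i. t s (p i))"
      using injective_mat_solvable[of T n "vec n (\<lambda>i. t s (p i))"] by (auto simp: T_def)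
    define m where "m = e v"
    have m: "m \<in> M" using c.e_closed[OF v(1)] by (simp add: V_simps m_def)
    have mG: "m \<in> carrier G" using m car by simp
    have "t m (p i) = t s (p i)" if "i < n" for i
      using T_mult[OF m that] v that by (simp add: m_def)
    then have "t m m' = t s m'" if "m' \<in> M" for m'
      using t_coord[OF s that] t_coord[OF mG that] by simp
    moreover have "t (s \<ominus>\<^bsub>G\<^esub> m) m' = t s m' - t m m'" if "m' \<in> M" for m'
      using that s mG car by (simp add: a_minus_def G.uminus_eq_smult t_add t_smult)
    ultimately have "s \<ominus>\<^bsub>G\<^esub> m \<in> B" using s mG by (simp add: B_def)
    moreover have "s = m \<oplus>\<^bsub>G\<^esub> (s \<ominus>\<^bsub>G\<^esub> m)"
      using s mG by (simp add: a_minus_def G.a_lcomm[of m] G.r_neg)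
    ultimately show "s \<in> M <+>\<^bsub>G\<^esub> B"
      using m by (auto simp: set_add_def set_mult_def)
  next
    fix s assume "s \<in> M <+>\<^bsub>G\<^esub> B"
    then show "s \<in> carrier G" using car by (auto simp: set_add_def set_mult_def B_def)
  qed
  then show thesis
    using that[OF MI BI MK M0] Msub B_sub MB by (simp add: internal_direct_sum_def)
qed

section \<open>Semisimplicity of split Leibniz algebras\<close>

text \<open>\<open>f\<close> crosses types because it compares vectors with cosets. Preservation of
  zero is listed since \<open>H\<close> need not be known to be a group: its structure is
  transported from \<open>G\<close> in \<open>leibniz_iso_lie_algebra\<close>.\<close>

definition leibniz_iso :: "('a \<Rightarrow> 'b) \<Rightarrow> 'a leibniz \<Rightarrow> 'b leibniz \<Rightarrow> bool" where
  "leibniz_iso f G H \<longleftrightarrow> bij_betw f (carrier G) (carrier H) \<and> f \<zero>\<^bsub>G\<^esub> = \<zero>\<^bsub>H\<^esub> \<and>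
    (\<forall>x\<in>carrier G. \<forall>y\<in>carrier G. f (x \<oplus>\<^bsub>G\<^esub> y) = f x \<oplus>\<^bsub>H\<^esub> f y \<and> f \<lbrace>x, y\<rbrace>\<^bsub>G\<^esub> = \<lbrace>f x, f y\<rbrace>\<^bsub>H\<^esub>) \<and>
    (\<forall>a. \<forall>x\<in>carrier G. f (a \<odot>\<^bsub>G\<^esub> x) = a \<odot>\<^bsub>H\<^esub> f x)"

text \<open>Both inclusions come from leastness of a span: the preimage of the right-hand span is a
  subspace containing \<open>X\<close>, and the image of the left-hand span is a subspace containing
  the image of \<open>X\<close>.\<close>

lemma span_image:
  assumes G: "vectorspace CC G" and H: "vectorspace CC H" and f: "leibniz_iso f G H" and X: "X \<subseteq> carrier G"
  shows "f ` LinearCombinations.module.span CC G X = LinearCombinations.module.span CC H (f ` X)"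
proof -
  interpret G: vectorspace CC G by (rule G)
  interpret H: vectorspace CC H by (rule H)
  have fc: "f x \<in> carrier H" if "x \<in> carrier G" for x
    using f that by (auto simp: leibniz_iso_def bij_betw_def)
  have f0: "f \<zero>\<^bsub>G\<^esub> = \<zero>\<^bsub>H\<^esub>" using f by (simp add: leibniz_iso_def)
  have fa: "f (x \<oplus>\<^bsub>G\<^esub> y) = f x \<oplus>\<^bsub>H\<^esub> f y" if "x \<in> carrier G" "y \<in> carrier G" for x y
    using f that by (simp add: leibniz_iso_def)
  have fs: "f (a \<odot>\<^bsub>G\<^esub> x) = a \<odot>\<^bsub>H\<^esub> f x" if "x \<in> carrier G" for a x
    using f that by (simp add: leibniz_iso_def)
  have sG: "VectorSpace.subspace CC (G.span X) G" by (rule subspace_CC_span[OF G X])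
  have X': "f ` X \<subseteq> carrier H" using X fc by auto
  have sH: "VectorSpace.subspace CC (H.span (f ` X)) H" by (rule subspace_CC_span[OF H X'])
  have "VectorSpace.subspace CC {x \<in> carrier G. f x \<in> H.span (f ` X)} G"
    using sH by (auto simp: subspace_CC_iff[OF G] subspace_CC_iff[OF H] fa fs f0)
  moreover have "X \<subseteq> {x \<in> carrier G. f x \<in> H.span (f ` X)}"
    using X H.in_own_span[OF X'] by auto
  ultimately have "G.span X \<subseteq> {x \<in> carrier G. f x \<in> H.span (f ` X)}"
    by (rule span_CC_least[OF G])
  moreover have "VectorSpace.subspace CC (f ` G.span X) H"
    unfolding subspace_CC_iff[OF H]
  proof (intro conjI ballI allI)
    have car: "G.span X \<subseteq> carrier G" using sG by (simp add: subspace_CC_iff[OF G])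
    then show "f ` G.span X \<subseteq> carrier H" using fc by auto
    have "\<zero>\<^bsub>G\<^esub> \<in> G.span X" using sG by (simp add: subspace_CC_iff[OF G])
    then show "\<zero>\<^bsub>H\<^esub> \<in> f ` G.span X" using f0 by (metis imageI)
    fix v a assume "v \<in> f ` G.span X"
    then obtain x where x: "x \<in> G.span X" "v = f x" by blast
    have "a \<odot>\<^bsub>G\<^esub> x \<in> G.span X" using sG x by (simp add: subspace_CC_iff[OF G])
    moreover have "a \<odot>\<^bsub>H\<^esub> v = f (a \<odot>\<^bsub>G\<^esub> x)" using fs[of x a] x subsetD[OF car] by simp
    ultimately show "a \<odot>\<^bsub>H\<^esub> v \<in> f ` G.span X" by blast
    fix w assume "w \<in> f ` G.span X"
    then obtain y where y: "y \<in> G.span X" "w = f y" by blast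
    have "x \<oplus>\<^bsub>G\<^esub> y \<in> G.span X" using sG x y by (simp add: subspace_CC_iff[OF G])
    moreover have "v \<oplus>\<^bsub>H\<^esub> w = f (x \<oplus>\<^bsub>G\<^esub> y)" using fa[of x y] x y subsetD[OF car] by simp
    ultimately show "v \<oplus>\<^bsub>H\<^esub> w \<in> f ` G.span X" by blast
  qed
  then have "H.span (f ` X) \<subseteq> f ` G.span X"
    using G.in_own_span[OF X] by (intro span_CC_least[OF H]) auto
  ultimately show ?thesis by auto
qed

lemma derived_series_image:
  assumes G: "leibniz_algebra G" and H: "leibniz_algebra H" and f: "leibniz_iso f G H"
  shows "derived_series G n \<subseteq> carrier G \<and> f ` derived_series G n = derived_series H n"
proof -
  interpret G: leibniz_algebra G by (rule G)
  interpret H: leibniz_algebra H by (rule H)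
  have fb: "f \<lbrace>x, y\<rbrace>\<^bsub>G\<^esub> = \<lbrace>f x, f y\<rbrace>\<^bsub>H\<^esub>" if "x \<in> carrier G" "y \<in> carrier G" for x y
    using f that by (simp add: leibniz_iso_def)
  show ?thesis
  proof (induction n)
    case 0
    show ?case using f by (simp add: leibniz_iso_def bij_betw_def)
  next
    case (Suc n)
    let ?D = "derived_series G n"
    let ?X = "{\<lbrace>x, y\<rbrace>\<^bsub>G\<^esub> | x y. x \<in> ?D \<and> y \<in> ?D}"
    have D: "?D \<subseteq> carrier G" "f ` ?D = derived_series H n" using Suc by auto
    have X: "?X \<subseteq> carrier G" using D(1) by (auto intro!: G.bracket_closed)
    have "f ` ?X = {\<lbrace>x, y\<rbrace>\<^bsub>H\<^esub> | x y. x \<in> f ` ?D \<and> y \<in> f ` ?D}"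
    proof (intro equalityI subsetI)
      fix z assume "z \<in> f ` ?X"
      then obtain x y where xy: "z = f \<lbrace>x, y\<rbrace>\<^bsub>G\<^esub>" "x \<in> ?D" "y \<in> ?D" by auto
      then have "z = \<lbrace>f x, f y\<rbrace>\<^bsub>H\<^esub>" using subsetD[OF D(1)] fb by simp
      then show "z \<in> {\<lbrace>x, y\<rbrace>\<^bsub>H\<^esub> | x y. x \<in> f ` ?D \<and> y \<in> f ` ?D}" using xy by blast
    next
      fix z assume "z \<in> {\<lbrace>x, y\<rbrace>\<^bsub>H\<^esub> | x y. x \<in> f ` ?D \<and> y \<in> f ` ?D}"
      then obtain x y where xy: "z = \<lbrace>f x, f y\<rbrace>\<^bsub>H\<^esub>" "x \<in> ?D" "y \<in> ?D" by auto
      then have "z = f \<lbrace>x, y\<rbrace>\<^bsub>G\<^esub>" using subsetD[OF D(1)] fb by simp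
      then show "z \<in> f ` ?X" using xy by blast
    qed
    then show ?case
      using span_image[OF G.vectorspace_axioms H.vectorspace_axioms f X] D(2) G.span_is_subset2[OF X] by simp
  qed
qed

text \<open>Transport of structure: every element of \<open>H\<close> is a value of
  \<open>f\<close>, so each axiom reduces to its instance in \<open>G\<close>. This is how the coset
  algebra acquires its Lie axioms.\<close>

lemma leibniz_iso_lie_algebra:
  assumes G: "lie_algebra G" and f: "leibniz_iso f G H"
  shows "lie_algebra H"
proof -
  interpret G: lie_algebra G by (rule G)
  have H: "carrier H = f ` carrier G" using f by (auto simp: leibniz_iso_def bij_betw_def)
  have f0: "\<zero>\<^bsub>H\<^esub> = f \<zero>\<^bsub>G\<^esub>" using f by (simp add: leibniz_iso_def)
  have fa: "f x \<oplus>\<^bsub>H\<^esub> f y = f (x \<oplus>\<^bsub>G\<^esub> y)" "\<lbrace>f x, f y\<rbrace>\<^bsub>H\<^esub> = f \<lbrace>x, y\<rbrace>\<^bsub>G\<^esub>"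
    if "x \<in> carrier G" "y \<in> carrier G" for x y
    using f that by (simp_all add: leibniz_iso_def)
  have fs: "a \<odot>\<^bsub>H\<^esub> f x = f (a \<odot>\<^bsub>G\<^esub> x)" if "x \<in> carrier G" for a x
    using f that by (simp add: leibniz_iso_def)
  have ag: "abelian_group H"
  proof (rule abelian_groupI)
    fix x assume "x \<in> carrier H"
    then obtain g where g: "g \<in> carrier G" "x = f g" by (auto simp: H)
    then have "f (\<ominus>\<^bsub>G\<^esub> g) \<oplus>\<^bsub>H\<^esub> x = \<zero>\<^bsub>H\<^esub>" by (simp add: fa f0 G.l_neg)
    then show "\<exists>y\<in>carrier H. y \<oplus>\<^bsub>H\<^esub> x = \<zero>\<^bsub>H\<^esub>" using g by (auto simp: H)
  qed (auto simp: H f0 fa G.a_ac)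
  have mod: "Module.module CC H"
  proof (intro Module.module.intro module_axioms.intro ag)
    show "cring CC" by (rule Module.module.axioms(1)[OF G.module_axioms])
  qed (auto simp: H f0 fa fs G.smult_l_distr[simplified] G.smult_r_distr[simplified] G.smult_assoc1[simplified])
  have vs: "vectorspace CC H"
    using mod G.vectorspace_axioms by (simp add: vectorspace_def)
  interpret H: vectorspace CC H by (rule vs)
  have fm: "\<ominus>\<^bsub>H\<^esub> f x = f (\<ominus>\<^bsub>G\<^esub> x)" if "x \<in> carrier G" for x
  proof (rule H.minus_equality)
    show "f (\<ominus>\<^bsub>G\<^esub> x) \<oplus>\<^bsub>H\<^esub> f x = \<zero>\<^bsub>H\<^esub>" using that by (simp add: fa f0 G.l_neg)
  qed (use that in \<open>auto simp: H\<close>)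
  have fd: "H.fin_dim"
  proof -
    obtain X where X: "finite X" "X \<subseteq> carrier G" "G.span X = carrier G"
      using G.finite_dimensional by (auto simp: G.fin_dim_def)
    have "H.span (f ` X) = carrier H"
      using span_image[OF G.vectorspace_axioms vs f X(2)] X(3) H by simp
    then show ?thesis using X H by (auto simp: H.fin_dim_def intro!: exI[of _ "f ` X"])
  qed
  note [simp] = G.bracket_closed
  show ?thesis
  proof (intro lie_algebra.intro leibniz_algebra.intro leibniz_algebra_axioms.intro lie_algebra_axioms.intro vs fd)
    show "\<lbrace>x, x\<rbrace>\<^bsub>H\<^esub> = \<zero>\<^bsub>H\<^esub>" if "x \<in> carrier H" for x
      using that by (auto simp: H fa f0 G.bracket_self)
    show "\<lbrace>x, \<lbrace>y, z\<rbrace>\<^bsub>H\<^esub>\<rbrace>\<^bsub>H\<^esub> = \<lbrace>\<lbrace>x, y\<rbrace>\<^bsub>H\<^esub>, z\<rbrace>\<^bsub>H\<^esub> \<ominus>\<^bsub>H\<^esub> \<lbrace>\<lbrace>x, z\<rbrace>\<^bsub>H\<^esub>, y\<rbrace>\<^bsub>H\<^esub>"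
      if "x \<in> carrier H" "y \<in> carrier H" "z \<in> carrier H" for x y z
      using that by (auto simp: H fa fm G.leibniz_identity a_minus_def)
  qed (auto simp: H fa fs G.bracket_add_left G.bracket_add_right G.bracket_smult_left G.bracket_smult_right)
qed

text \<open>A solvable ideal of \<open>H\<close> is pulled back along \<open>f\<close>. The derived
  series of the preimage maps onto that of the ideal, and injectivity brings its vanishing back to
  \<open>G\<close>.\<close>

lemma leibniz_iso_semisimple:
  assumes G: "semisimple_lie G" and f: "leibniz_iso f G H"
  shows "semisimple_lie H"
proof -
  interpret G: lie_algebra G using G by (simp add: semisimple_lie_def)
  interpret H: lie_algebra H by (rule leibniz_iso_lie_algebra[OF G.lie_algebra_axioms f])
  have inj: "inj_on f (carrier G)" and img: "f ` carrier G = carrier H"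
    using f by (auto simp: leibniz_iso_def bij_betw_def)
  have f0: "f \<zero>\<^bsub>G\<^esub> = \<zero>\<^bsub>H\<^esub>" using f by (simp add: leibniz_iso_def)
  have "J = {\<zero>\<^bsub>H\<^esub>}" if J: "leibniz_ideal H J" and solv: "solvable_algebra (H\<lparr>carrier := J\<rparr>)" for J
  proof -
    define J' where "J' = {x \<in> carrier G. f x \<in> J}"
    have "VectorSpace.subspace CC J' G"
      using H.ideal_subspace[OF J] f by (auto simp: J'_def G.subspace_iff H.subspace_iff leibniz_iso_def)
    then have J': "leibniz_ideal G J'"
      using J f img by (auto simp: J'_def leibniz_ideal_def G.bracket_closed leibniz_iso_def)
    have fJ': "f ` J' = J"
      using H.ideal_carrier[OF J] img by (fastforce simp: J'_def)
    have iso: "leibniz_iso f (G\<lparr>carrier := J'\<rparr>) (H\<lparr>carrier := J\<rparr>)"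
      using f fJ' inj_on_subset[OF inj, of J'] by (auto simp: leibniz_iso_def bij_betw_def J'_def)
    obtain n where n: "derived_series (H\<lparr>carrier := J\<rparr>) n = {\<zero>\<^bsub>H\<^esub>}"
      using solv by (auto simp: solvable_algebra_def)
    have D: "derived_series (G\<lparr>carrier := J'\<rparr>) n \<subseteq> J'" "f ` derived_series (G\<lparr>carrier := J'\<rparr>) n = {\<zero>\<^bsub>H\<^esub>}"
      using derived_series_image[OF G.leibniz_subalgebra_restrict[OF G.ideal_subalgebra[OF J']]
          H.leibniz_subalgebra_restrict[OF H.ideal_subalgebra[OF J]] iso, of n] n by auto
    have "x = \<zero>\<^bsub>G\<^esub>" if "x \<in> derived_series (G\<lparr>carrier := J'\<rparr>) n" for x
      using that D f0 inj by (intro inj_onD[OF inj]) (auto simp: J'_def)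
    then have "derived_series (G\<lparr>carrier := J'\<rparr>) n = {\<zero>\<^bsub>G\<^esub>}" using D(2) by blast
    then have "solvable_algebra (G\<lparr>carrier := J'\<rparr>)" by (auto simp: solvable_algebra_def)
    then have "J' = {\<zero>\<^bsub>G\<^esub>}" using G J' by (simp add: semisimple_lie_def)
    then show ?thesis using fJ' f0 by auto
  qed
  then show ?thesis using H.lie_algebra_axioms by (simp add: semisimple_lie_def)
qed

lemma mem_set_add_iff: "x \<in> A <+>\<^bsub>L\<^esub> B \<longleftrightarrow> (\<exists>a\<in>A. \<exists>b\<in>B. x = a \<oplus>\<^bsub>L\<^esub> b)"
  by (auto simp: set_add_def set_mult_def)

lemma internal_direct_sum_commute:
  assumes "vectorspace CC L" "internal_direct_sum L A B"
  shows "internal_direct_sum L B A"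
proof -
  interpret vectorspace CC L by (rule assms)
  have "A \<subseteq> carrier L" "B \<subseteq> carrier L"
    using assms by (auto simp: internal_direct_sum_def subspace_CC_iff)
  then have comm: "a \<oplus>\<^bsub>L\<^esub> b = b \<oplus>\<^bsub>L\<^esub> a" if "a \<in> A" "b \<in> B" for a b
    using that a_comm by blast
  have "x \<in> A <+>\<^bsub>L\<^esub> B \<longleftrightarrow> x \<in> B <+>\<^bsub>L\<^esub> A" for x
    unfolding mem_set_add_iff by (metis comm)
  then have "A <+>\<^bsub>L\<^esub> B = B <+>\<^bsub>L\<^esub> A" by blast
  then show ?thesis using assms by (auto simp: internal_direct_sum_def)
qed

lemma internal_direct_sumE:
  assumes "internal_direct_sum L A B" "x \<in> carrier L"
  obtains a b where "a \<in> A" "b \<in> B" "x = a \<oplus>\<^bsub>L\<^esub> b"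
  using assms mem_set_add_iff[of x L A B] unfolding internal_direct_sum_def by blast

text \<open>The bracket lies in both ideals, hence in their intersection.\<close>

lemma direct_sum_ideals_bracket:
  assumes L: "leibniz_algebra L" and "leibniz_ideal L A" "leibniz_ideal L B" "internal_direct_sum L A B"
    and "a \<in> A" "b \<in> B"
  shows "\<lbrace>a, b\<rbrace>\<^bsub>L\<^esub> = \<zero>\<^bsub>L\<^esub>"
proof -
  interpret leibniz_algebra L by (rule L)
  have "\<lbrace>a, b\<rbrace>\<^bsub>L\<^esub> \<in> A \<inter> B"
    using assms ideal_carrier by (simp add: leibniz_ideal_def)
  moreover have "A \<inter> B = {\<zero>\<^bsub>L\<^esub>}" using assms by (simp add: internal_direct_sum_def)
  ultimately show ?thesis by blast
qed

text \<open>The complement \<open>B\<close> annihilates \<open>A\<close>, so an ideal of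
  \<open>A\<close> is already an ideal of \<open>G\<close>, and its solvability is the same
  condition in either algebra.\<close>

lemma semisimple_lie_summand:
  assumes G: "semisimple_lie G" and A: "leibniz_ideal G A" and B: "leibniz_ideal G B"
    and AB: "internal_direct_sum G A B"
  shows "semisimple_lie (G\<lparr>carrier := A\<rparr>)"
proof -
  interpret G: lie_algebra G using G by (simp add: semisimple_lie_def)
  have "J = {\<zero>\<^bsub>G\<^esub>}"
    if J: "leibniz_ideal (G\<lparr>carrier := A\<rparr>) J" and solv: "solvable_algebra (G\<lparr>carrier := J\<rparr>)" for J
  proof -
    have JA: "J \<subseteq> A"
      using J subspace_CC_iff[OF G.subspace_is_vs[OF G.ideal_subspace[OF A]], of J] by (simp add: leibniz_ideal_def)
    have "VectorSpace.subspace CC J G"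
      using J subspace_CC_restrict[OF G.vectorspace_axioms G.ideal_subspace[OF A] JA] by (simp add: leibniz_ideal_def)
    then have "leibniz_ideal G J"
    proof (rule G.lie_idealI)
      fix j x assume j: "j \<in> J" and "x \<in> carrier G"
      then obtain a b where ab: "a \<in> A" "b \<in> B" "x = a \<oplus>\<^bsub>G\<^esub> b" using AB internal_direct_sumE by metis
      have "\<lbrace>j, x\<rbrace>\<^bsub>G\<^esub> = \<lbrace>j, a\<rbrace>\<^bsub>G\<^esub> \<oplus>\<^bsub>G\<^esub> \<lbrace>j, b\<rbrace>\<^bsub>G\<^esub>"
        using j JA ab G.ideal_carrier[OF A] G.ideal_carrier[OF B] by (auto simp: G.bracket_add_right)
      also have "\<lbrace>j, b\<rbrace>\<^bsub>G\<^esub> = \<zero>\<^bsub>G\<^esub>"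
        using direct_sum_ideals_bracket[OF G.leibniz_algebra_axioms A B AB _ ab(2)] j JA by auto
      finally have "\<lbrace>j, x\<rbrace>\<^bsub>G\<^esub> = \<lbrace>j, a\<rbrace>\<^bsub>G\<^esub>"
        using j JA ab(1) G.ideal_carrier[OF A] by (auto simp: G.bracket_closed)
      then show "\<lbrace>j, x\<rbrace>\<^bsub>G\<^esub> \<in> J" using J j ab by (simp add: leibniz_ideal_def)
    qed
    then show ?thesis using G solv by (simp add: semisimple_lie_def)
  qed
  then show ?thesis
    using G.lie_subalgebra_restrict[OF G.ideal_subalgebra[OF A]] by (simp add: semisimple_lie_def)
qed

section \<open>The kernel spanned by the squares\<close>

context leibniz_algebra
begin

lemma squares_carrier: "{\<lbrace>x, x\<rbrace> | x. x \<in> carrier L} \<subseteq> carrier L"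
  by (auto simp: bracket_closed)

lemma kernel_subspace: "VectorSpace.subspace CC (leibniz_kernel L) L"
  unfolding leibniz_kernel_def by (rule subspace_CC_span[OF vectorspace_axioms squares_carrier])

lemma square_in_kernel: "x \<in> carrier L \<Longrightarrow> \<lbrace>x, x\<rbrace> \<in> leibniz_kernel L"
  unfolding leibniz_kernel_def using in_own_span[OF squares_carrier] by blast

lemma kernel_carrier: "i \<in> leibniz_kernel L \<Longrightarrow> i \<in> carrier L"
  using kernel_subspace by (auto simp: subspace_iff)

lemma kernel_least:
  "VectorSpace.subspace CC W L \<Longrightarrow> (\<And>x. x \<in> carrier L \<Longrightarrow> \<lbrace>x, x\<rbrace> \<in> W) \<Longrightarrow> leibniz_kernel L \<subseteq> W"
  unfolding leibniz_kernel_def by (rule span_CC_least[OF vectorspace_axioms]) auto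

text \<open>By the Leibniz identity, [x, [y, y]] is the difference of [[x, y], y] with itself; the
  elements annihilated by left multiplication with \<open>x\<close> form a subspace.\<close>

lemma bracket_kernel_right:
  assumes i: "i \<in> leibniz_kernel L" and x: "x \<in> carrier L"
  shows "\<lbrace>x, i\<rbrace> = \<zero>"
proof -
  have "leibniz_kernel L \<subseteq> {i \<in> carrier L. \<lbrace>x, i\<rbrace> = \<zero>}"
  proof (rule kernel_least)
    show "VectorSpace.subspace CC {i \<in> carrier L. \<lbrace>x, i\<rbrace> = \<zero>} L"
      using x by (auto simp: subspace_iff bracket_add_right bracket_smult_right)
    show "\<lbrace>y, y\<rbrace> \<in> {i \<in> carrier L. \<lbrace>x, i\<rbrace> = \<zero>}" if "y \<in> carrier L" for y
      using x that leibniz_identity[of x y y] by (simp add: bracket_closed a_minus_def r_neg)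
  qed
  then show ?thesis using i by blast
qed

text \<open>Polarization: the expression is the square of x + y minus the squares of
  \<open>x\<close> and \<open>y\<close>.\<close>

lemma symmetric_bracket_in_kernel:
  assumes x: "x \<in> carrier L" and y: "y \<in> carrier L"
  shows "\<lbrace>x, y\<rbrace> \<oplus> \<lbrace>y, x\<rbrace> \<in> leibniz_kernel L"
proof -
  note [simp] = bracket_closed
  let ?s = "\<lbrace>x, x\<rbrace> \<oplus> \<lbrace>y, y\<rbrace>"
  have "\<lbrace>x \<oplus> y, x \<oplus> y\<rbrace> = ?s \<oplus> (\<lbrace>x, y\<rbrace> \<oplus> \<lbrace>y, x\<rbrace>)"
    using x y by (simp add: bracket_add_left bracket_add_right a_ac)
  then have "\<lbrace>x, y\<rbrace> \<oplus> \<lbrace>y, x\<rbrace> = \<lbrace>x \<oplus> y, x \<oplus> y\<rbrace> \<ominus> ?s"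
    using x y add_minus_cancel_left[of ?s "\<lbrace>x, y\<rbrace> \<oplus> \<lbrace>y, x\<rbrace>"] by simp
  moreover have "?s \<in> leibniz_kernel L"
    using kernel_subspace square_in_kernel x y by (simp add: subspace_iff)
  ultimately show ?thesis
    using subspace_CC_minus[OF vectorspace_axioms kernel_subspace] square_in_kernel x y by simp
qed

lemma kernel_ideal: "leibniz_ideal L (leibniz_kernel L)"
  unfolding leibniz_ideal_def
proof (intro conjI ballI kernel_subspace)
  fix x i assume x: "x \<in> carrier L" and i: "i \<in> leibniz_kernel L"
  show "\<lbrace>x, i\<rbrace> \<in> leibniz_kernel L"
    using bracket_kernel_right[OF i x] kernel_subspace by (simp add: subspace_iff)
  \<comment> \<open>Since [x, i] = 0, the symmetric sum of
    \<open>symmetric_bracket_in_kernel\<close> reduces to [i, x].\<close>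
  show "\<lbrace>i, x\<rbrace> \<in> leibniz_kernel L"
    using symmetric_bracket_in_kernel[OF kernel_carrier[OF i] x] bracket_kernel_right[OF i x] x kernel_carrier[OF i]
    by (simp add: bracket_closed)
qed

end

text \<open>The coset map restricted to a complementary subalgebra is an isomorphism onto the
  quotient by the kernel, and semisimplicity is transported along it.\<close>

lemma semisimple_leibniz_split:
  assumes E: "leibniz_algebra E" and P: "leibniz_subalgebra E P"
    and ss: "semisimple_lie (E\<lparr>carrier := P\<rparr>)" and sum: "internal_direct_sum E P (leibniz_kernel E)"
  shows "semisimple_leibniz E"
proof -
  interpret E: leibniz_algebra E by (rule E)
  define I where "I = leibniz_kernel E"
  have I: "leibniz_ideal E I" unfolding I_def by (rule E.kernel_ideal)
  have I_sub: "VectorSpace.subspace CC I E" by (rule E.ideal_subspace[OF I])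
  have I_car: "i \<in> I \<Longrightarrow> i \<in> carrier E" for i by (rule E.ideal_carrier[OF I])
  have P_car: "p \<in> P \<Longrightarrow> p \<in> carrier E" for p
    using P by (auto simp: leibniz_subalgebra_def E.subspace_iff)
  have P_br: "p \<in> P \<Longrightarrow> q \<in> P \<Longrightarrow> \<lbrace>p, q\<rbrace>\<^bsub>E\<^esub> \<in> P" for p q
    using P by (simp add: leibniz_subalgebra_def)
  have P_add: "p \<in> P \<Longrightarrow> q \<in> P \<Longrightarrow> p \<oplus>\<^bsub>E\<^esub> q \<in> P" for p q
    using P by (simp add: leibniz_subalgebra_def E.subspace_iff)
  have PI: "P \<inter> I = {\<zero>\<^bsub>E\<^esub>}" using sum by (simp add: internal_direct_sum_def I_def)
  define f where "f p = I +>\<^bsub>E\<^esub> p" for p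
  have mem: "x \<in> f p \<longleftrightarrow> (\<exists>i\<in>I. x = i \<oplus>\<^bsub>E\<^esub> p)" for x p
    by (auto simp: f_def a_r_coset_def r_coset_def)
  have absorb: "f (i \<oplus>\<^bsub>E\<^esub> p) = f p" if i: "i \<in> I" and p: "p \<in> carrier E" for i p
  proof (intro equalityI subsetI)
    fix x assume "x \<in> f (i \<oplus>\<^bsub>E\<^esub> p)"
    then obtain j where "j \<in> I" "x = j \<oplus>\<^bsub>E\<^esub> (i \<oplus>\<^bsub>E\<^esub> p)" by (auto simp: mem)
    then have "x = (j \<oplus>\<^bsub>E\<^esub> i) \<oplus>\<^bsub>E\<^esub> p" "j \<oplus>\<^bsub>E\<^esub> i \<in> I"
      using i p I_car I_sub by (simp_all add: E.a_assoc E.subspace_iff)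
    then show "x \<in> f p" by (auto simp: mem)
  next
    fix x assume "x \<in> f p"
    then obtain j where j: "j \<in> I" "x = j \<oplus>\<^bsub>E\<^esub> p" by (auto simp: mem)
    have "x = (j \<ominus>\<^bsub>E\<^esub> i) \<oplus>\<^bsub>E\<^esub> (i \<oplus>\<^bsub>E\<^esub> p)"
      using j i p I_car by (simp add: a_minus_def E.a_assoc E.r_neg1)
    then show "x \<in> f (i \<oplus>\<^bsub>E\<^esub> p)"
      using subspace_CC_minus[OF E.vectorspace_axioms I_sub j(1) i] by (auto simp: mem)
  qed
  have self: "p \<in> f p" if "p \<in> carrier E" for p
    using that I_sub E.l_zero[OF that] by (auto simp: mem E.subspace_iff intro!: bexI[of _ "\<zero>\<^bsub>E\<^esub>"])
  have f_add: "f p <+>\<^bsub>E\<^esub> f q = f (p \<oplus>\<^bsub>E\<^esub> q)" if pq: "p \<in> carrier E" "q \<in> carrier E" for p q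
  proof (intro equalityI subsetI)
    fix x assume "x \<in> f p <+>\<^bsub>E\<^esub> f q"
    then obtain i j where ij: "i \<in> I" "j \<in> I" "x = (i \<oplus>\<^bsub>E\<^esub> p) \<oplus>\<^bsub>E\<^esub> (j \<oplus>\<^bsub>E\<^esub> q)"
      by (auto simp: set_add_def set_mult_def mem)
    then have "x = (i \<oplus>\<^bsub>E\<^esub> j) \<oplus>\<^bsub>E\<^esub> (p \<oplus>\<^bsub>E\<^esub> q)" using I_car pq by (simp add: E.a_ac)
    moreover have "i \<oplus>\<^bsub>E\<^esub> j \<in> I" using ij I_sub by (simp add: E.subspace_iff)
    ultimately show "x \<in> f (p \<oplus>\<^bsub>E\<^esub> q)" by (auto simp: mem)
  next
    fix x assume "x \<in> f (p \<oplus>\<^bsub>E\<^esub> q)"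
    then obtain i where i: "i \<in> I" "x = i \<oplus>\<^bsub>E\<^esub> (p \<oplus>\<^bsub>E\<^esub> q)" by (auto simp: mem)
    then have "x = (i \<oplus>\<^bsub>E\<^esub> p) \<oplus>\<^bsub>E\<^esub> q" using I_car pq by (simp add: E.a_assoc)
    moreover have "i \<oplus>\<^bsub>E\<^esub> p \<in> f p" using i by (auto simp: mem)
    ultimately show "x \<in> f p <+>\<^bsub>E\<^esub> f q" using self[OF pq(2)] by (auto simp: set_add_def set_mult_def)
  qed
  \<comment> \<open>The quotient operations are unions over representatives. By
    \<open>absorb\<close> all the united cosets coincide, and \<open>self\<close> supplies at least
    one, so the union is that coset.\<close>
  have f_smult: "(\<Union>a\<in>f p. f (d \<odot>\<^bsub>E\<^esub> a)) = f (d \<odot>\<^bsub>E\<^esub> p)" if p: "p \<in> carrier E" for d p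
  proof -
    have "f (d \<odot>\<^bsub>E\<^esub> a) = f (d \<odot>\<^bsub>E\<^esub> p)" if a: "a \<in> f p" for a
    proof -
      obtain i where i: "i \<in> I" "a = i \<oplus>\<^bsub>E\<^esub> p" using a unfolding mem by blast
      have "d \<odot>\<^bsub>E\<^esub> a = d \<odot>\<^bsub>E\<^esub> i \<oplus>\<^bsub>E\<^esub> d \<odot>\<^bsub>E\<^esub> p"
        using i p I_car E.smult_r_distr[of d i p] by simp
      then show ?thesis using i p I_sub absorb[of "d \<odot>\<^bsub>E\<^esub> i" "d \<odot>\<^bsub>E\<^esub> p"] by (simp add: E.subspace_iff)
    qed
    then show ?thesis using self[OF p] by blast
  qed
  have f_br: "(\<Union>a\<in>f p. \<Union>b\<in>f q. f \<lbrace>a, b\<rbrace>\<^bsub>E\<^esub>) = f \<lbrace>p, q\<rbrace>\<^bsub>E\<^esub>"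
    if pq: "p \<in> carrier E" "q \<in> carrier E" for p q
  proof -
    have "f \<lbrace>a, b\<rbrace>\<^bsub>E\<^esub> = f \<lbrace>p, q\<rbrace>\<^bsub>E\<^esub>" if ab: "a \<in> f p" "b \<in> f q" for a b
    proof -
      obtain i j where ij: "i \<in> I" "a = i \<oplus>\<^bsub>E\<^esub> p" "j \<in> I" "b = j \<oplus>\<^bsub>E\<^esub> q" using ab unfolding mem by blast
      \<comment> \<open>Every term of the expansion except [p, q] has an argument in the ideal
        \<open>I\<close>.\<close>
      have "\<lbrace>a, b\<rbrace>\<^bsub>E\<^esub> = (\<lbrace>i, j\<rbrace>\<^bsub>E\<^esub> \<oplus>\<^bsub>E\<^esub> (\<lbrace>i, q\<rbrace>\<^bsub>E\<^esub> \<oplus>\<^bsub>E\<^esub> \<lbrace>p, j\<rbrace>\<^bsub>E\<^esub>)) \<oplus>\<^bsub>E\<^esub> \<lbrace>p, q\<rbrace>\<^bsub>E\<^esub>"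
        using ij pq I_car by (simp add: E.bracket_add_left E.bracket_add_right E.bracket_closed E.a_ac)
      moreover have "\<lbrace>i, j\<rbrace>\<^bsub>E\<^esub> \<oplus>\<^bsub>E\<^esub> (\<lbrace>i, q\<rbrace>\<^bsub>E\<^esub> \<oplus>\<^bsub>E\<^esub> \<lbrace>p, j\<rbrace>\<^bsub>E\<^esub>) \<in> I"
        using ij pq I I_car I_sub by (simp add: leibniz_ideal_def E.subspace_iff)
      ultimately show ?thesis using absorb pq by (simp add: E.bracket_closed)
    qed
    then show ?thesis using self[OF pq(1)] self[OF pq(2)] by blast
  qed
  define Q where "Q = leibniz_quotient E I"
  have Q: "carrier Q = f ` carrier E" "\<zero>\<^bsub>Q\<^esub> = I" "A \<oplus>\<^bsub>Q\<^esub> B = A <+>\<^bsub>E\<^esub> B"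
    "d \<odot>\<^bsub>Q\<^esub> A = (\<Union>a\<in>A. f (d \<odot>\<^bsub>E\<^esub> a))" "\<lbrace>A, B\<rbrace>\<^bsub>Q\<^esub> = (\<Union>a\<in>A. \<Union>b\<in>B. f \<lbrace>a, b\<rbrace>\<^bsub>E\<^esub>)" for A B d
    by (auto simp: Q_def leibniz_quotient_def A_RCOSETS_def' f_def)
  have "leibniz_iso f (E\<lparr>carrier := P\<rparr>) Q"
    unfolding leibniz_iso_def
  proof (intro conjI ballI allI)
    have "inj_on f P"
    proof (rule inj_onI)
      fix p q assume pq: "p \<in> P" "q \<in> P" "f p = f q"
      then obtain i where i: "i \<in> I" "p = i \<oplus>\<^bsub>E\<^esub> q" using self[of p] P_car by (auto simp: mem)
      then have "i = p \<ominus>\<^bsub>E\<^esub> q"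
        using pq P_car I_car by (simp add: a_minus_def E.a_assoc E.r_neg)
      moreover have "p \<ominus>\<^bsub>E\<^esub> q \<in> P"
        using P pq subspace_CC_minus[OF E.vectorspace_axioms] by (simp add: leibniz_subalgebra_def)
      ultimately have "i = \<zero>\<^bsub>E\<^esub>" using PI i by blast
      then show "p = q" using i pq P_car by simp
    qed
    moreover have "f ` P = f ` carrier E"
    proof (intro equalityI subsetI)
      fix A assume "A \<in> f ` carrier E"
      then obtain x where x: "x \<in> carrier E" "A = f x" by blast
      then obtain p i where pi: "p \<in> P" "i \<in> I" "x = p \<oplus>\<^bsub>E\<^esub> i"
        using internal_direct_sumE[OF sum] unfolding I_def by metis
      then have "x = i \<oplus>\<^bsub>E\<^esub> p" using P_car I_car by (simp add: E.a_comm)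
      then have "A = f p" using absorb[of i p] pi x P_car by simp
      then show "A \<in> f ` P" using pi by blast
    qed (use P_car in auto)
    ultimately show "bij_betw f (carrier (E\<lparr>carrier := P\<rparr>)) (carrier Q)"
      by (simp add: bij_betw_def Q)
    show "f \<zero>\<^bsub>E\<lparr>carrier := P\<rparr>\<^esub> = \<zero>\<^bsub>Q\<^esub>"
    proof -
      have "f \<zero>\<^bsub>E\<^esub> = I" using I_car by (auto simp: mem)
      then show ?thesis by (simp add: Q)
    qed
  qed (use P_car in \<open>simp_all add: Q f_add f_smult f_br\<close>)
  then have "semisimple_lie Q" by (rule leibniz_iso_semisimple[OF ss])
  then show ?thesis using E by (simp add: semisimple_leibniz_def Q_def I_def)
qed

text \<open>An ideal \<open>M\<close> of \<open>S\<close> inside the annihilator brackets to zero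
  with \<open>I\<close> on one side by its choice and on the other because [L, I] = 0; with its
  complement \<open>B\<close> it brackets to zero as well. So \<open>M\<close> is an ideal of all of
  \<open>L\<close>. That the kernel is nonzero makes the other summand nonzero.\<close>

lemma annihilator_trivial:
  fixes L :: "'v leibniz"
  assumes L: "leibniz_algebra L" and indec: "\<not> decomposable L" and nz: "leibniz_kernel L \<noteq> {\<zero>\<^bsub>L\<^esub>}"
    and S: "leibniz_subalgebra L S" and ss: "semisimple_lie (L\<lparr>carrier := S\<rparr>)"
    and sum: "internal_direct_sum L S (leibniz_kernel L)"
    and s: "s \<in> S" and ann: "\<And>i. i \<in> leibniz_kernel L \<Longrightarrow> \<lbrace>i, s\<rbrace>\<^bsub>L\<^esub> = \<zero>\<^bsub>L\<^esub>"
  shows "s = \<zero>\<^bsub>L\<^esub>"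
proof (rule ccontr)
  assume "s \<noteq> \<zero>\<^bsub>L\<^esub>"
  interpret L: leibniz_algebra L by (rule L)
  note [simp] = L.bracket_closed
  define I where "I = leibniz_kernel L"
  have I: "leibniz_ideal L I" unfolding I_def by (rule L.kernel_ideal)
  have I_sub: "VectorSpace.subspace CC I L" by (rule L.ideal_subspace[OF I])
  have I_car: "i \<in> I \<Longrightarrow> i \<in> carrier L" for i by (rule L.ideal_carrier[OF I])
  have xI: "\<lbrace>x, i\<rbrace>\<^bsub>L\<^esub> = \<zero>\<^bsub>L\<^esub>" if "x \<in> carrier L" "i \<in> I" for x i
    using L.bracket_kernel_right that by (simp add: I_def)
  have Ix: "\<lbrace>i, x\<rbrace>\<^bsub>L\<^esub> \<in> I" if "x \<in> carrier L" "i \<in> I" for x i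
    using I that by (simp add: leibniz_ideal_def)
  have S_sub: "VectorSpace.subspace CC S L" using S by (simp add: leibniz_subalgebra_def)
  have S_car: "x \<in> S \<Longrightarrow> x \<in> carrier L" for x using S_sub by (auto simp: L.subspace_iff)
  have S_br: "x \<in> S \<Longrightarrow> y \<in> S \<Longrightarrow> \<lbrace>x, y\<rbrace>\<^bsub>L\<^esub> \<in> S" for x y
    using S by (simp add: leibniz_subalgebra_def)
  have SI: "S \<inter> I = {\<zero>\<^bsub>L\<^esub>}" using sum by (simp add: internal_direct_sum_def I_def)
  define G where "G = L\<lparr>carrier := S\<rparr>"
  have G_simps: "carrier G = S" "x \<oplus>\<^bsub>G\<^esub> y = x \<oplus>\<^bsub>L\<^esub> y" "a \<odot>\<^bsub>G\<^esub> x = a \<odot>\<^bsub>L\<^esub> x" "\<zero>\<^bsub>G\<^esub> = \<zero>\<^bsub>L\<^esub>"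
    "\<lbrace>x, y\<rbrace>\<^bsub>G\<^esub> = \<lbrace>x, y\<rbrace>\<^bsub>L\<^esub>" "G\<lparr>carrier := X\<rparr> = L\<lparr>carrier := X\<rparr>" for x y a X
    by (simp_all add: G_def)
  have G: "semisimple_lie G" using ss by (simp add: G_def)
  interpret G: lie_algebra G using G by (simp add: semisimple_lie_def)
  define K where "K = {x \<in> S. \<forall>i\<in>I. \<lbrace>i, x\<rbrace>\<^bsub>L\<^esub> = \<zero>\<^bsub>L\<^esub>}"
  have "VectorSpace.subspace CC K G"
    using S_sub S_car I_car
    by (auto simp: G.subspace_iff L.subspace_iff K_def G_simps L.bracket_add_right L.bracket_smult_right)
  then have K: "leibniz_ideal G K"
  proof (rule G.lie_idealI)
    fix k x assume k: "k \<in> K" and "x \<in> carrier G"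
    then have x: "x \<in> S" by (simp add: G_simps)
    \<comment> \<open>The Leibniz identity gives [i, [k, x]] = [[i, k], x] - [[i, x], k]. Both terms
      vanish, the second because [i, x] is again in \<open>I\<close>.\<close>
    have "\<lbrace>i, \<lbrace>k, x\<rbrace>\<^bsub>L\<^esub>\<rbrace>\<^bsub>L\<^esub> = \<zero>\<^bsub>L\<^esub>" if i: "i \<in> I" for i
      using L.leibniz_identity[of i k x] Ix[of x i] k x i S_car I_car
      by (simp add: K_def a_minus_def L.r_neg)
    then show "\<lbrace>k, x\<rbrace>\<^bsub>G\<^esub> \<in> K" using k x S_br by (simp add: K_def G_simps)
  qed
  have "s \<in> K" using s ann by (simp add: K_def I_def)
  then have "K \<noteq> {\<zero>\<^bsub>G\<^esub>}" using \<open>s \<noteq> \<zero>\<^bsub>L\<^esub>\<close> by (auto simp: G_simps)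
  then obtain M B where M: "leibniz_ideal G M" and B: "leibniz_ideal G B" and MK: "M \<subseteq> K"
    and M0: "M \<noteq> {\<zero>\<^bsub>G\<^esub>}" and MB: "internal_direct_sum G M B"
    using semisimple_lie_split_ideal[OF G K] by blast
  have BM: "internal_direct_sum G B M" by (rule internal_direct_sum_commute[OF G.vectorspace_axioms MB])
  have M_S: "m \<in> M \<Longrightarrow> m \<in> S" and B_S: "b \<in> B \<Longrightarrow> b \<in> S" for m b
    using G.ideal_carrier[OF M] G.ideal_carrier[OF B] by (simp_all add: G_simps)
  note car = S_car[OF M_S] S_car[OF B_S] I_car S_car
  have M_sub: "VectorSpace.subspace CC M L" and B_sub: "VectorSpace.subspace CC B L"
    using G.ideal_subspace[OF M] G.ideal_subspace[OF B] S_sub M_S B_S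
    by (auto simp: G.subspace_iff L.subspace_iff G_simps)
  have MB0: "\<lbrace>m, b\<rbrace>\<^bsub>L\<^esub> = \<zero>\<^bsub>L\<^esub>" "\<lbrace>b, m\<rbrace>\<^bsub>L\<^esub> = \<zero>\<^bsub>L\<^esub>" if "m \<in> M" "b \<in> B" for m b
    using direct_sum_ideals_bracket[OF G.leibniz_algebra_axioms M B MB that]
      direct_sum_ideals_bracket[OF G.leibniz_algebra_axioms B M BM that(2,1)] by (simp_all add: G_simps)
  have IM: "\<lbrace>i, m\<rbrace>\<^bsub>L\<^esub> = \<zero>\<^bsub>L\<^esub>" if "m \<in> M" "i \<in> I" for m i
    using MK that by (auto simp: K_def)
  have S_dec: "\<exists>m\<in>M. \<exists>b\<in>B. x = m \<oplus>\<^bsub>L\<^esub> b" if "x \<in> S" for x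
    using MB that mem_set_add_iff[of x G M B] by (simp add: internal_direct_sum_def G_simps)
  have L_dec: "\<exists>m\<in>M. \<exists>b\<in>B. \<exists>i\<in>I. x = m \<oplus>\<^bsub>L\<^esub> (b \<oplus>\<^bsub>L\<^esub> i)" if x: "x \<in> carrier L" for x
  proof -
    obtain t i where ti: "t \<in> S" "i \<in> I" "x = t \<oplus>\<^bsub>L\<^esub> i"
      using sum x unfolding I_def by (rule internal_direct_sumE)
    obtain m b where mb: "m \<in> M" "b \<in> B" "t = m \<oplus>\<^bsub>L\<^esub> b" using S_dec[OF ti(1)] by blast
    have "x = m \<oplus>\<^bsub>L\<^esub> (b \<oplus>\<^bsub>L\<^esub> i)" using ti mb car by (simp add: L.a_assoc)
    then show ?thesis using ti mb by blast
  qed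
  define C where "C = B <+>\<^bsub>L\<^esub> I"
  have C: "x \<in> C \<longleftrightarrow> (\<exists>b\<in>B. \<exists>i\<in>I. x = b \<oplus>\<^bsub>L\<^esub> i)" for x
    by (simp add: C_def mem_set_add_iff)
  have C_car: "x \<in> C \<Longrightarrow> x \<in> carrier L" for x using car by (auto simp: C)
  have B0: "\<zero>\<^bsub>L\<^esub> \<in> B" and I0: "\<zero>\<^bsub>L\<^esub> \<in> I" using B_sub I_sub by (simp_all add: L.subspace_iff)
  have BC: "b \<in> B \<Longrightarrow> b \<in> C" for b
    using I0 car by (force simp: C)
  have IC: "i \<in> I \<Longrightarrow> i \<in> C" for i
    using B0 car by (force simp: C)
  have C_sub: "VectorSpace.subspace CC C L"
    unfolding L.subspace_iff
  proof (intro conjI ballI allI subsetI)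
    show "\<zero>\<^bsub>L\<^esub> \<in> C" using BC[OF B0] .
    fix x a assume "x \<in> C"
    then obtain b i where bi: "b \<in> B" "i \<in> I" "x = b \<oplus>\<^bsub>L\<^esub> i" by (auto simp: C)
    have "a \<odot>\<^bsub>L\<^esub> x = a \<odot>\<^bsub>L\<^esub> b \<oplus>\<^bsub>L\<^esub> a \<odot>\<^bsub>L\<^esub> i"
      using bi car L.smult_r_distr[of a b i] by simp
    moreover have "a \<odot>\<^bsub>L\<^esub> b \<in> B" "a \<odot>\<^bsub>L\<^esub> i \<in> I" using bi B_sub I_sub by (simp_all add: L.subspace_iff)
    ultimately show "a \<odot>\<^bsub>L\<^esub> x \<in> C" unfolding C by blast
    fix y assume "y \<in> C"
    then obtain b' i' where bi': "b' \<in> B" "i' \<in> I" "y = b' \<oplus>\<^bsub>L\<^esub> i'" by (auto simp: C)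
    have "x \<oplus>\<^bsub>L\<^esub> y = (b \<oplus>\<^bsub>L\<^esub> b') \<oplus>\<^bsub>L\<^esub> (i \<oplus>\<^bsub>L\<^esub> i')"
      using bi bi' car by (simp add: L.a_ac)
    moreover have "b \<oplus>\<^bsub>L\<^esub> b' \<in> B" "i \<oplus>\<^bsub>L\<^esub> i' \<in> I" using bi bi' B_sub I_sub by (simp_all add: L.subspace_iff)
    ultimately show "x \<oplus>\<^bsub>L\<^esub> y \<in> C" unfolding C by blast
  qed (rule C_car)
  have M_ideal: "leibniz_ideal L M"
    unfolding leibniz_ideal_def
  proof (intro conjI ballI M_sub)
    fix x m assume "x \<in> carrier L" and m: "m \<in> M"
    then obtain m' b i where x: "m' \<in> M" "b \<in> B" "i \<in> I" "x = m' \<oplus>\<^bsub>L\<^esub> (b \<oplus>\<^bsub>L\<^esub> i)" using L_dec by blast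
    have "\<lbrace>x, m\<rbrace>\<^bsub>L\<^esub> = \<lbrace>m', m\<rbrace>\<^bsub>L\<^esub>" "\<lbrace>m, x\<rbrace>\<^bsub>L\<^esub> = \<lbrace>m, m'\<rbrace>\<^bsub>L\<^esub>"
      using x m car by (simp_all add: L.bracket_add_left L.bracket_add_right MB0 IM xI)
    moreover have "\<lbrace>m', m\<rbrace>\<^bsub>L\<^esub> \<in> M" "\<lbrace>m, m'\<rbrace>\<^bsub>L\<^esub> \<in> M"
      using M M_S x(1) m by (simp_all add: leibniz_ideal_def G_simps)
    ultimately show "\<lbrace>x, m\<rbrace>\<^bsub>L\<^esub> \<in> M" "\<lbrace>m, x\<rbrace>\<^bsub>L\<^esub> \<in> M" by simp_all
  qed
  have C_ideal: "leibniz_ideal L C"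
    unfolding leibniz_ideal_def
  proof (intro conjI ballI C_sub)
    fix x y assume x: "x \<in> carrier L" and "y \<in> C"
    then obtain b j where y: "b \<in> B" "j \<in> I" "y = b \<oplus>\<^bsub>L\<^esub> j" by (auto simp: C)
    obtain t i where ti: "t \<in> S" "i \<in> I" "x = t \<oplus>\<^bsub>L\<^esub> i"
      using sum x unfolding I_def by (rule internal_direct_sumE)
    have "\<lbrace>x, y\<rbrace>\<^bsub>L\<^esub> = \<lbrace>t, b\<rbrace>\<^bsub>L\<^esub> \<oplus>\<^bsub>L\<^esub> \<lbrace>i, b\<rbrace>\<^bsub>L\<^esub>" "\<lbrace>y, x\<rbrace>\<^bsub>L\<^esub> = \<lbrace>b, t\<rbrace>\<^bsub>L\<^esub> \<oplus>\<^bsub>L\<^esub> \<lbrace>j, t\<rbrace>\<^bsub>L\<^esub>"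
      using y ti car by (simp_all add: L.bracket_add_left L.bracket_add_right xI)
    moreover have "\<lbrace>t, b\<rbrace>\<^bsub>L\<^esub> \<in> B" "\<lbrace>b, t\<rbrace>\<^bsub>L\<^esub> \<in> B"
      using B y(1) ti(1) by (simp_all add: leibniz_ideal_def G_simps)
    moreover have "\<lbrace>i, b\<rbrace>\<^bsub>L\<^esub> \<in> I" "\<lbrace>j, t\<rbrace>\<^bsub>L\<^esub> \<in> I" using y ti car Ix by simp_all
    ultimately show "\<lbrace>x, y\<rbrace>\<^bsub>L\<^esub> \<in> C" "\<lbrace>y, x\<rbrace>\<^bsub>L\<^esub> \<in> C" unfolding C by blast+
  qed
  have MC: "internal_direct_sum L M C"
    unfolding internal_direct_sum_def
  proof (intro conjI M_sub C_sub equalityI subsetI)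
    fix x assume x: "x \<in> M \<inter> C"
    then obtain b i where bi: "b \<in> B" "i \<in> I" "x = b \<oplus>\<^bsub>L\<^esub> i" by (auto simp: C)
    \<comment> \<open>The component in \<open>I\<close> is a difference of two elements of
      \<open>S\<close>, which forces it to be zero.\<close>
    have "i = x \<ominus>\<^bsub>L\<^esub> b" using bi car L.add_minus_cancel_left[of b i] by simp
    also have "\<dots> \<in> S" using x bi by (intro subspace_CC_minus[OF L.vectorspace_axioms S_sub] M_S B_S) auto
    finally have "i = \<zero>\<^bsub>L\<^esub>" using SI bi by blast
    then have "x = b" using bi car by simp
    then have "x \<in> M \<inter> B" using x bi by blast
    moreover have "M \<inter> B = {\<zero>\<^bsub>L\<^esub>}" using MB by (simp add: internal_direct_sum_def G_simps)
    ultimately show "x \<in> {\<zero>\<^bsub>L\<^esub>}" by blast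
  next
    fix x assume "x \<in> {\<zero>\<^bsub>L\<^esub>}"
    then show "x \<in> M \<inter> C" using M_sub C_sub by (simp add: L.subspace_iff)
  next
    fix x assume "x \<in> M <+>\<^bsub>L\<^esub> C"
    then show "x \<in> carrier L" using car C_car by (auto simp: mem_set_add_iff)
  next
    fix x assume "x \<in> carrier L"
    then obtain m b i where d: "m \<in> M" "b \<in> B" "i \<in> I" "x = m \<oplus>\<^bsub>L\<^esub> (b \<oplus>\<^bsub>L\<^esub> i)" using L_dec by blast
    then have "b \<oplus>\<^bsub>L\<^esub> i \<in> C" unfolding C by blast
    then show "x \<in> M <+>\<^bsub>L\<^esub> C" using d unfolding mem_set_add_iff by blast
  qed
  have ssM: "semisimple_lie (L\<lparr>carrier := M\<rparr>)"
    using semisimple_lie_summand[OF G M B MB] by (simp add: G_simps)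
  have ssB: "semisimple_lie (L\<lparr>carrier := B\<rparr>)"
    using semisimple_lie_summand[OF G B M BM] by (simp add: G_simps)
  \<comment> \<open>\<open>M\<close> is a Lie algebra, so its kernel is zero and \<open>M\<close>
    itself is the complement that \<open>semisimple_leibniz_split\<close> asks for.\<close>
  have "semisimple_leibniz (L\<lparr>carrier := M\<rparr>)"
  proof (rule semisimple_leibniz_split[of _ M])
    interpret M: lie_algebra "L\<lparr>carrier := M\<rparr>" using ssM by (simp add: semisimple_lie_def)
    show "leibniz_algebra (L\<lparr>carrier := M\<rparr>)" by (rule M.leibniz_algebra_axioms)
    have whole: "VectorSpace.subspace CC M (L\<lparr>carrier := M\<rparr>)"
      using M_sub by (auto simp: M.subspace_iff L.subspace_iff)
    then show "leibniz_subalgebra (L\<lparr>carrier := M\<rparr>) M"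
      using M.bracket_closed by (simp add: leibniz_subalgebra_def)
    show "semisimple_lie (L\<lparr>carrier := M, carrier := M\<rparr>)" using ssM by simp
    have zero: "VectorSpace.subspace CC {\<zero>\<^bsub>L\<^esub>} (L\<lparr>carrier := M\<rparr>)"
      using M_sub L.smult_r_null by (auto simp: M.subspace_iff L.subspace_iff)
    then have "leibniz_kernel (L\<lparr>carrier := M\<rparr>) = {\<zero>\<^bsub>L\<^esub>}"
      using M.kernel_least[OF zero] M.bracket_self M.kernel_subspace by (auto simp: M.subspace_iff)
    then show "internal_direct_sum (L\<lparr>carrier := M\<rparr>) M (leibniz_kernel (L\<lparr>carrier := M\<rparr>))"
      using whole zero M_sub car
      by (auto simp: internal_direct_sum_def L.subspace_iff mem_set_add_iff intro!: Set.set_eqI)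
  qed
  moreover have "semisimple_leibniz (L\<lparr>carrier := C\<rparr>)"
  proof (rule semisimple_leibniz_split[of _ B])
    show C_alg: "leibniz_algebra (L\<lparr>carrier := C\<rparr>)"
      by (rule L.leibniz_subalgebra_restrict[OF L.ideal_subalgebra[OF C_ideal]])
    interpret C: leibniz_algebra "L\<lparr>carrier := C\<rparr>" by (rule C_alg)
    \<comment> \<open>\<open>M\<close> contributes nothing to squares, since it is Lie and
      annihilates \<open>B\<close> and \<open>I\<close> on both sides. So the kernel of
      \<open>C\<close> is again \<open>I\<close>, and \<open>B\<close> is a complement of it in
      \<open>C\<close>.\<close>
    have "{\<lbrace>x, x\<rbrace>\<^bsub>L\<^esub> | x. x \<in> carrier L} = {\<lbrace>x, x\<rbrace>\<^bsub>L\<^esub> | x. x \<in> C}"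
    proof (intro equalityI subsetI)
      fix z assume "z \<in> {\<lbrace>x, x\<rbrace>\<^bsub>L\<^esub> | x. x \<in> carrier L}"
      then obtain x where x: "x \<in> carrier L" "z = \<lbrace>x, x\<rbrace>\<^bsub>L\<^esub>" by blast
      obtain m b i where d: "m \<in> M" "b \<in> B" "i \<in> I" "x = m \<oplus>\<^bsub>L\<^esub> (b \<oplus>\<^bsub>L\<^esub> i)" using L_dec[OF x(1)] by blast
      have "\<lbrace>m, m\<rbrace>\<^bsub>L\<^esub> = \<zero>\<^bsub>L\<^esub>" using G.bracket_self[of m] M_S[OF d(1)] by (simp add: G_simps)
      then have "z = \<lbrace>b \<oplus>\<^bsub>L\<^esub> i, b \<oplus>\<^bsub>L\<^esub> i\<rbrace>\<^bsub>L\<^esub>"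
        using d car by (simp add: x(2) L.bracket_add_left L.bracket_add_right MB0 IM xI)
      then show "z \<in> {\<lbrace>x, x\<rbrace>\<^bsub>L\<^esub> | x. x \<in> C}" using d unfolding C by blast
    qed (use C_car in blast)
    moreover have "{\<lbrace>x, x\<rbrace>\<^bsub>L\<^esub> | x. x \<in> C} \<subseteq> C" using C.squares_carrier by simp
    ultimately have kernel: "leibniz_kernel (L\<lparr>carrier := C\<rparr>) = I"
      using span_CC_restrict[OF L.vectorspace_axioms C_sub] by (simp add: leibniz_kernel_def I_def)
    have BC_sub: "VectorSpace.subspace CC B (L\<lparr>carrier := C\<rparr>)" "VectorSpace.subspace CC I (L\<lparr>carrier := C\<rparr>)"
      using B_sub I_sub BC IC by (auto simp: C.subspace_iff L.subspace_iff)
    then show "leibniz_subalgebra (L\<lparr>carrier := C\<rparr>) B"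
      using B B_S by (simp add: leibniz_subalgebra_def leibniz_ideal_def G_simps)
    show "semisimple_lie (L\<lparr>carrier := C, carrier := B\<rparr>)" using ssB by simp
    have "B \<inter> I = {\<zero>\<^bsub>L\<^esub>}" using SI B_S B0 I0 by blast
    moreover have "B <+>\<^bsub>L\<lparr>carrier := C\<rparr>\<^esub> I = C"
      by (intro Set.set_eqI) (simp add: mem_set_add_iff C)
    ultimately show "internal_direct_sum (L\<lparr>carrier := C\<rparr>) B (leibniz_kernel (L\<lparr>carrier := C\<rparr>))"
      using BC_sub by (simp add: internal_direct_sum_def kernel)
  qed
  moreover have "C \<noteq> {\<zero>\<^bsub>L\<^esub>}" using nz IC I0 by (auto simp: I_def)
  moreover have "M \<noteq> {\<zero>\<^bsub>L\<^esub>}" using M0 by (simp add: G_simps)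
  ultimately have "decomposable L"
    unfolding decomposable_def using M_ideal C_ideal MC by blast
  then show False using indec by simp
qed

section \<open>Automorphisms\<close>

lemma leibniz_autoI:
  assumes "bij_betw f (carrier L) (carrier L)" "f \<in> extensional (carrier L)"
    and "\<And>x y. x \<in> carrier L \<Longrightarrow> y \<in> carrier L \<Longrightarrow> f (x \<oplus>\<^bsub>L\<^esub> y) = f x \<oplus>\<^bsub>L\<^esub> f y"
    and "\<And>a x. x \<in> carrier L \<Longrightarrow> f (a \<odot>\<^bsub>L\<^esub> x) = a \<odot>\<^bsub>L\<^esub> f x"
    and "\<And>x y. x \<in> carrier L \<Longrightarrow> y \<in> carrier L \<Longrightarrow> f \<lbrace>x, y\<rbrace>\<^bsub>L\<^esub> = \<lbrace>f x, f y\<rbrace>\<^bsub>L\<^esub>"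
  shows "f \<in> leibniz_auto L"
  using assms by (auto simp: leibniz_auto_def Bij_def LinearCombinations.module_hom_def bij_betw_def)

section \<open>The automorphism group and its two subgroups\<close>

context leibniz_algebra
begin

lemma autoD:
  assumes "f \<in> leibniz_auto L"
  shows "f \<in> Bij (carrier L)" "bij_betw f (carrier L) (carrier L)"
    and "x \<in> carrier L \<Longrightarrow> f x \<in> carrier L"
    and "x \<in> carrier L \<Longrightarrow> y \<in> carrier L \<Longrightarrow> f (x \<oplus> y) = f x \<oplus> f y"
    and "x \<in> carrier L \<Longrightarrow> f (a \<odot>\<^bsub>L\<^esub> x) = a \<odot>\<^bsub>L\<^esub> f x"
    and "x \<in> carrier L \<Longrightarrow> y \<in> carrier L \<Longrightarrow> f \<lbrace>x, y\<rbrace> = \<lbrace>f x, f y\<rbrace>"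
    and "x \<in> carrier L \<Longrightarrow> y \<in> carrier L \<Longrightarrow> f x = f y \<Longrightarrow> x = y"
  using assms
  by (auto simp: leibniz_auto_def Bij_def LinearCombinations.module_hom_def bij_betw_def dest: inj_onD)

lemma auto_zero: "f \<in> leibniz_auto L \<Longrightarrow> f \<zero> = \<zero>"
  using autoD(5)[of f \<zero> 0] autoD(3)[of f \<zero>] by simp

lemma auto_iso:
  assumes "f \<in> leibniz_auto L"
  shows "leibniz_iso f L L"
  unfolding leibniz_iso_def using autoD[OF assms] auto_zero[OF assms] by simp

text \<open>An automorphism permutes the squares, hence maps their span onto itself.\<close>

lemma auto_kernel:
  assumes f: "f \<in> leibniz_auto L"
  shows "f ` leibniz_kernel L = leibniz_kernel L"
proof -
  let ?X = "{\<lbrace>x, x\<rbrace> | x. x \<in> carrier L}"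
  have img: "f ` carrier L = carrier L" using autoD(2)[OF f] by (simp add: bij_betw_def)
  have "f ` ?X = ?X"
  proof (intro equalityI subsetI)
    fix z assume "z \<in> f ` ?X"
    then obtain x where "x \<in> carrier L" "z = f \<lbrace>x, x\<rbrace>" by blast
    then show "z \<in> ?X" using autoD(3,6)[OF f] by auto
  next
    fix z assume "z \<in> ?X"
    then obtain y where y: "y \<in> carrier L" "z = \<lbrace>y, y\<rbrace>" by blast
    then obtain x where "x \<in> carrier L" "y = f x" using img by blast
    then have "x \<in> carrier L" "z = f \<lbrace>x, x\<rbrace>" using y autoD(6)[OF f] by auto
    then show "z \<in> f ` ?X" by blast
  qed
  then show ?thesis
    unfolding leibniz_kernel_def
    using span_image[OF vectorspace_axioms vectorspace_axioms auto_iso[OF f] squares_carrier] by simp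
qed

abbreviation (input) "bij_group \<equiv> BijGroup (carrier L)"

lemma bij_group_simps: "carrier bij_group = Bij (carrier L)" "\<one>\<^bsub>bij_group\<^esub> = (\<lambda>x\<in>carrier L. x)"
  by (simp_all add: BijGroup_def)

lemma auto_mult: "f \<in> leibniz_auto L \<Longrightarrow> g \<in> leibniz_auto L \<Longrightarrow> f \<otimes>\<^bsub>bij_group\<^esub> g = compose (carrier L) f g"
  using autoD(1) by (simp add: BijGroup_def)

lemma auto_inv:
  assumes f: "f \<in> leibniz_auto L" and x: "x \<in> carrier L"
  shows "(inv\<^bsub>bij_group\<^esub> f) x \<in> carrier L" "f ((inv\<^bsub>bij_group\<^esub> f) x) = x" "(inv\<^bsub>bij_group\<^esub> f) (f x) = x"
  using autoD[OF f] x
  by (auto simp: inv_BijGroup bij_betw_def inv_into_into f_inv_into_f)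

lemma one_auto: "\<one>\<^bsub>bij_group\<^esub> \<in> leibniz_auto L"
  by (rule leibniz_autoI) (auto simp: bij_group_simps bracket_closed bij_betw_def inj_on_def)

lemma mult_auto:
  assumes "f \<in> leibniz_auto L" "g \<in> leibniz_auto L"
  shows "f \<otimes>\<^bsub>bij_group\<^esub> g \<in> leibniz_auto L"
  unfolding auto_mult[OF assms]
  by (rule leibniz_autoI)
    (use assms in \<open>auto simp: compose_eq autoD bracket_closed intro!: bij_betw_compose[where B = "carrier L"]\<close>)

lemma inv_auto:
  assumes f: "f \<in> leibniz_auto L"
  shows "inv\<^bsub>bij_group\<^esub> f \<in> leibniz_auto L"
proof -
  note [simp] = auto_inv[OF f] autoD(3-6)[OF f] bracket_closed
  \<comment> \<open>Each law for the inverse is checked by applying \<open>f\<close> to the claimed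
    value.\<close>
  have eq: "(inv\<^bsub>bij_group\<^esub> f) y = x" if "x \<in> carrier L" "f x = y" for x y
    using that by auto
  have "inv\<^bsub>bij_group\<^esub> f \<in> Bij (carrier L)"
    using group.inv_closed[OF group_BijGroup, of f "carrier L"] autoD(1)[OF f] by (simp add: bij_group_simps)
  then show ?thesis
    by (intro leibniz_autoI) (auto simp: Bij_def intro!: eq)
qed

lemma auto_subgroup: "subgroup (leibniz_auto L) bij_group"
  by (intro group.subgroupI[OF group_BijGroup])
    (use autoD(1) one_auto mult_auto inv_auto in \<open>auto simp: bij_group_simps\<close>)

lemma Aut_stab_subgroup:
  assumes "S \<subseteq> carrier L"
  shows "subgroup (Aut_stab L S) bij_group"
proof (rule group.subgroupI[OF group_BijGroup])
  show "Aut_stab L S \<subseteq> carrier bij_group" using autoD(1) by (auto simp: Aut_stab_def bij_group_simps)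
  have "\<one>\<^bsub>bij_group\<^esub> ` S = S" using assms by (auto simp: bij_group_simps)
  then show "Aut_stab L S \<noteq> {}" using one_auto by (auto simp: Aut_stab_def)
  show "inv\<^bsub>bij_group\<^esub> f \<in> Aut_stab L S" if "f \<in> Aut_stab L S" for f
  proof -
    have f: "f \<in> leibniz_auto L" "f ` S = S" using that by (auto simp: Aut_stab_def)
    have "(inv\<^bsub>bij_group\<^esub> f) ` (f ` S) = S"
      using auto_inv(3)[OF f(1)] assms by (force simp: image_image)
    then show ?thesis using f inv_auto by (simp add: Aut_stab_def)
  qed
  show "f \<otimes>\<^bsub>bij_group\<^esub> g \<in> Aut_stab L S" if "f \<in> Aut_stab L S" "g \<in> Aut_stab L S" for f g
  proof -
    have fg: "f \<in> leibniz_auto L" "f ` S = S" "g \<in> leibniz_auto L" "g ` S = S"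
      using that by (auto simp: Aut_stab_def)
    have "compose (carrier L) f g ` S = f ` (g ` S)"
      using assms by (auto simp: compose_eq image_iff subset_iff)
    then show ?thesis using fg mult_auto by (simp add: Aut_stab_def auto_mult)
  qed
qed

lemma Aut_zero_subgroup: "subgroup (Aut_zero L) bij_group"
proof (rule group.subgroupI[OF group_BijGroup])
  show "Aut_zero L \<subseteq> carrier bij_group" using autoD(1) by (auto simp: Aut_zero_def bij_group_simps)
  show "Aut_zero L \<noteq> {}" using one_auto kernel_carrier by (auto simp: Aut_zero_def bij_group_simps)
  show "inv\<^bsub>bij_group\<^esub> f \<in> Aut_zero L" if "f \<in> Aut_zero L" for f
  proof -
    have "(inv\<^bsub>bij_group\<^esub> f) x = x" if "x \<in> leibniz_kernel L" for x
      using auto_inv(3)[of f x] \<open>f \<in> Aut_zero L\<close> that kernel_carrier by (simp add: Aut_zero_def)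
    then show ?thesis using that inv_auto by (simp add: Aut_zero_def)
  qed
  show "f \<otimes>\<^bsub>bij_group\<^esub> g \<in> Aut_zero L" if "f \<in> Aut_zero L" "g \<in> Aut_zero L" for f g
    using that mult_auto kernel_carrier by (auto simp: Aut_zero_def auto_mult compose_eq)
qed

lemma leibniz_Aut_eq: "leibniz_Aut L = bij_group\<lparr>carrier := leibniz_auto L\<rparr>"
  by (simp add: leibniz_Aut_def)

lemma leibniz_Aut_group: "group (leibniz_Aut L)"
  unfolding leibniz_Aut_eq by (rule subgroup.subgroup_is_group[OF auto_subgroup group_BijGroup])

text \<open>\<open>Aut_zero L\<close> is the kernel of the homomorphism that restricts automorphisms
  to the subspace \<open>leibniz_kernel L\<close>, which they preserve. In the conjugate, the
  inverse of \<open>f\<close> therefore keeps \<open>i\<close> where \<open>h\<close> acts as the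
  identity.\<close>

lemma Aut_zero_normal: "Aut_zero L \<lhd> leibniz_Aut L"
  unfolding group.normal_inv_iff[OF leibniz_Aut_group]
proof (intro conjI ballI)
  show "subgroup (Aut_zero L) (leibniz_Aut L)"
    unfolding leibniz_Aut_eq
    by (rule group.subgroup_incl[OF group_BijGroup Aut_zero_subgroup auto_subgroup]) (auto simp: Aut_zero_def)
  fix f h assume "f \<in> carrier (leibniz_Aut L)" and h: "h \<in> Aut_zero L"
  then have f: "f \<in> leibniz_auto L" by (simp add: leibniz_Aut_def)
  have h': "h \<in> leibniz_auto L" using h by (simp add: Aut_zero_def)
  \<comment> \<open>Inverses in the subgroup agree with those of the ambient group, to which
    \<open>auto_inv\<close> applies.\<close>
  have inv: "inv\<^bsub>leibniz_Aut L\<^esub> f = inv\<^bsub>bij_group\<^esub> f"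
    unfolding leibniz_Aut_eq using group.m_inv_consistent[OF group_BijGroup auto_subgroup f] by simp
  have "(f \<otimes>\<^bsub>bij_group\<^esub> h \<otimes>\<^bsub>bij_group\<^esub> inv\<^bsub>bij_group\<^esub> f) i = i" if i: "i \<in> leibniz_kernel L" for i
  proof -
    have "(inv\<^bsub>bij_group\<^esub> f) i \<in> leibniz_kernel L"
      using auto_kernel[OF inv_auto[OF f]] i by blast
    then have "h ((inv\<^bsub>bij_group\<^esub> f) i) = (inv\<^bsub>bij_group\<^esub> f) i" using h by (simp add: Aut_zero_def)
    then show ?thesis
      using auto_inv[OF f kernel_carrier[OF i]] kernel_carrier[OF i] f h' mult_auto inv_auto
      by (simp add: auto_mult compose_eq)
  qed
  then have "f \<otimes>\<^bsub>bij_group\<^esub> h \<otimes>\<^bsub>bij_group\<^esub> inv\<^bsub>bij_group\<^esub> f \<in> Aut_zero L"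
    using f h' mult_auto inv_auto by (simp add: Aut_zero_def)
  then show "f \<otimes>\<^bsub>leibniz_Aut L\<^esub> h \<otimes>\<^bsub>leibniz_Aut L\<^esub> inv\<^bsub>leibniz_Aut L\<^esub> f \<in> Aut_zero L"
    unfolding inv by (simp add: leibniz_Aut_def)
qed

end

section \<open>Splitting an automorphism along the complement\<close>

lemma (in leibniz_algebra) complement_projection:
  assumes S: "leibniz_subalgebra L S" and sum: "internal_direct_sum L S (leibniz_kernel L)"
  obtains p where "\<And>x. x \<in> carrier L \<Longrightarrow> p x \<in> S"
    "\<And>x. x \<in> carrier L \<Longrightarrow> x \<ominus> p x \<in> leibniz_kernel L"
    "\<And>x s. x \<in> carrier L \<Longrightarrow> s \<in> S \<Longrightarrow> x \<ominus> s \<in> leibniz_kernel L \<Longrightarrow> p x = s"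
proof -
  have S_sub: "VectorSpace.subspace CC S L" using S by (simp add: leibniz_subalgebra_def)
  have S_car: "x \<in> S \<Longrightarrow> x \<in> carrier L" for x using S_sub by (auto simp: subspace_iff)
  have "\<exists>!s. s \<in> S \<and> x \<ominus> s \<in> leibniz_kernel L" if x: "x \<in> carrier L" for x
  proof -
    obtain s i where si: "s \<in> S" "i \<in> leibniz_kernel L" "x = s \<oplus> i"
      using sum x by (rule internal_direct_sumE)
    have xs: "x \<ominus> s \<in> leibniz_kernel L" using si S_car kernel_carrier by (simp add: add_minus_cancel_left)
    have "t = s" if t: "t \<in> S" "x \<ominus> t \<in> leibniz_kernel L" for t
    proof -
      \<comment> \<open>Two candidates differ by an element of \<open>S\<close> that also lies in
        the kernel.\<close>
      have "t \<ominus> s = (x \<ominus> s) \<ominus> (x \<ominus> t)"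
        using x t(1) si(1) S_car
        by (simp add: a_minus_def minus_add a_ac r_neg1 r_neg2) (simp add: a_lcomm[of x "\<ominus> s" "\<ominus> x"] r_neg)
      then have "t \<ominus> s \<in> leibniz_kernel L"
        using subspace_CC_minus[OF vectorspace_axioms kernel_subspace xs t(2)] by simp
      moreover have "t \<ominus> s \<in> S" using subspace_CC_minus[OF vectorspace_axioms S_sub t(1) si(1)] .
      ultimately have "t \<ominus> s = \<zero>" using sum by (auto simp: internal_direct_sum_def)
      then show ?thesis using t si S_car by simp
    qed
    then show ?thesis using si(1) xs by blast
  qed
  note unique = this
  show thesis
    by (rule that[of "\<lambda>x. THE s. s \<in> S \<and> x \<ominus> s \<in> leibniz_kernel L"])
      (use theI'[OF unique] the1_equality[OF unique] in auto)
qed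


text \<open>Because \<open>I\<close> is an ideal, the projection \<open>p\<close> is an algebra
  homomorphism onto \<open>S\<close>, and \<open>p\<close> after \<open>f\<close> restricts to an
  automorphism \<open>h\<close> of \<open>S\<close>. What remains is the mixed bracket of
  \<open>I\<close> with \<open>S\<close>, where \<open>f_br\<close> replaces \<open>f t\<close> by
  \<open>h t\<close>.\<close>

lemma (in leibniz_algebra) stabilizing_part_exists:
  assumes S: "leibniz_subalgebra L S" and sum: "internal_direct_sum L S (leibniz_kernel L)"
    and f: "f \<in> leibniz_auto L"
  obtains g where "g \<in> Aut_stab L S" "\<And>i. i \<in> leibniz_kernel L \<Longrightarrow> g i = f i"
proof -
  define I where "I = leibniz_kernel L"
  obtain p where p: "\<And>x. x \<in> carrier L \<Longrightarrow> p x \<in> S" "\<And>x. x \<in> carrier L \<Longrightarrow> x \<ominus> p x \<in> I"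
    and p_unique: "\<And>x s. x \<in> carrier L \<Longrightarrow> s \<in> S \<Longrightarrow> x \<ominus> s \<in> I \<Longrightarrow> p x = s"
    using complement_projection[OF S sum] unfolding I_def by metis
  note [simp] = bracket_closed
  have S_sub: "VectorSpace.subspace CC S L" using S by (simp add: leibniz_subalgebra_def)
  have S_car [simp]: "x \<in> S \<Longrightarrow> x \<in> carrier L" for x using S_sub by (auto simp: subspace_iff)
  have S_br [simp]: "x \<in> S \<Longrightarrow> y \<in> S \<Longrightarrow> \<lbrace>x, y\<rbrace> \<in> S" for x y
    using S by (simp add: leibniz_subalgebra_def)
  have S_ops [simp]: "x \<in> S \<Longrightarrow> y \<in> S \<Longrightarrow> x \<oplus> y \<in> S" "x \<in> S \<Longrightarrow> a \<odot>\<^bsub>L\<^esub> x \<in> S" "\<zero> \<in> S" for x y a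
    using S_sub by (simp_all add: subspace_iff)
  have I_sub: "VectorSpace.subspace CC I L" by (simp add: I_def kernel_subspace)
  have I_car [simp]: "x \<in> I \<Longrightarrow> x \<in> carrier L" for x using I_sub by (auto simp: subspace_iff)
  have I_ops [simp]: "x \<in> I \<Longrightarrow> y \<in> I \<Longrightarrow> x \<oplus> y \<in> I" "x \<in> I \<Longrightarrow> a \<odot>\<^bsub>L\<^esub> x \<in> I" "\<zero> \<in> I" for x y a
    using I_sub by (simp_all add: subspace_iff)
  have xI [simp]: "\<lbrace>x, i\<rbrace> = \<zero>" if "x \<in> carrier L" "i \<in> I" for x i
    using bracket_kernel_right that by (simp add: I_def)
  have Ix [simp]: "\<lbrace>i, x\<rbrace> \<in> I" if "x \<in> carrier L" "i \<in> I" for x i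
    using kernel_ideal that by (simp add: leibniz_ideal_def I_def)
  have fI: "f ` I = I" using auto_kernel[OF f] by (simp add: I_def)
  have f_I [simp]: "f i \<in> I" if "i \<in> I" for i using fI that by blast
  note [simp] = autoD(3-6)[OF f]
  have p_sum [simp]: "p (s \<oplus> i) = s" if "s \<in> S" "i \<in> I" for s i
    using that by (intro p_unique) (simp_all add: add_minus_cancel_left)
  have dec: "\<exists>s\<in>S. \<exists>i\<in>I. x = s \<oplus> i" if "x \<in> carrier L" for x
    using sum that unfolding internal_direct_sum_def I_def by (metis mem_set_add_iff)
  have p_add: "p (x \<oplus> y) = p x \<oplus> p y" if xy: "x \<in> carrier L" "y \<in> carrier L" for x y
  proof -
    obtain s i t j where d: "s \<in> S" "i \<in> I" "x = s \<oplus> i" "t \<in> S" "j \<in> I" "y = t \<oplus> j"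
      using dec[OF xy(1)] dec[OF xy(2)] by blast
    have "x \<oplus> y = (s \<oplus> t) \<oplus> (i \<oplus> j)" using d by (simp add: a_ac)
    then show ?thesis using d by (simp del: a_assoc)
  qed
  have p_smult: "p (a \<odot>\<^bsub>L\<^esub> x) = a \<odot>\<^bsub>L\<^esub> p x" if x: "x \<in> carrier L" for a x
  proof -
    obtain s i where d: "s \<in> S" "i \<in> I" "x = s \<oplus> i" using dec[OF x] by blast
    have "a \<odot>\<^bsub>L\<^esub> x = a \<odot>\<^bsub>L\<^esub> s \<oplus> a \<odot>\<^bsub>L\<^esub> i" using d smult_r_distr[of a s i] by simp
    then show ?thesis using d by simp
  qed
  have p_bracket: "p \<lbrace>x, y\<rbrace> = \<lbrace>p x, p y\<rbrace>" if xy: "x \<in> carrier L" "y \<in> carrier L" for x y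
  proof -
    obtain s i t j where d: "s \<in> S" "i \<in> I" "x = s \<oplus> i" "t \<in> S" "j \<in> I" "y = t \<oplus> j"
      using dec[OF xy(1)] dec[OF xy(2)] by blast
    have "\<lbrace>x, y\<rbrace> = \<lbrace>s, t\<rbrace> \<oplus> \<lbrace>i, t\<rbrace>" using d by (simp add: bracket_add_left bracket_add_right)
    then show ?thesis using d by simp
  qed
  have p_I: "p i = \<zero>" if "i \<in> I" for i using p_sum[of \<zero> i] that by simp
  have p_S: "p s = s" if "s \<in> S" for s using p_sum[of s \<zero>] that by simp
  define h where "h s = p (f s)" for s
  have h [simp]: "h s \<in> S" if "s \<in> S" for s using that by (simp add: h_def p)
  \<comment> \<open>If \<open>f s\<close> has no component in \<open>S\<close>, it lies in
    \<open>I\<close>, which \<open>f\<close> maps onto itself; injectivity of \<open>f\<close> then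
    puts \<open>s\<close> in S \<inter> I.\<close>
  have h_inj: "s = \<zero>" if s: "s \<in> S" "h s = \<zero>" for s
  proof -
    obtain t j where d: "t \<in> S" "j \<in> I" "f s = t \<oplus> j" using dec[of "f s"] s(1) by auto
    then have "t = \<zero>" using s(2) by (simp add: h_def)
    then have "f s \<in> I" using d by simp
    then have "f s \<in> f ` I" using fI by simp
    then obtain i where i: "i \<in> I" "f s = f i" by blast
    then have "s = i" using autoD(7)[OF f, of s i] s by simp
    then show ?thesis using p_I[OF i(1)] p_S[OF s(1)] by simp
  qed
  have h_surj: "\<exists>s\<in>S. h s = t" if t: "t \<in> S" for t
  proof -
    have "t \<in> f ` carrier L" using autoD(2)[OF f] S_car[OF t] by (simp add: bij_betw_def)
    then obtain x where x: "x \<in> carrier L" "f x = t" by blast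
    obtain s i where d: "s \<in> S" "i \<in> I" "x = s \<oplus> i" using dec[OF x(1)] by blast
    \<comment> \<open>Applying \<open>p\<close> removes the second term, so the component
      \<open>s\<close> of the preimage under \<open>f\<close> is a preimage under
      \<open>h\<close>.\<close>
    have "t = f s \<oplus> f i" using x d by simp
    then have "p t = h s" using d by (simp add: p_add h_def p_I p)
    then show ?thesis using d p_S[OF t] by auto
  qed
  \<comment> \<open>Restricting to the carrier makes \<open>g\<close> extensional, as membership in
    \<open>Bij\<close> demands.\<close>
  define g where "g = (\<lambda>x\<in>carrier L. h (p x) \<oplus> f (x \<ominus> p x))"
  have g: "g (s \<oplus> i) = h s \<oplus> f i" if "s \<in> S" "i \<in> I" for s i
    using that by (simp add: g_def add_minus_cancel_left)
  have g_car: "g x \<in> carrier L" if "x \<in> carrier L" for x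
    using dec[OF that] g by auto
  have g_S: "g s = h s" if "s \<in> S" for s
    using g[OF that, of \<zero>] that auto_zero[OF f] by simp
  have g_I: "g i = f i" if "i \<in> I" for i
  proof -
    have "h \<zero> = \<zero>" using auto_zero[OF f] p_I[of \<zero>] by (simp add: h_def)
    then show ?thesis using g[of \<zero> i] that by simp
  qed
  have h_ops: "h (s \<oplus> t) = h s \<oplus> h t" "h (a \<odot>\<^bsub>L\<^esub> s) = a \<odot>\<^bsub>L\<^esub> h s" "h \<lbrace>s, t\<rbrace> = \<lbrace>h s, h t\<rbrace>"
    if "s \<in> S" "t \<in> S" for s t a
    using that by (simp_all add: h_def p_add p_smult p_bracket)
  \<comment> \<open>\<open>f t\<close> and \<open>h t\<close> differ by an element of
    \<open>I\<close>, which contributes zero as a right argument.\<close>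
  have f_br: "f \<lbrace>i, t\<rbrace> = \<lbrace>f i, h t\<rbrace>" if it: "i \<in> I" "t \<in> S" for i t
  proof -
    have "f t = h t \<oplus> (f t \<ominus> h t)"
      using it by (simp add: a_minus_def a_lcomm[of "h t"] r_neg)
    moreover have "f t \<ominus> h t \<in> I" using it p(2)[of "f t"] by (simp add: h_def)
    ultimately have "\<lbrace>f i, f t\<rbrace> = \<lbrace>f i, h t\<rbrace> \<oplus> \<zero>"
      using it bracket_add_right[of "f i" "h t" "f t \<ominus> h t"] by simp
    then show ?thesis using it by simp
  qed
  have g_auto: "g \<in> leibniz_auto L"
  proof (rule leibniz_autoI)
    show "g \<in> extensional (carrier L)" by (simp add: g_def)
    show g_add: "g (x \<oplus> y) = g x \<oplus> g y" if xy: "x \<in> carrier L" "y \<in> carrier L" for x y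
    proof -
      obtain s i t j where d: "s \<in> S" "i \<in> I" "x = s \<oplus> i" "t \<in> S" "j \<in> I" "y = t \<oplus> j"
        using dec[OF xy(1)] dec[OF xy(2)] by blast
      have "x \<oplus> y = (s \<oplus> t) \<oplus> (i \<oplus> j)" using d by (simp add: a_ac)
      then have "g (x \<oplus> y) = h (s \<oplus> t) \<oplus> f (i \<oplus> j)" using d g[of "s \<oplus> t" "i \<oplus> j"] by simp
      also have "\<dots> = (h s \<oplus> f i) \<oplus> (h t \<oplus> f j)"
        using d by (simp add: h_ops a_ac)
      finally show ?thesis using d g by simp
    qed
    show g_smult: "g (a \<odot>\<^bsub>L\<^esub> x) = a \<odot>\<^bsub>L\<^esub> g x" if x: "x \<in> carrier L" for a x
    proof -
      obtain s i where d: "s \<in> S" "i \<in> I" "x = s \<oplus> i" using dec[OF x] by blast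
      have "a \<odot>\<^bsub>L\<^esub> x = a \<odot>\<^bsub>L\<^esub> s \<oplus> a \<odot>\<^bsub>L\<^esub> i" using d smult_r_distr[of a s i] by simp
      then have "g (a \<odot>\<^bsub>L\<^esub> x) = h (a \<odot>\<^bsub>L\<^esub> s) \<oplus> f (a \<odot>\<^bsub>L\<^esub> i)" using d g[of "a \<odot>\<^bsub>L\<^esub> s" "a \<odot>\<^bsub>L\<^esub> i"] by simp
      also have "\<dots> = a \<odot>\<^bsub>L\<^esub> (h s \<oplus> f i)"
        using d smult_r_distr[of a "h s" "f i"] by (simp add: h_ops)
      finally show ?thesis using d g by simp
    qed
    show "g \<lbrace>x, y\<rbrace> = \<lbrace>g x, g y\<rbrace>" if xy: "x \<in> carrier L" "y \<in> carrier L" for x y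
    proof -
      obtain s i t j where d: "s \<in> S" "i \<in> I" "x = s \<oplus> i" "t \<in> S" "j \<in> I" "y = t \<oplus> j"
        using dec[OF xy(1)] dec[OF xy(2)] by blast
      have "\<lbrace>x, y\<rbrace> = \<lbrace>s, t\<rbrace> \<oplus> \<lbrace>i, t\<rbrace>" using d by (simp add: bracket_add_left bracket_add_right)
      then have "g \<lbrace>x, y\<rbrace> = h \<lbrace>s, t\<rbrace> \<oplus> f \<lbrace>i, t\<rbrace>" using d g[of "\<lbrace>s, t\<rbrace>" "\<lbrace>i, t\<rbrace>"] by simp
      also have "\<dots> = \<lbrace>h s, h t\<rbrace> \<oplus> \<lbrace>f i, h t\<rbrace>" using d h_ops(3) f_br by simp
      also have "\<dots> = \<lbrace>h s \<oplus> f i, h t \<oplus> f j\<rbrace>"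
        using d by (simp add: bracket_add_left bracket_add_right)
      finally show ?thesis using d g by simp
    qed
    show "bij_betw g (carrier L) (carrier L)"
      unfolding bij_betw_def
    proof (intro conjI equalityI subsetI inj_onI)
      \<comment> \<open>Projecting h s + f i = 0 to \<open>S\<close> gives h s = 0, and then f i =
        0; both parts are injective.\<close>
      have ker: "x = \<zero>" if x: "x \<in> carrier L" "g x = \<zero>" for x
      proof -
        obtain s i where d: "s \<in> S" "i \<in> I" "x = s \<oplus> i" using dec[OF x(1)] by blast
        have hf: "h s \<oplus> f i = \<zero>" using x d g by simp
        then have hs: "h s = \<zero>" using p_sum[of "h s" "f i"] d p_I[of \<zero>] by simp
        then have "f i = f \<zero>" using hf d auto_zero[OF f] by simp
        then have "i = \<zero>" using autoD(7)[OF f, of i \<zero>] d by simp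
        then show ?thesis using h_inj[OF d(1) hs] d by simp
      qed
      fix x y assume xy: "x \<in> carrier L" "y \<in> carrier L" "g x = g y"
      have "g (x \<ominus> y) = g x \<ominus> g y"
        using xy by (simp add: a_minus_def uminus_eq_smult g_add g_smult g_car)
      then have "x \<ominus> y = \<zero>" using ker[of "x \<ominus> y"] xy g_car by simp
      then show "x = y" using xy by simp
    next
      fix y assume "y \<in> g ` carrier L"
      then show "y \<in> carrier L" using g_car by auto
    next
      fix y assume y: "y \<in> carrier L"
      obtain t j where d: "t \<in> S" "j \<in> I" "y = t \<oplus> j" using dec[OF y] by blast
      obtain s where s: "s \<in> S" "h s = t" using h_surj[OF d(1)] by blast
      have "j \<in> f ` I" using fI d(2) by simp
      then obtain i where i: "i \<in> I" "f i = j" by blast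
      have "y = g (s \<oplus> i)" using g s i d by simp
      moreover have "s \<oplus> i \<in> carrier L" using s i by simp
      ultimately show "y \<in> g ` carrier L" by blast
    qed
  qed
  have "g ` S = S"
  proof (intro equalityI subsetI)
    fix t assume "t \<in> S"
    from h_surj[OF this] obtain s where "s \<in> S" "h s = t" by blast
    then have "t = g s" "s \<in> S" by (simp_all add: g_S)
    then show "t \<in> g ` S" by blast
  qed (use g_S in auto)
  then have "g \<in> Aut_stab L S" using g_auto by (simp add: Aut_stab_def)
  then show thesis using that g_I by (simp add: I_def)
qed

lemma (in leibniz_algebra) stab_Int_zero:
  assumes S: "leibniz_subalgebra L S" and sum: "internal_direct_sum L S (leibniz_kernel L)"
    and faithful: "\<And>s. s \<in> S \<Longrightarrow> (\<And>i. i \<in> leibniz_kernel L \<Longrightarrow> \<lbrace>i, s\<rbrace> = \<zero>) \<Longrightarrow> s = \<zero>"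
    and f: "f \<in> Aut_stab L S" "f \<in> Aut_zero L"
  shows "f = (\<lambda>x\<in>carrier L. x)"
proof
  note [simp] = bracket_closed
  have fa: "f \<in> leibniz_auto L" and fS: "f ` S = S" and fI: "\<And>i. i \<in> leibniz_kernel L \<Longrightarrow> f i = i"
    using f by (auto simp: Aut_stab_def Aut_zero_def)
  have S_sub: "VectorSpace.subspace CC S L" using S by (simp add: leibniz_subalgebra_def)
  have S_car: "x \<in> S \<Longrightarrow> x \<in> carrier L" for x using S_sub by (auto simp: subspace_iff)
  have f_S: "f s = s" if s: "s \<in> S" for s
  proof -
    have fs: "f s \<in> S" using fS s by blast
    have "f s \<ominus> s = \<zero>"
    proof (rule faithful)
      show "f s \<ominus> s \<in> S" by (rule subspace_CC_minus[OF vectorspace_axioms S_sub fs s])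
      fix i assume i: "i \<in> leibniz_kernel L"
      have "\<lbrace>i, s\<rbrace> \<in> leibniz_kernel L" using kernel_ideal i S_car[OF s] by (simp add: leibniz_ideal_def)
      \<comment> \<open>[i, s] lies in the kernel and is therefore fixed, while \<open>f\<close>
        also maps it to [f i, f s] = [i, f s].\<close>
      then have "\<lbrace>i, s\<rbrace> = \<lbrace>i, f s\<rbrace>"
        using autoD(6)[OF fa, of i s] fI i kernel_carrier S_car[OF s] by simp
      then have "\<lbrace>i, f s \<ominus> s\<rbrace> = \<lbrace>i, s\<rbrace> \<ominus> \<lbrace>i, s\<rbrace>"
        using bracket_minus_right[of "f s" s i] i kernel_carrier S_car[OF s] S_car[OF fs] by simp
      then show "\<lbrace>i, f s \<ominus> s\<rbrace> = \<zero>"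
        using i kernel_carrier S_car[OF s] by (simp add: a_minus_def r_neg)
    qed
    then show ?thesis using S_car[OF s] S_car[OF fs] by simp
  qed
  fix x
  show "f x = (\<lambda>x\<in>carrier L. x) x"
  proof (cases "x \<in> carrier L")
    case True
    with sum obtain s i where d: "s \<in> S" "i \<in> leibniz_kernel L" "x = s \<oplus> i" by (rule internal_direct_sumE)
    then show ?thesis using True autoD(4)[OF fa] S_car kernel_carrier f_S fI by simp
  next
    case False
    \<comment> \<open>Off the carrier both sides are \<open>undefined\<close>, by
      extensionality.\<close>
    then show ?thesis using autoD(1)[OF fa] by (simp add: Bij_def extensional_def)
  qed
qed

theorem theorem5p7:
  fixes L :: "'v leibniz" and S :: "'v set"
  assumes "semisimple_leibniz L"
    and "\<not> decomposable L"
    and "leibniz_kernel L \<noteq> {\<zero>\<^bsub>L\<^esub>}"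
    and "leibniz_subalgebra L S"
    and "semisimple_lie (L\<lparr>carrier := S\<rparr>)"
    and "internal_direct_sum L S (leibniz_kernel L)"
  shows "internal_semidirect_product (leibniz_Aut L) (Aut_stab L S) (Aut_zero L)"
proof -
  interpret L: leibniz_algebra L using assms(1) by (simp add: semisimple_leibniz_def)
  have S_car: "S \<subseteq> carrier L" using assms(4) by (simp add: leibniz_subalgebra_def L.subspace_iff)
  have stab: "Aut_stab L S \<subseteq> leibniz_auto L" and zero: "Aut_zero L \<subseteq> leibniz_auto L"
    by (auto simp: Aut_stab_def Aut_zero_def)
  have Aut: "carrier (leibniz_Aut L) = leibniz_auto L" "f \<otimes>\<^bsub>leibniz_Aut L\<^esub> g = f \<otimes>\<^bsub>BijGroup (carrier L)\<^esub> g"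
    "\<one>\<^bsub>leibniz_Aut L\<^esub> = (\<lambda>x\<in>carrier L. x)" for f g
    by (simp_all add: leibniz_Aut_def BijGroup_def)
  show ?thesis
    unfolding internal_semidirect_product_def
  proof (intro conjI L.leibniz_Aut_group L.Aut_zero_normal)
    show stab_sub: "subgroup (Aut_stab L S) (leibniz_Aut L)"
      unfolding L.leibniz_Aut_eq
      by (rule group.subgroup_incl[OF group_BijGroup L.Aut_stab_subgroup[OF S_car] L.auto_subgroup stab])
    have zero_sub: "subgroup (Aut_zero L) (leibniz_Aut L)"
      using L.Aut_zero_normal by (rule normal_imp_subgroup)
    show "Aut_stab L S \<inter> Aut_zero L = {\<one>\<^bsub>leibniz_Aut L\<^esub>}"
    proof (intro equalityI subsetI)
      fix f assume "f \<in> Aut_stab L S \<inter> Aut_zero L"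
      then have f: "f \<in> Aut_stab L S" "f \<in> Aut_zero L" by simp_all
      have "f = (\<lambda>x\<in>carrier L. x)"
        by (rule L.stab_Int_zero[OF assms(4,6) annihilator_trivial[OF L.leibniz_algebra_axioms assms(2-6)] f])
      then show "f \<in> {\<one>\<^bsub>leibniz_Aut L\<^esub>}" by (simp add: Aut)
    qed (use subgroup.one_closed[OF stab_sub] subgroup.one_closed[OF zero_sub] in auto)
    show "Aut_stab L S <#>\<^bsub>leibniz_Aut L\<^esub> Aut_zero L = carrier (leibniz_Aut L)"
    proof (intro equalityI subsetI)
      fix f assume "f \<in> Aut_stab L S <#>\<^bsub>leibniz_Aut L\<^esub> Aut_zero L"
      then show "f \<in> carrier (leibniz_Aut L)"
        using stab zero L.mult_auto by (auto simp: set_mult_def Aut)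
    next
      fix f assume "f \<in> carrier (leibniz_Aut L)"
      then have f: "f \<in> leibniz_auto L" by (simp add: Aut)
      obtain g where g: "g \<in> Aut_stab L S" "\<And>i. i \<in> leibniz_kernel L \<Longrightarrow> g i = f i"
        using L.stabilizing_part_exists[OF assms(4,6) f] by blast
      have ga: "g \<in> leibniz_auto L" using g stab by blast
      \<comment> \<open>Since \<open>g\<close> and \<open>f\<close> agree on the kernel, this
        quotient fixes it pointwise.\<close>
      define h where "h = inv\<^bsub>BijGroup (carrier L)\<^esub> g \<otimes>\<^bsub>BijGroup (carrier L)\<^esub> f"
      have ha: "h \<in> leibniz_auto L" unfolding h_def by (rule L.mult_auto[OF L.inv_auto[OF ga] f])
      have "h i = i" if i: "i \<in> leibniz_kernel L" for i
        using L.auto_mult[OF L.inv_auto[OF ga] f] L.kernel_carrier[OF i] L.auto_inv(3)[OF ga, of i] g(2)[OF i]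
        by (simp add: h_def compose_eq)
      then have "h \<in> Aut_zero L" using ha by (simp add: Aut_zero_def)
      moreover have "f = g \<otimes>\<^bsub>BijGroup (carrier L)\<^esub> h"
      proof -
        interpret bij: group "BijGroup (carrier L)" by (rule group_BijGroup)
        have "g \<in> carrier (BijGroup (carrier L))" "f \<in> carrier (BijGroup (carrier L))"
          using L.autoD(1) ga f by (simp_all add: L.bij_group_simps)
        then show ?thesis by (simp add: h_def bij.m_assoc[symmetric])
      qed
      ultimately show "f \<in> Aut_stab L S <#>\<^bsub>leibniz_Aut L\<^esub> Aut_zero L"
        using g(1) by (auto simp: set_mult_def Aut)
    qed
  qed
qed

end
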